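(* The p-Vertex-Disjoint Paths problem can be solved in time $O(q^{2.5q+o(q)}\cdot n)$, where $q=k^2\cdot 2^k$ and $n$ is the input size, on graphs of neighborhood diversity at most $k$.
   Context: p-Vertex-Disjoint Paths problem: the input is an undirected graph $G=(V,E)$ and a set $P=\{(s_i,t_i)\}$ of pairs of start and end vertices $s_i,t_i\in V$ (the number of pairs is part of the input and not bounded). The question is whether there exist $|P|$ mutually vertex-disjoint paths $p_i$, with $p_i$ between $s_i$ and $t_i$. Two vertices $v,v'$ of a graph $G$ have the same type iff $N(v)\setminus\{v'\}=N(v')\setminus\{v\}$, where $N(v)$ denotes the neighborhood of $v$. A graph $G=(V,E)$ has neighborhood diversity at most $w$ if there exists a partition of $V$ into at most $w$ sets such that all vertices in each set have the same type. *)

theory Defs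
  imports Complex_Main "HOL-Library.Disjoint_Sets" "HOL-Library.Landau_Symbols"
begin

definition simple_graph :: "'a set \<Rightarrow> 'a set set \<Rightarrow> bool" where
  "simple_graph V E \<longleftrightarrow> finite V \<and> (\<forall>e\<in>E. e \<subseteq> V \<and> card e = 2)"

definition nbhd :: "'a set set \<Rightarrow> 'a \<Rightarrow> 'a set" where
  "nbhd E v = {u. {v, u} \<in> E}"

definition path_between :: "'a set \<Rightarrow> 'a set set \<Rightarrow> 'a \<Rightarrow> 'a \<Rightarrow> 'a list \<Rightarrow> bool" where
  "path_between V E s t p \<longleftrightarrow>
     p \<noteq> [] \<and> hd p = s \<and> last p = t \<and> distinct p \<and> set p \<subseteq> V \<and>
     successively (\<lambda>u v. {u, v} \<in> E) p"

definition has_disjoint_paths :: "'a set \<Rightarrow> 'a set set \<Rightarrow> ('a \<times> 'a) set \<Rightarrow> bool" where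
  "has_disjoint_paths V E P \<longleftrightarrow>
     (\<exists>p. (\<forall>(s, t)\<in>P. path_between V E s t (p (s, t))) \<and>
          disjoint_family_on (\<lambda>x. set (p x)) P)"

definition same_type :: "'a set set \<Rightarrow> 'a \<Rightarrow> 'a \<Rightarrow> bool" where
  "same_type E v v' \<longleftrightarrow> nbhd E v - {v'} = nbhd E v' - {v}"

definition nd_at_most :: "'a set \<Rightarrow> 'a set set \<Rightarrow> nat \<Rightarrow> bool" where
  "nd_at_most V E w \<longleftrightarrow>
     (\<exists>\<P>. partition_on V \<P> \<and> finite \<P> \<and> card \<P> \<le> w \<and>
          (\<forall>A\<in>\<P>. \<forall>v\<in>A. \<forall>v'\<in>A. same_type E v v'))"

text \<open>
  A word RAM with unit-cost instructions. A program uses finitely many registers; the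
  addressable memory is separate. The first argument of every instruction other than
  \<open>Store\<close> and the jumps is the target register.
\<close>

datatype instr =
    Const nat nat
  | Add nat nat nat
  | Sub nat nat nat
  | Mul nat nat nat
  | Div nat nat nat
  | Load nat nat
  | Store nat nat
  | Jump nat
  | Jump_Zero nat nat

record config =
  pc :: nat
  regs :: "nat \<Rightarrow> nat"
  mem :: "nat \<Rightarrow> nat"

definition set_reg :: "nat \<Rightarrow> nat \<Rightarrow> config \<Rightarrow> config" where
  "set_reg r x s = s\<lparr>pc := Suc (pc s), regs := (regs s)(r := x)\<rparr>"

fun exec :: "instr \<Rightarrow> config \<Rightarrow> config" where
  "exec (Const r x) s = set_reg r x s"
| "exec (Add r a b) s = set_reg r (regs s a + regs s b) s"
| "exec (Sub r a b) s = set_reg r (regs s a - regs s b) s"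
| "exec (Mul r a b) s = set_reg r (regs s a * regs s b) s"
| "exec (Div r a b) s = set_reg r (regs s a div regs s b) s"
| "exec (Load r a) s = set_reg r (mem s (regs s a)) s"
| "exec (Store a b) s = s\<lparr>pc := Suc (pc s), mem := (mem s)(regs s a := regs s b)\<rparr>"
| "exec (Jump l) s = s\<lparr>pc := l\<rparr>"
| "exec (Jump_Zero a l) s = s\<lparr>pc := (if regs s a = 0 then l else Suc (pc s))\<rparr>"

definition halted :: "instr list \<Rightarrow> config \<Rightarrow> bool" where
  "halted prog s \<longleftrightarrow> pc s \<ge> length prog"

definition step :: "instr list \<Rightarrow> config \<Rightarrow> config" where
  "step prog s = (if halted prog s then s else exec (prog ! pc s) s)"

definition init :: "nat list \<Rightarrow> config" where
  "init xs = \<lparr>pc = 0, regs = (\<lambda>r. if r = 0 then length xs else 0),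
              mem = (\<lambda>a. if a < length xs then xs ! a else 0)\<rparr>"

definition run :: "instr list \<Rightarrow> nat list \<Rightarrow> nat \<Rightarrow> config" where
  "run prog xs i = (step prog ^^ i) (init xs)"

text \<open>
  Unit cost is only meaningful for numbers of logarithmic length: all words occurring in the
  computation are required to be polynomial in input length plus running time, that is, to
  have at most \<open>c\<close> times logarithmically many bits. The answer is read off register 0.
\<close>

definition decides_in :: "instr list \<Rightarrow> nat \<Rightarrow> nat list \<Rightarrow> bool \<Rightarrow> nat \<Rightarrow> bool" where
  "decides_in prog c xs ans t \<longleftrightarrow>
     halted prog (run prog xs t) \<and>
     (regs (run prog xs t) 0 \<noteq> 0 \<longleftrightarrow> ans) \<and>
     (\<forall>i\<le>t. \<forall>a. regs (run prog xs i) a \<le> (length xs + t) ^ c \<and>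
                mem (run prog xs i) a \<le> (length xs + t) ^ c)"

text \<open>
  The vertices are numbered by their position in an arbitrary enumeration \<open>vs\<close>, the graph is
  given by adjacency lists (each preceded by its length, in arbitrary order), followed by
  the list of pairs. The code word has length \<open>2 + |V| + 2 |E| + 2 |P|\<close>.
\<close>

definition encodes :: "nat list \<Rightarrow> 'a set \<Rightarrow> 'a set set \<Rightarrow> ('a \<times> 'a) set \<Rightarrow> bool" where
  "encodes xs V E P \<longleftrightarrow>
     (\<exists>vs adj ps.
        distinct vs \<and> set vs = V \<and>
        length adj = length vs \<and>
        (\<forall>i<length vs. distinct (adj ! i) \<and>
           set (adj ! i) = {j. j < length vs \<and> vs ! j \<in> nbhd E (vs ! i)}) \<and>
        distinct ps \<and>
        set ps = {(i, j). i < length vs \<and> j < length vs \<and> (vs ! i, vs ! j) \<in> P} \<and>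
        xs = length vs # concat (map (\<lambda>l. length l # l) adj)
             @ length ps # concat (map (\<lambda>(i, j). [i, j]) ps))"

end

theory Submission
  imports Defs "HOL-Library.FuncSet" "HOL-Real_Asymp.Real_Asymp"
begin

text \<open>
  A pair whose ends are adjacent is joined by an edge. For any other pair \<open>(s, t)\<close> one replaces \<open>s\<close>
  by a free neighbour. Since vertices of one type are interchangeable, a solution is described by
  the numbers \<open>y (a, b, c)\<close> of such moves from type \<open>a\<close> to type \<open>c\<close> on the way to type \<open>b\<close>, and
  solutions correspond to the nonnegative integer points of a system with \<open>k\<^sup>3\<close> variables, \<open>k\<^sup>2 + k\<close>
  rows and coefficients of absolute value at most 1.

  To decide whether \<open>b + A y \<ge> 0\<close> is solvable with \<open>y < 2 ^ L\<close>, guess the parities \<open>z\<close> of \<open>y\<close> and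
  continue with \<open>(b + A z) div 2\<close> and \<open>L - 1\<close>. After \<open>i\<close> rounds all reachable vectors lie within
  distance about \<open>k\<^sup>3\<close> of \<open>b div 2 ^ i\<close>, so there are only \<open>(2 * k ^ 3 + 2) ^ (k\<^sup>2 + k)\<close> of them,
  independently of \<open>n\<close>. With one round per vertex this takes linear time for fixed \<open>k\<close>, and the
  factor \<open>2 ^ k ^ 3\<close> times a power of the number of vectors is far below the claimed bound.
\<close>

subsection \<open>A loop language for the word RAM\<close>

text \<open>The rows are inequalities because a solution need not be realised completely or in any
  given order. A pair with non-adjacent ends has an unmet demand in its row \<open>(a, b)\<close>;
  this forces a positive variable \<open>(a, b, c)\<close>, and the capacity row of \<open>c\<close>
  then supplies a free vertex. Paths grow greedily, and cycles among the types never have to be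
  excluded.

  The reachable vectors stay few because halving also halves the accumulated deviation: a round with
  at most Q columns turns a deviation d into (d + Q) / 2, and Q is the fixed point of this map.

  The machine model shapes the program. The exponent of the word bound is fixed before
  \<open>k\<close> is known, so a vector cannot be packed into one word; it is stored entry by
  entry, and repetitions are found by linear search. The types are not part of the input: each
  vertex is compared with one representative of every type found so far, which costs about
  \<open>k\<close> times the space of its adjacency list and is linear in total.\<close>

text \<open>
  \<open>Avg\<close> is primitive because a halved sum of two small values is small again, whereas the sum
  alone need not be (see \<open>safe\<close> below).
\<close>

datatype exp = Cn nat | Rg nat | Ar nat exp | Plus exp exp | Minus exp exp | Times exp exp | Avg exp exp

datatype com = Nop | Asg nat exp | Sto nat exp exp | Seq com com (infixr ";;" 60)
  | Cond exp com com | Loop exp com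

record st =
  rg :: "nat \<Rightarrow> nat"
  ar :: "nat \<Rightarrow> nat \<Rightarrow> nat"
  tm :: nat

fun eval :: "exp \<Rightarrow> st \<Rightarrow> nat" where
  "eval (Cn c) s = c"
| "eval (Rg r) s = rg s r"
| "eval (Ar a e) s = ar s a (eval e s)"
| "eval (Plus e f) s = eval e s + eval f s"
| "eval (Minus e f) s = eval e s - eval f s"
| "eval (Times e f) s = eval e s * eval f s"
| "eval (Avg e f) s = (eval e s + eval f s) div 2"

definition tick :: "st \<Rightarrow> st" where
  "tick s = s\<lparr>tm := Suc (tm s)\<rparr>"

fun sem :: "com \<Rightarrow> st \<Rightarrow> st" where
  "sem Nop s = s"
| "sem (Asg r e) s = s\<lparr>rg := (rg s)(r := eval e s), tm := Suc (tm s)\<rparr>"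
| "sem (Sto a i e) s = s\<lparr>ar := (ar s)(a := (ar s a)(eval i s := eval e s)), tm := Suc (tm s)\<rparr>"
| "sem (c ;; c') s = sem c' (sem c s)"
| "sem (Cond e c c') s = (if eval e s \<noteq> 0 then sem c (tick s) else sem c' (tick s))"
| "sem (Loop e c) s = ((\<lambda>s. sem c (tick s)) ^^ eval e s) (tick s)"

lemma tick_simps [simp]: "rg (tick s) = rg s" "ar (tick s) = ar s" "tm (tick s) = Suc (tm s)"
  by (simp_all add: tick_def)

lemma eval_cong: "rg s = rg s' \<Longrightarrow> ar s = ar s' \<Longrightarrow> eval e s = eval e s'"
  by (induction e) auto

lemma eval_tick [simp]: "eval e (tick s) = eval e s"
  by (rule eval_cong) auto

text \<open>
  Layout of the compiled program: the registers below \<open>D\<close> are the variables, the higher ones are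
  a stack for subexpressions and loop counters. Register 0 permanently holds the input length \<open>n\<close>,
  and cell \<open>i\<close> of array \<open>a\<close> has address \<open>n + KA * i + a\<close>.
\<close>

definition KA :: nat where "KA = 8"

text \<open>The machine has no copy instruction, so a register is copied by adding it to 0. Only
  registers from \<open>d\<close> on are written, which keeps variables and pending operands below
  \<open>d\<close> intact.\<close>

fun cexp :: "exp \<Rightarrow> nat \<Rightarrow> instr list" where
  "cexp (Cn c) d = [Const d c]"
| "cexp (Rg r) d = [Const d 0, Add d d r]"
| "cexp (Ar a e) d = cexp e d @ [Const (Suc d) KA, Mul d d (Suc d), Const (Suc d) a, Add d d (Suc d), Add d d 0, Load d d]"
| "cexp (Plus e f) d = cexp e d @ cexp f (Suc d) @ [Add d d (Suc d)]"
| "cexp (Minus e f) d = cexp e d @ cexp f (Suc d) @ [Sub d d (Suc d)]"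
| "cexp (Times e f) d = cexp e d @ cexp f (Suc d) @ [Mul d d (Suc d)]"
| "cexp (Avg e f) d = cexp e d @ cexp f (Suc d) @ [Add d d (Suc d), Const (Suc d) 2, Div d d (Suc d)]"

text \<open>Jump targets are absolute, hence the start address \<open>p\<close>. A loop evaluates
  its bound once and jumps back behind that evaluation; its body gets the stack base
  \<open>Suc d\<close>, so that the counter in \<open>d\<close> survives.\<close>

fun ccom :: "com \<Rightarrow> nat \<Rightarrow> nat \<Rightarrow> instr list" where
  "ccom Nop p d = []"
| "ccom (Asg r e) p d = cexp e d @ [Const (Suc d) 0, Add r d (Suc d)]"
| "ccom (Sto a i e) p d = cexp i d @ [Const (Suc d) KA, Mul d d (Suc d), Const (Suc d) a, Add d d (Suc d), Add d d 0]
     @ cexp e (Suc d) @ [Store d (Suc d)]"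
| "ccom (c ;; c') p d = (let i = ccom c p d in i @ ccom c' (p + length i) d)"
| "ccom (Cond e c c') p d =
    (let l = p + length (cexp e d); i = ccom c (l + 1) d; i' = ccom c' (l + length i + 2) d in
     cexp e d @ [Jump_Zero d (l + length i + 2)] @ i @ [Jump (l + length i + 2 + length i')] @ i')"
| "ccom (Loop e c) p d =
    (let l = p + length (cexp e d); i = ccom c (l + 3) (Suc d) in
     cexp e d @ [Jump_Zero d (l + length i + 4), Const (Suc d) 1, Sub d d (Suc d)] @ i @ [Jump l])"

section \<open>Correctness of the compiled code\<close>

definition bd :: "nat \<Rightarrow> config \<Rightarrow> bool" where
  "bd W s \<longleftrightarrow> (\<forall>r. regs s r \<le> W) \<and> (\<forall>x. mem s x \<le> W)"

text \<open>\<open>decides_in\<close> limits the words at every time, also in the middle of an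
  expression, so the bound \<open>W\<close> is demanded of all intermediate configurations.\<close>

definition runs :: "instr list \<Rightarrow> nat \<Rightarrow> config \<Rightarrow> nat \<Rightarrow> config \<Rightarrow> bool" where
  "runs prog W s t s' \<longleftrightarrow> (step prog ^^ t) s = s' \<and> (\<forall>i\<le>t. bd W ((step prog ^^ i) s))"

definition code_at :: "instr list \<Rightarrow> nat \<Rightarrow> instr list \<Rightarrow> bool" where
  "code_at prog p is \<longleftrightarrow> (\<forall>i<length is. p + i < length prog \<and> prog ! (p + i) = is ! i)"

lemma code_at_Nil [simp]: "code_at prog p []"
  by (simp add: code_at_def)

lemma code_at_Cons [simp]:
  "code_at prog p (x # is) \<longleftrightarrow> p < length prog \<and> prog ! p = x \<and> code_at prog (Suc p) is"
  by (auto simp: code_at_def less_Suc_eq_0_disj all_conj_distrib)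

lemma code_at_append [simp]:
  "code_at prog p (is @ js) \<longleftrightarrow> code_at prog p is \<and> code_at prog (p + length is) js"
  by (induction "is" arbitrary: p) auto

lemma runs_0 [simp]: "runs prog W s 0 s' \<longleftrightarrow> s = s' \<and> bd W s"
  by (auto simp: runs_def)

lemma runs_bd: "runs prog W s t s' \<Longrightarrow> bd W s \<and> bd W s'"
  unfolding runs_def by (metis funpow_0 le0 order_refl)

lemma runs_trans:
  assumes "runs prog W s t s'" "runs prog W s' t' s''"
  shows "runs prog W s (t + t') s''"
  unfolding runs_def
proof (intro conjI allI impI)
  show "(step prog ^^ (t + t')) s = s''"
    using assms unfolding runs_def by (metis add.commute comp_apply funpow_add)
next
  fix i assume i: "i \<le> t + t'"
  show "bd W ((step prog ^^ i) s)"
  proof (cases "i \<le> t")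
    case False
    then obtain j where j: "i = j + t" "j \<le> t'" using i
      by (metis add.commute add_le_cancel_left le_Suc_ex linorder_le_cases)
    then show ?thesis using assms unfolding runs_def by (simp add: funpow_add)
  qed (use assms in \<open>auto simp: runs_def\<close>)
qed

lemma runs_Cons:
  assumes "pc s < length prog" "exec (prog ! pc s) s = s1" "bd W s" "runs prog W s1 t s2"
  shows "runs prog W s (Suc t) s2"
proof -
  have "step prog s = s1" using assms by (simp add: step_def halted_def)
  then have "runs prog W s 1 s1"
    using assms(3) runs_bd[OF assms(4)] by (auto simp: runs_def le_Suc_eq)
  from runs_trans[OF this assms(4)] show ?thesis by simp
qed

text \<open>Nothing is claimed about memory below the address \<open>rg s 0\<close>, where the
  original input lies, or about registers from \<open>D\<close> on. The base address is read from
  variable 0, which \<open>wfc\<close> forbids to assign.\<close>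

definition rel :: "nat \<Rightarrow> config \<Rightarrow> st \<Rightarrow> bool" where
  "rel D cfg s \<longleftrightarrow> (\<forall>r<D. regs cfg r = rg s r) \<and>
     (\<forall>a<KA. \<forall>i. mem cfg (rg s 0 + KA * i + a) = ar s a i)"

fun wfe :: "nat \<Rightarrow> exp \<Rightarrow> bool" where
  "wfe D (Cn c) = True"
| "wfe D (Rg r) = (r < D)"
| "wfe D (Ar a e) = (a < KA \<and> wfe D e)"
| "wfe D (Plus e f) = (wfe D e \<and> wfe D f)"
| "wfe D (Minus e f) = (wfe D e \<and> wfe D f)"
| "wfe D (Times e f) = (wfe D e \<and> wfe D f)"
| "wfe D (Avg e f) = (wfe D e \<and> wfe D f)"

fun wfc :: "nat \<Rightarrow> com \<Rightarrow> bool" where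
  "wfc D Nop = True"
| "wfc D (Asg r e) = (0 < r \<and> r < D \<and> wfe D e)"
| "wfc D (Sto a i e) = (a < KA \<and> wfe D i \<and> wfe D e)"
| "wfc D (c ;; c') = (wfc D c \<and> wfc D c')"
| "wfc D (Cond e c c') = (wfe D e \<and> wfc D c \<and> wfc D c')"
| "wfc D (Loop e c) = (wfe D e \<and> wfc D c)"

text \<open>These are the words that the compiled code produces, intermediate sums included. In an
  address the extra \<open>KA\<close> covers the constants that are loaded to compute it.\<close>

fun ebnd :: "nat \<Rightarrow> exp \<Rightarrow> st \<Rightarrow> bool" where
  "ebnd W (Cn c) s = (c \<le> W)"
| "ebnd W (Rg r) s = True"
| "ebnd W (Ar a e) s = (ebnd W e s \<and> rg s 0 + KA * eval e s + a + KA \<le> W)"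
| "ebnd W (Plus e f) s = (ebnd W e s \<and> ebnd W f s \<and> eval e s + eval f s \<le> W)"
| "ebnd W (Minus e f) s = (ebnd W e s \<and> ebnd W f s)"
| "ebnd W (Times e f) s = (ebnd W e s \<and> ebnd W f s \<and> eval e s * eval f s \<le> W)"
| "ebnd W (Avg e f) s = (ebnd W e s \<and> ebnd W f s \<and> 2 \<le> W \<and> eval e s + eval f s \<le> W)"

fun cbnd :: "nat \<Rightarrow> com \<Rightarrow> st \<Rightarrow> bool" where
  "cbnd W Nop s = True"
| "cbnd W (Asg r e) s = ebnd W e s"
| "cbnd W (Sto a i e) s = (ebnd W i s \<and> ebnd W e s \<and> rg s 0 + KA * eval i s + a + KA \<le> W)"
| "cbnd W (c ;; c') s = (cbnd W c s \<and> cbnd W c' (sem c s))"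
| "cbnd W (Cond e c c') s = (ebnd W e s \<and> (if eval e s \<noteq> 0 then cbnd W c (tick s) else cbnd W c' (tick s)))"
| "cbnd W (Loop e c) s = (ebnd W e s \<and> 1 \<le> W \<and>
     (\<forall>i<eval e s. cbnd W c (tick (((\<lambda>s. sem c (tick s)) ^^ i) (tick s)))))"

lemma relD: "rel D cfg s \<Longrightarrow> r < D \<Longrightarrow> regs cfg r = rg s r"
  "rel D cfg s \<Longrightarrow> a < KA \<Longrightarrow> mem cfg (rg s 0 + KA * i + a) = ar s a i"
  by (auto simp: rel_def)

lemma rel_cong:
  "rel D cfg s \<Longrightarrow> (\<And>r. r < D \<Longrightarrow> regs cfg' r = regs cfg r) \<Longrightarrow> mem cfg' = mem cfg
    \<Longrightarrow> rg s' = rg s \<Longrightarrow> ar s' = ar s \<Longrightarrow> rel D cfg' s'"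
  by (simp add: rel_def)

lemma bd_set_reg [simp]: "bd W s \<Longrightarrow> bd W (set_reg r x s) \<longleftrightarrow> x \<le> W"
  by (auto simp: bd_def set_reg_def)

lemma set_reg_simps [simp]: "pc (set_reg r x s) = Suc (pc s)" "regs (set_reg r x s) = (regs s)(r := x)"
  "mem (set_reg r x s) = mem s"
  by (simp_all add: set_reg_def)

lemma bd_le: "bd W s \<Longrightarrow> regs s r \<le> W" "bd W s \<Longrightarrow> mem s x \<le> W"
  by (auto simp: bd_def)

text \<open>Registers above \<open>d\<close> are scratch space and stay unspecified.\<close>

definition post :: "nat \<Rightarrow> nat \<Rightarrow> nat \<Rightarrow> config \<Rightarrow> config \<Rightarrow> bool" where
  "post p d v s s' \<longleftrightarrow> pc s' = p \<and> regs s' d = v \<and> (\<forall>r<d. regs s' r = regs s r) \<and> mem s' = mem s"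

lemma address_runs:
  assumes "code_at prog p [Const (Suc d) KA, Mul d d (Suc d), Const (Suc d) a, Add d d (Suc d), Add d d 0]"
    and "pc cfg = p" "bd W cfg" "regs cfg 0 + KA * regs cfg d + a + KA \<le> W" "0 < d"
  shows "\<exists>cfg'. runs prog W cfg 5 cfg' \<and> post (p + 5) d (regs cfg 0 + KA * regs cfg d + a) cfg cfg'"
proof -
  have 5: "5 = Suc (Suc (Suc (Suc (Suc 0))))" by simp
  show ?thesis
    unfolding 5
    apply (intro exI conjI)
     apply (rule runs_Cons[OF _ refl], use assms in \<open>simp_all add: algebra_simps\<close>)+
    by (auto simp: post_def algebra_simps)
qed

lemma bin_runs:
  assumes "post q d v cfg cfg1" "post q' (Suc d) w cfg1 cfg2" "q' < length prog"
    "exec (prog ! q') cfg2 = set_reg d x cfg2" "bd W cfg2" "x \<le> W"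
  shows "\<exists>cfg'. runs prog W cfg2 (Suc 0) cfg' \<and> post (Suc q') d x cfg cfg'"
proof (intro exI conjI)
  show "runs prog W cfg2 (Suc 0) (set_reg d x cfg2)"
    by (rule runs_Cons[OF _ refl]) (use assms in \<open>simp_all add: post_def\<close>)
  show "post (Suc q') d x cfg (set_reg d x cfg2)"
    using assms by (simp add: post_def)
qed

lemma avg_runs:
  assumes "code_at prog p [Add d d (Suc d), Const (Suc d) 2, Div d d (Suc d)]"
    "pc cfg = p" "bd W cfg" "regs cfg d + regs cfg (Suc d) \<le> W" "2 \<le> W"
  shows "runs prog W cfg (Suc (Suc (Suc 0))) (set_reg d ((regs cfg d + regs cfg (Suc d)) div 2) (set_reg (Suc d) 2
       (set_reg d (regs cfg d + regs cfg (Suc d)) cfg)))"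
proof -
  have "(regs cfg d + regs cfg (Suc d)) div 2 \<le> W" using assms by linarith
  then show ?thesis
    by (intro runs_Cons[OF _ refl]) (use assms in simp_all)
qed

lemma rel_post:
  assumes "rel D cfg s" "post p d v cfg cfg'" "D \<le> d"
  shows "rel D cfg' s"
  using assms by (auto intro!: rel_cong[OF assms(1)] simp: post_def)

text \<open>Expression code contains no jumps, so its running time is its length, whatever the
  state.\<close>

lemma cexp_runs:
  assumes "code_at prog p (cexp e d)" "pc cfg = p" "bd W cfg" "rel D cfg s" "wfe D e" "D \<le> d" "0 < D"
    "ebnd W e s"
  shows "\<exists>cfg'. runs prog W cfg (length (cexp e d)) cfg' \<and>
    post (p + length (cexp e d)) d (eval e s) cfg cfg'"
  using assms
proof (induction e arbitrary: p d cfg)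
  case (Cn c)
  show ?case
    apply (intro exI conjI)
     apply (simp, rule runs_Cons[OF _ refl], use Cn in simp_all)
    by (auto simp: post_def)
next
  case (Rg r)
  have 2: "regs cfg r = rg s r" "rg s r \<le> W" "r \<noteq> d" using Rg relD bd_le by (fastforce, metis bd_le(1) relD(1) wfe.simps(2), simp)
  show ?case
    apply (intro exI conjI)
     apply (simp, (rule runs_Cons[OF _ refl], use Rg 2 in simp_all)+)
    by (auto simp: post_def 2)
next
  case (Ar a e)
  obtain cfg1 where 1: "runs prog W cfg (length (cexp e d)) cfg1"
    "post (p + length (cexp e d)) d (eval e s) cfg cfg1"
    using Ar.IH[of p d cfg] Ar.prems by auto
  have r0: "regs cfg1 0 = rg s 0" using 1(2) Ar.prems relD(1)[of D cfg s 0] by (auto simp: post_def)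
  obtain cfg2 where 2: "runs prog W cfg1 5 cfg2"
    "post (p + length (cexp e d) + 5) d (rg s 0 + KA * eval e s + a) cfg1 cfg2"
    using address_runs[of prog "p + length (cexp e d)" d a cfg1 W] 1 r0 Ar.prems runs_bd[OF 1(1)]
    by (auto simp: post_def)
  have pi: "prog ! (p + length (cexp e d) + 5) = Load d d" "p + length (cexp e d) + 5 < length prog"
    using Ar.prems(1) by (simp_all add: numeral_eq_Suc)
  have m: "mem cfg2 (rg s 0 + KA * eval e s + a) = ar s a (eval e s)"
    using 1 2 Ar.prems relD(2)[of D cfg s a "eval e s"] by (auto simp: post_def)
  have "\<exists>cfg'. runs prog W cfg2 (Suc 0) cfg' \<and> post (p + length (cexp e d) + 6) d (eval (Ar a e) s) cfg cfg'"
  proof (intro exI conjI)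
    show "runs prog W cfg2 (Suc 0) (set_reg d (ar s a (eval e s)) cfg2)"
      by (rule runs_Cons[OF _ refl]) (use pi Ar.prems(3-) 1 2 m runs_bd[OF 2(1)] bd_le(2)[of W cfg2 "rg s 0 + KA * eval e s + a"]
        in \<open>simp_all add: post_def\<close>)
    show "post (p + length (cexp e d) + 6) d (eval (Ar a e) s) cfg (set_reg d (ar s a (eval e s)) cfg2)"
      using 1 2 by (simp add: post_def)
  qed
  then obtain cfg3 where 3: "runs prog W cfg2 (Suc 0) cfg3"
    "post (p + length (cexp e d) + 6) d (eval (Ar a e) s) cfg cfg3" by blast
  have len: "length (cexp (Ar a e) d) = length (cexp e d) + (5 + Suc 0)" by simp
  have "p + length (cexp e d) + 6 = p + (length (cexp e d) + (5 + Suc 0))" by simp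
  then show ?case unfolding len using runs_trans[OF 1(1) runs_trans[OF 2(1) 3(1)]] 3(2) by metis
next
  case (Plus e f)
  obtain cfg1 where 1: "runs prog W cfg (length (cexp e d)) cfg1"
    "post (p + length (cexp e d)) d (eval e s) cfg cfg1"
    using Plus.IH(1)[of p d cfg] Plus.prems by auto
  have "rel D cfg1 s" using rel_post[OF Plus.prems(4) 1(2)] Plus.prems by simp
  moreover have "code_at prog (p + length (cexp e d)) (cexp f (Suc d))" "pc cfg1 = p + length (cexp e d)"
    "bd W cfg1" "wfe D f" "D \<le> Suc d" "ebnd W f s"
    using Plus.prems runs_bd[OF 1(1)] 1(2) by (auto simp: post_def)
  ultimately obtain cfg2 where 2: "runs prog W cfg1 (length (cexp f (Suc d))) cfg2"
    "post (p + length (cexp e d) + length (cexp f (Suc d))) (Suc d) (eval f s) cfg1 cfg2"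
    using Plus.IH(2) Plus.prems(7) by blast
  obtain cfg3 where 3: "runs prog W cfg2 (Suc 0) cfg3"
    "post (Suc (p + length (cexp e d) + length (cexp f (Suc d)))) d (eval (Plus e f) s) cfg cfg3"
    using bin_runs[OF 1(2) 2(2), of prog "eval (Plus e f) s" W] Plus.prems 1 2 runs_bd[OF 2(1)] by (auto simp: post_def)
  show ?case
  proof (intro exI conjI)
    show "runs prog W cfg (length (cexp (Plus e f) d)) cfg3"
      using runs_trans[OF 1(1) runs_trans[OF 2(1) 3(1)]] by simp
    show "post (p + length (cexp (Plus e f) d)) d (eval (Plus e f) s) cfg cfg3"
      using 3(2) by (simp add: add.assoc)
  qed
next
  case (Minus e f)
  obtain cfg1 where 1: "runs prog W cfg (length (cexp e d)) cfg1"
    "post (p + length (cexp e d)) d (eval e s) cfg cfg1"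
    using Minus.IH(1)[of p d cfg] Minus.prems by auto
  have "rel D cfg1 s" using rel_post[OF Minus.prems(4) 1(2)] Minus.prems by simp
  moreover have "code_at prog (p + length (cexp e d)) (cexp f (Suc d))" "pc cfg1 = p + length (cexp e d)"
    "bd W cfg1" "wfe D f" "D \<le> Suc d" "ebnd W f s"
    using Minus.prems runs_bd[OF 1(1)] 1(2) by (auto simp: post_def)
  ultimately obtain cfg2 where 2: "runs prog W cfg1 (length (cexp f (Suc d))) cfg2"
    "post (p + length (cexp e d) + length (cexp f (Suc d))) (Suc d) (eval f s) cfg1 cfg2"
    using Minus.IH(2) Minus.prems(7) by blast
  have "eval e s \<le> W" using 1 runs_bd[OF 1(1)] bd_le(1)[of W cfg1 d] by (auto simp: post_def)
  then have "eval (Minus e f) s \<le> W" by simp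
  then obtain cfg3 where 3: "runs prog W cfg2 (Suc 0) cfg3"
    "post (Suc (p + length (cexp e d) + length (cexp f (Suc d)))) d (eval (Minus e f) s) cfg cfg3"
    using bin_runs[OF 1(2) 2(2), of prog "eval (Minus e f) s" W] Minus.prems 1 2 runs_bd[OF 2(1)] by (auto simp: post_def)
  show ?case
  proof (intro exI conjI)
    show "runs prog W cfg (length (cexp (Minus e f) d)) cfg3"
      using runs_trans[OF 1(1) runs_trans[OF 2(1) 3(1)]] by simp
    show "post (p + length (cexp (Minus e f) d)) d (eval (Minus e f) s) cfg cfg3"
      using 3(2) by (simp add: add.assoc)
  qed
next
  case (Times e f)
  obtain cfg1 where 1: "runs prog W cfg (length (cexp e d)) cfg1"
    "post (p + length (cexp e d)) d (eval e s) cfg cfg1"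
    using Times.IH(1)[of p d cfg] Times.prems by auto
  have "rel D cfg1 s" using rel_post[OF Times.prems(4) 1(2)] Times.prems by simp
  moreover have "code_at prog (p + length (cexp e d)) (cexp f (Suc d))" "pc cfg1 = p + length (cexp e d)"
    "bd W cfg1" "wfe D f" "D \<le> Suc d" "ebnd W f s"
    using Times.prems runs_bd[OF 1(1)] 1(2) by (auto simp: post_def)
  ultimately obtain cfg2 where 2: "runs prog W cfg1 (length (cexp f (Suc d))) cfg2"
    "post (p + length (cexp e d) + length (cexp f (Suc d))) (Suc d) (eval f s) cfg1 cfg2"
    using Times.IH(2) Times.prems(7) by blast
  obtain cfg3 where 3: "runs prog W cfg2 (Suc 0) cfg3"
    "post (Suc (p + length (cexp e d) + length (cexp f (Suc d)))) d (eval (Times e f) s) cfg cfg3"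
    using bin_runs[OF 1(2) 2(2), of prog "eval (Times e f) s" W] Times.prems 1 2 runs_bd[OF 2(1)] by (auto simp: post_def)
  show ?case
  proof (intro exI conjI)
    show "runs prog W cfg (length (cexp (Times e f) d)) cfg3"
      using runs_trans[OF 1(1) runs_trans[OF 2(1) 3(1)]] by simp
    show "post (p + length (cexp (Times e f) d)) d (eval (Times e f) s) cfg cfg3"
      using 3(2) by (simp add: add.assoc)
  qed
next
  case (Avg e f)
  obtain cfg1 where 1: "runs prog W cfg (length (cexp e d)) cfg1"
    "post (p + length (cexp e d)) d (eval e s) cfg cfg1"
    using Avg.IH(1)[of p d cfg] Avg.prems by auto
  have "rel D cfg1 s" using rel_post[OF Avg.prems(4) 1(2)] Avg.prems by simp
  moreover have "code_at prog (p + length (cexp e d)) (cexp f (Suc d))" "pc cfg1 = p + length (cexp e d)"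
    "bd W cfg1" "wfe D f" "D \<le> Suc d" "ebnd W f s"
    using Avg.prems runs_bd[OF 1(1)] 1(2) by (auto simp: post_def)
  ultimately obtain cfg2 where 2: "runs prog W cfg1 (length (cexp f (Suc d))) cfg2"
    "post (p + length (cexp e d) + length (cexp f (Suc d))) (Suc d) (eval f s) cfg1 cfg2"
    using Avg.IH(2) Avg.prems(7) by blast
  have "\<exists>cfg'. runs prog W cfg2 (Suc (Suc (Suc 0))) cfg' \<and>
     post (p + length (cexp e d) + length (cexp f (Suc d)) + 3) d (eval (Avg e f) s) cfg cfg'"
  proof (intro exI conjI)
    show "runs prog W cfg2 (Suc (Suc (Suc 0))) (set_reg d (eval (Avg e f) s) (set_reg (Suc d) 2
       (set_reg d (eval e s + eval f s) cfg2)))"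
      using avg_runs[of prog "p + length (cexp e d) + length (cexp f (Suc d))" d cfg2 W] Avg.prems 1(2) 2(2) runs_bd[OF 2(1)]
      by (simp add: post_def)
    show "post (p + length (cexp e d) + length (cexp f (Suc d)) + 3) d (eval (Avg e f) s) cfg
       (set_reg d (eval (Avg e f) s) (set_reg (Suc d) 2 (set_reg d (eval e s + eval f s) cfg2)))"
      using 1 2 by (simp add: post_def)
  qed
  then obtain cfg3 where 3: "runs prog W cfg2 (Suc (Suc (Suc 0))) cfg3"
    "post (p + length (cexp e d) + length (cexp f (Suc d)) + 3) d (eval (Avg e f) s) cfg cfg3" by blast
  show ?case
  proof (intro exI conjI)
    show "runs prog W cfg (length (cexp (Avg e f) d)) cfg3"
      using runs_trans[OF 1(1) runs_trans[OF 2(1) 3(1)]] by simp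
    show "post (p + length (cexp (Avg e f) d)) d (eval (Avg e f) s) cfg cfg3"
      using 3(2) by (simp add: add.assoc numeral_3_eq_3)
  qed
qed

lemma assign_runs:
  assumes "code_at prog p [Const (Suc d) 0, Add r d (Suc d)]"
    and "pc cfg = p" "bd W cfg" "r \<le> d"
  shows "\<exists>cfg'. runs prog W cfg 2 cfg' \<and> pc cfg' = p + 2 \<and> mem cfg' = mem cfg \<and>
    (\<forall>r'<d. regs cfg' r' = (if r' = r then regs cfg d else regs cfg r'))"
proof (intro exI conjI)
  show "runs prog W cfg 2 (set_reg r (regs cfg d) (set_reg (Suc d) 0 cfg))"
    unfolding numeral_2_eq_2
    by (rule runs_Cons[OF _ refl] | use assms bd_le(1)[of W cfg d] in simp)+
qed (use assms in auto)

text \<open>The number of machine steps that one tick of \<open>tm\<close> has to pay for. A loop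
  adds four instructions per iteration and one last test, a conditional its test and the jump over
  the other branch.\<close>

fun csize :: "com \<Rightarrow> nat \<Rightarrow> nat" where
  "csize Nop d = 1"
| "csize (Asg r e) d = length (cexp e d) + 2"
| "csize (Sto a i e) d = length (cexp i d) + length (cexp e (Suc d)) + 6"
| "csize (c ;; c') d = csize c d + csize c' d"
| "csize (Cond e c c') d = length (cexp e d) + 2 + csize c d + csize c' d"
| "csize (Loop e c) d = length (cexp e d) + 5 + csize c (Suc d)"

lemma sem_tm: "tm s \<le> tm (sem c s)"
proof (induction c arbitrary: s)
  case (Seq c c')
  then show ?case by (metis le_trans sem.simps(4))
next
  case (Cond e c c')
  have "tm s \<le> tm (tick s)" by simp
  then show ?case using Cond[of "tick s"] by (metis le_trans sem.simps(5))
next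
  case (Loop e c)
  have "tm s \<le> tm (((\<lambda>s. sem c (tick s)) ^^ i) s)" for i s
  proof (induction i)
    case (Suc i)
    then show ?case using Loop[of "tick (((\<lambda>s. sem c (tick s)) ^^ i) s)"] by simp
  qed simp
  from this[where s = "tick s"] show ?case by (simp add: Suc_le_eq less_imp_le)
qed auto

lemma relD_regs: "rel D cfg s \<Longrightarrow> post p d v cfg cfg' \<Longrightarrow> r < D \<Longrightarrow> D \<le> d \<Longrightarrow> regs cfg' r = rg s r"
  by (auto simp: rel_def post_def)

lemma address_inj:
  fixes a b i j :: nat
  assumes "a < KA" "b < KA" "n + KA * i + a = n + KA * j + b"
  shows "a = b \<and> i = j"
proof -
  have "(KA * i + a) mod KA = (KA * j + b) mod KA" "(KA * i + a) div KA = (KA * j + b) div KA"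
    using assms by (simp_all add: add.assoc)
  then show ?thesis using assms by simp
qed

text \<open>The time bound has the form of a potential: \<open>csize c d * tm\<close> grows by at
  least the number of steps taken, and such bounds add up along sequences and iterations. The
  preserved registers from \<open>D\<close> to below \<open>d\<close> hold the counters of enclosing
  loops.\<close>

lemma ccom_runs:
  assumes "code_at prog p (ccom c p d)" "pc cfg = p" "bd W cfg" "rel D cfg s" "wfc D c" "D \<le> d" "0 < D"
    "cbnd W c s"
  shows "\<exists>t cfg'. runs prog W cfg t cfg' \<and> pc cfg' = p + length (ccom c p d) \<and> rel D cfg' (sem c s) \<and>
    (\<forall>r<d. D \<le> r \<longrightarrow> regs cfg' r = regs cfg r) \<and> t + csize c d * tm s \<le> csize c d * tm (sem c s)"
  using assms
proof (induction c arbitrary: p d cfg s)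
  case Nop
  then show ?case by (intro exI[of _ 0] exI[of _ cfg]) auto
next
  case (Asg r e)
  obtain cfg1 where 1: "runs prog W cfg (length (cexp e d)) cfg1"
    "post (p + length (cexp e d)) d (eval e s) cfg cfg1"
    using cexp_runs[of prog p e d cfg W D s] Asg by auto
  obtain cfg2 where 2: "runs prog W cfg1 2 cfg2" "pc cfg2 = p + length (cexp e d) + 2" "mem cfg2 = mem cfg1"
    "\<forall>r'<d. regs cfg2 r' = (if r' = r then regs cfg1 d else regs cfg1 r')"
    using assign_runs[of prog "p + length (cexp e d)" d r cfg1 W] Asg.prems 1 runs_bd[OF 1(1)]
    by (auto simp: post_def)
  have "rel D cfg2 (sem (Asg r e) s)"
    using Asg.prems 1(2) 2 by (auto simp: rel_def post_def)
  moreover have "\<forall>r<d. D \<le> r \<longrightarrow> regs cfg2 r = regs cfg r"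
    using Asg.prems 1(2) 2 by (auto simp: post_def)
  ultimately show ?case using runs_trans[OF 1(1) 2(1)] 2(2)
    by (intro exI[of _ "length (cexp e d) + 2"] exI[of _ cfg2]) auto
next
  case (Sto a i e)
  obtain cfg1 where 1: "runs prog W cfg (length (cexp i d)) cfg1"
    "post (p + length (cexp i d)) d (eval i s) cfg cfg1"
    using cexp_runs[of prog p i d cfg W D s] Sto by auto
  have r0: "regs cfg1 0 = rg s 0" using relD_regs[OF Sto.prems(4) 1(2)] Sto.prems by simp
  obtain cfg2 where 2: "runs prog W cfg1 5 cfg2"
    "post (p + length (cexp i d) + 5) d (rg s 0 + KA * eval i s + a) cfg1 cfg2"
    using address_runs[of prog "p + length (cexp i d)" d a cfg1 W] 1 r0 Sto.prems runs_bd[OF 1(1)]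
    by (auto simp: post_def)
  have rel2: "rel D cfg2 s" using rel_post[OF rel_post[OF Sto.prems(4) 1(2)] 2(2)] Sto.prems by simp
  obtain cfg3 where 3: "runs prog W cfg2 (length (cexp e (Suc d))) cfg3"
    "post (p + length (cexp i d) + 5 + length (cexp e (Suc d))) (Suc d) (eval e s) cfg2 cfg3"
    using cexp_runs[of prog "p + length (cexp i d) + 5" e "Suc d" cfg2 W D s] Sto.prems rel2 2 runs_bd[OF 2(1)]
    by (auto simp: post_def numeral_eq_Suc)
  let ?q = "p + length (cexp i d) + 5 + length (cexp e (Suc d))"
  define cfg4 where "cfg4 = exec (Store d (Suc d)) cfg3"
  have cfg4: "pc cfg4 = Suc ?q" "regs cfg4 = regs cfg3"
    "mem cfg4 = (mem cfg)(rg s 0 + KA * eval i s + a := eval e s)"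
    using 1 2 3 by (auto simp: cfg4_def post_def)
  have q: "?q < length prog" "prog ! ?q = Store d (Suc d)"
    using Sto.prems(1) by (simp_all add: numeral_eq_Suc)
  have bd3: "bd W cfg3" using runs_bd[OF 3(1)] by simp
  then have bd4: "bd W cfg4" by (auto simp: bd_def cfg4_def)
  have 4: "runs prog W cfg3 (Suc 0) cfg4"
    by (rule runs_Cons[OF _ refl]) (use q 3 bd3 bd4 in \<open>simp_all add: post_def cfg4_def\<close>)
  have "rel D cfg4 (sem (Sto a i e) s)"
    unfolding rel_def
  proof (intro conjI allI impI)
    fix r assume "r < D"
    then show "regs cfg4 r = rg (sem (Sto a i e) s) r"
      using Sto.prems 1 2 3 cfg4 relD(1)[OF Sto.prems(4), of r] by (simp add: post_def)
  next
    fix b j assume "b < KA"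
    then show "mem cfg4 (rg (sem (Sto a i e) s) 0 + KA * j + b) = ar (sem (Sto a i e) s) b j"
      using address_inj[of a b "rg s 0" "eval i s" j] Sto.prems(5) relD(2)[OF Sto.prems(4), of b j]
      by (auto simp: cfg4)
  qed
  moreover have "\<forall>r<d. D \<le> r \<longrightarrow> regs cfg4 r = regs cfg r"
    using 1 2 3 cfg4 by (auto simp: post_def)
  moreover note runs_trans[OF runs_trans[OF 1(1) 2(1)] runs_trans[OF 3(1) 4]]
  ultimately show ?case
    by (intro exI[of _ "length (cexp i d) + 5 + (length (cexp e (Suc d)) + Suc 0)"] exI[of _ cfg4])
      (auto simp: cfg4)
next
  case (Seq c c')
  obtain t1 cfg1 where 1: "runs prog W cfg t1 cfg1" "pc cfg1 = p + length (ccom c p d)" "rel D cfg1 (sem c s)"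
    "\<forall>r<d. D \<le> r \<longrightarrow> regs cfg1 r = regs cfg r" "t1 + csize c d * tm s \<le> csize c d * tm (sem c s)"
    using Seq.IH(1)[of p d cfg s] Seq.prems by (auto simp: Let_def)
  obtain t2 cfg2 where 2: "runs prog W cfg1 t2 cfg2"
    "pc cfg2 = p + length (ccom c p d) + length (ccom c' (p + length (ccom c p d)) d)" "rel D cfg2 (sem c' (sem c s))"
    "\<forall>r<d. D \<le> r \<longrightarrow> regs cfg2 r = regs cfg1 r"
    "t2 + csize c' d * tm (sem c s) \<le> csize c' d * tm (sem c' (sem c s))"
    using Seq.IH(2)[of "p + length (ccom c p d)" d cfg1 "sem c s"] Seq.prems 1 runs_bd[OF 1(1)]
    by (auto simp: Let_def)
  \<comment> \<open>Each half is paid for with its own constant. As time never decreases, the sum of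
    the two constants pays for both halves.\<close>
  note mult_le_mono2[OF sem_tm[of "sem c s" c'], of "csize c d"] mult_le_mono2[OF sem_tm[of s c], of "csize c' d"]
  then have "t1 + t2 + csize (c ;; c') d * tm s \<le> csize (c ;; c') d * tm (sem (c ;; c') s)"
    using 1(5) 2(5) unfolding csize.simps sem.simps add_mult_distrib by linarith
  then show ?case using runs_trans[OF 1(1) 2(1)] 1 2
    by (intro exI[of _ "t1 + t2"] exI[of _ cfg2]) (auto simp: Let_def)
next
  case (Cond e c c')
  define l i i' where "l = p + length (cexp e d)" and "i = ccom c (l + 1) d" and "i' = ccom c' (l + length i + 2) d"
  have code: "code_at prog p (cexp e d)" "l < length prog" "prog ! l = Jump_Zero d (l + length i + 2)"
    "code_at prog (l + 1) i" "l + 1 + length i < length prog"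
    "prog ! (l + 1 + length i) = Jump (l + length i + 2 + length i')" "code_at prog (l + length i + 2) i'"
    and len: "p + length (ccom (Cond e c c') p d) = l + length i + 2 + length i'"
    using Cond.prems(1) by (simp_all add: Let_def l_def i_def i'_def)
  obtain cfg1 where 1: "runs prog W cfg (length (cexp e d)) cfg1" "post l d (eval e s) cfg cfg1"
    using cexp_runs[of prog p e d cfg W D s] Cond.prems code by (auto simp: l_def)
  have bd1: "bd W cfg1" using runs_bd[OF 1(1)] by simp
  have rel1: "rel D cfg1 (tick s)"
    using rel_post[OF Cond.prems(4) 1(2)] Cond.prems by (auto intro!: rel_cong[of D cfg1 s])
  show ?case
  proof (cases "eval e s = 0")
    case False
    have 2: "runs prog W cfg1 (Suc 0) (cfg1\<lparr>pc := l + 1\<rparr>)"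
      by (rule runs_Cons[OF _ refl]) (use False 1 bd1 code in \<open>simp_all add: post_def bd_def\<close>)
    obtain t3 cfg3 where 3: "runs prog W (cfg1\<lparr>pc := l + 1\<rparr>) t3 cfg3" "pc cfg3 = l + 1 + length i"
      "rel D cfg3 (sem c (tick s))"
      "\<forall>r<d. D \<le> r \<longrightarrow> regs cfg3 r = regs cfg1 r" "t3 + csize c d * tm (tick s) \<le> csize c d * tm (sem c (tick s))"
      using Cond.IH(1)[of "l + 1" d "cfg1\<lparr>pc := l + 1\<rparr>" "tick s"] Cond.prems code runs_bd[OF 2] rel1 False
      by (auto simp: i_def rel_def)
    have 4: "runs prog W cfg3 (Suc 0) (cfg3\<lparr>pc := l + length i + 2 + length i'\<rparr>)"
      by (rule runs_Cons[OF _ refl]) (use 3 runs_bd[OF 3(1)] code in \<open>simp_all add: bd_def\<close>)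
    have le: "tm s \<le> tm (sem c (tick s))" "Suc (tm s) \<le> tm (sem c (tick s))"
      using sem_tm[of "tick s" c] by simp_all
    have tt: "length (cexp e d) + 2 + t3 + csize (Cond e c c') d * tm s \<le> csize (Cond e c c') d * tm (sem c (tick s))"
      using 3(5) mult_le_mono2[OF le(2), of "length (cexp e d) + 2"] mult_le_mono2[OF le(1), of "csize c' d"]
      unfolding csize.simps add_mult_distrib add_mult_distrib2 mult_Suc_right tick_simps by linarith
    note runs_trans[OF runs_trans[OF 1(1) 2] runs_trans[OF 3(1) 4]]
    moreover have "length (cexp e d) + Suc 0 + (t3 + Suc 0) = length (cexp e d) + 2 + t3" by simp
    ultimately have "runs prog W cfg (length (cexp e d) + 2 + t3) (cfg3\<lparr>pc := l + length i + 2 + length i'\<rparr>)"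
      by simp
    then show ?thesis unfolding len using False tt 3 1(2)
      by (intro exI[of _ "length (cexp e d) + 2 + t3"] exI[of _ "cfg3\<lparr>pc := l + length i + 2 + length i'\<rparr>"])
        (auto simp: rel_def post_def)
  next
    case True
    have 2: "runs prog W cfg1 (Suc 0) (cfg1\<lparr>pc := l + length i + 2\<rparr>)"
      by (rule runs_Cons[OF _ refl]) (use True 1 bd1 code in \<open>simp_all add: post_def bd_def\<close>)
    obtain t3 cfg3 where 3: "runs prog W (cfg1\<lparr>pc := l + length i + 2\<rparr>) t3 cfg3" "pc cfg3 = l + length i + 2 + length i'"
      "rel D cfg3 (sem c' (tick s))"
      "\<forall>r<d. D \<le> r \<longrightarrow> regs cfg3 r = regs cfg1 r" "t3 + csize c' d * tm (tick s) \<le> csize c' d * tm (sem c' (tick s))"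
      using Cond.IH(2)[of "l + length i + 2" d "cfg1\<lparr>pc := l + length i + 2\<rparr>" "tick s"] Cond.prems code runs_bd[OF 2] rel1 True
      by (auto simp: i'_def rel_def)
    have le: "tm s \<le> tm (sem c' (tick s))" "Suc (tm s) \<le> tm (sem c' (tick s))"
      using sem_tm[of "tick s" c'] by simp_all
    have tt: "length (cexp e d) + 1 + t3 + csize (Cond e c c') d * tm s \<le> csize (Cond e c c') d * tm (sem c' (tick s))"
      using 3(5) mult_le_mono2[OF le(2), of "length (cexp e d) + 2"] mult_le_mono2[OF le(1), of "csize c d"]
      unfolding csize.simps add_mult_distrib add_mult_distrib2 mult_Suc_right tick_simps by linarith
    have "runs prog W cfg (length (cexp e d) + 1 + t3) cfg3"
      using runs_trans[OF runs_trans[OF 1(1) 2] 3(1)] by simp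
    then show ?thesis unfolding len using True tt 3 1(2)
      by (intro exI[of _ "length (cexp e d) + 1 + t3"] exI[of _ "cfg3"])
        (auto simp: rel_def post_def)
  qed
next
  case (Loop e c)
  define l i where "l = p + length (cexp e d)" and "i = ccom c (l + 3) (Suc d)"
  have code: "code_at prog p (cexp e d)" "l < length prog" "prog ! l = Jump_Zero d (l + length i + 4)"
    "l + 1 < length prog" "prog ! (l + 1) = Const (Suc d) 1"
    "l + 2 < length prog" "prog ! (l + 2) = Sub d d (Suc d)"
    "code_at prog (l + 3) i" "l + 3 + length i < length prog" "prog ! (l + 3 + length i) = Jump l"
    and len: "p + length (ccom (Loop e c) p d) = l + length i + 4"
    using Loop.prems(1) by (simp_all add: Let_def l_def i_def numeral_eq_Suc)
  define n where "n = eval e s"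
  define S where "S j = ((\<lambda>s. sem c (tick s)) ^^ j) (tick s)" for j
  \<comment> \<open>The 4 counts the zero test, the constant 1, the subtraction and the jump back;
    the tick of each iteration pays for them.\<close>
  define K where "K = csize c (Suc d) + 4"
  obtain cfg1 where 1: "runs prog W cfg (length (cexp e d)) cfg1" "post l d (eval e s) cfg cfg1"
    using cexp_runs[of prog p e d cfg W D s] Loop.prems code by (auto simp: l_def)
  have rel1: "rel D cfg1 (tick s)"
    using rel_post[OF Loop.prems(4) 1(2)] Loop.prems by (auto intro!: rel_cong[of D cfg1 s])
  have "\<exists>t cfg'. runs prog W cfg1 t cfg' \<and> pc cfg' = l \<and> rel D cfg' (S j) \<and>
    (\<forall>r<d. D \<le> r \<longrightarrow> regs cfg' r = regs cfg1 r) \<and> regs cfg' d = n - j \<and> t + K * tm (S 0) \<le> K * tm (S j)" if "j \<le> n" for j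
    using that
  proof (induction j)
    case 0
    then show ?case using 1(2) rel1 runs_bd[OF 1(1)]
      by (intro exI[of _ 0] exI[of _ cfg1]) (auto simp: S_def post_def n_def)
  next
    case (Suc j)
    then obtain t2 cfg2 where 2: "runs prog W cfg1 t2 cfg2" "pc cfg2 = l" "rel D cfg2 (S j)"
      "\<forall>r<d. D \<le> r \<longrightarrow> regs cfg2 r = regs cfg1 r" "regs cfg2 d = n - j" "t2 + K * tm (S 0) \<le> K * tm (S j)"
      by auto
    define cfg3 where "cfg3 = set_reg d (n - Suc j) (set_reg (Suc d) 1 (cfg2\<lparr>pc := l + 1\<rparr>))"
    have bd2: "bd W cfg2" using runs_bd[OF 2(1)] by simp
    have W: "1 \<le> W" "n - Suc j \<le> W" using Loop.prems bd_le(1)[OF bd2, of d] 2 by auto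
    have bd2': "bd W (cfg2\<lparr>pc := l + 1\<rparr>)" using bd2 by (simp add: bd_def)
    have 3: "runs prog W cfg2 (Suc (Suc (Suc 0))) cfg3"
      apply (rule runs_Cons[where ?s1.0 = "cfg2\<lparr>pc := l + 1\<rparr>"])
         apply (use 2 Suc.prems code bd2 in \<open>simp_all add: cfg3_def\<close>)
      apply (rule runs_Cons[OF _ refl] | use 2 Suc.prems code bd2' W in simp)+
      done
    have rel3: "rel D cfg3 (tick (S j))"
      using 2(3) Loop.prems by (auto intro!: rel_cong[OF 2(3)] simp: cfg3_def)
    obtain t4 cfg4 where 4: "runs prog W cfg3 t4 cfg4" "pc cfg4 = l + 3 + length i"
      "rel D cfg4 (sem c (tick (S j)))" "\<forall>r<Suc d. D \<le> r \<longrightarrow> regs cfg4 r = regs cfg3 r"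
      "t4 + csize c (Suc d) * tm (tick (S j)) \<le> csize c (Suc d) * tm (sem c (tick (S j)))"
      using Loop.IH[of "l + 3" "Suc d" cfg3 "tick (S j)"] Loop.prems code runs_bd[OF 3] rel3 Suc.prems
      by (auto simp: i_def S_def n_def cfg3_def)
    have 5: "runs prog W cfg4 (Suc 0) (cfg4\<lparr>pc := l\<rparr>)"
      by (rule runs_Cons[OF _ refl]) (use 4 runs_bd[OF 4(1)] code in \<open>simp_all add: bd_def\<close>)
    have SS: "S (Suc j) = sem c (tick (S j))" by (simp add: S_def)
    have "tm (tick (S j)) \<le> tm (S (Suc j))" unfolding SS by (rule sem_tm)
    then have "t2 + 3 + t4 + 1 + K * tm (S 0) \<le> K * tm (S (Suc j))"
      using 2(6) 4(5) unfolding SS[symmetric] by (simp add: K_def algebra_simps)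
    moreover have "runs prog W cfg1 (t2 + 3 + t4 + 1) (cfg4\<lparr>pc := l\<rparr>)"
      using runs_trans[OF runs_trans[OF 2(1) 3] runs_trans[OF 4(1) 5]] by (simp add: numeral_eq_Suc)
    moreover have "rel D (cfg4\<lparr>pc := l\<rparr>) (S (Suc j))" using 4 by (auto simp: SS intro!: rel_cong[OF 4(3)])
    moreover have "\<forall>r<d. D \<le> r \<longrightarrow> regs (cfg4\<lparr>pc := l\<rparr>) r = regs cfg1 r"
      using 2 4 by (auto simp: cfg3_def)
    moreover have "regs (cfg4\<lparr>pc := l\<rparr>) d = n - Suc j" using 4 Loop.prems by (auto simp: cfg3_def)
    ultimately show ?case by (intro exI[of _ "t2 + 3 + t4 + 1"] exI[of _ "cfg4\<lparr>pc := l\<rparr>"]) auto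
  qed
  from this[of n] obtain t2 cfg2 where 2: "runs prog W cfg1 t2 cfg2" "pc cfg2 = l" "rel D cfg2 (S n)"
      "\<forall>r<d. D \<le> r \<longrightarrow> regs cfg2 r = regs cfg1 r" "regs cfg2 d = 0" "t2 + K * tm (S 0) \<le> K * tm (S n)"
    by auto
  have 3: "runs prog W cfg2 (Suc 0) (cfg2\<lparr>pc := l + length i + 4\<rparr>)"
    by (rule runs_Cons[OF _ refl]) (use 2 code runs_bd[OF 2(1)] in \<open>simp_all add: bd_def\<close>)
  have Sn: "sem (Loop e c) s = S n" by (simp add: S_def n_def)
  have "tm s \<le> tm (S n)" unfolding Sn[symmetric] by (rule sem_tm)
  \<comment> \<open>The tick on entering the loop pays for evaluating the bound and for the last
    test, even without any iteration.\<close>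
  moreover have "Suc (tm s) \<le> tm (S n)"
  proof -
    have "tm (tick s) \<le> tm (S j)" for j
      by (induction j) (simp_all add: S_def, metis le_SucI le_trans sem_tm tick_simps(3) Suc_leD)
    from this[of n] show ?thesis by simp
  qed
  ultimately have "length (cexp e d) + t2 + 1 + csize (Loop e c) d * tm s \<le> csize (Loop e c) d * tm (S n)"
    using 2(6) mult_le_mono2[OF \<open>Suc (tm s) \<le> tm (S n)\<close>, of "length (cexp e d) + 1"]
    by (simp add: K_def S_def algebra_simps)
  moreover have "runs prog W cfg (length (cexp e d) + t2 + 1) (cfg2\<lparr>pc := l + length i + 4\<rparr>)"
    using runs_trans[OF 1(1) runs_trans[OF 2(1) 3]] by simp
  ultimately show ?case unfolding len Sn using 2 1(2)
    by (intro exI[of _ "length (cexp e d) + t2 + 1"] exI[of _ "cfg2\<lparr>pc := l + length i + 4\<rparr>"])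
        (auto simp: rel_def post_def)
qed

subsection \<open>Word size\<close>

text \<open>
  Safe assignments increase the largest stored value by at most \<open>\<kappa>\<close>, so all variables and array
  cells stay linear in input length plus time. Other expressions occur only as addresses, loop
  bounds, tests and subtrahends, and these are polynomials in small values.
\<close>

fun safe :: "nat \<Rightarrow> exp \<Rightarrow> bool" where
  "safe \<kappa> (Cn c) = (c \<le> \<kappa>)"
| "safe \<kappa> (Rg r) = True"
| "safe \<kappa> (Ar a e) = True"
| "safe \<kappa> (Plus e f) = (case f of Cn c \<Rightarrow> c \<le> \<kappa> \<and> safe (\<kappa> - c) e | _ \<Rightarrow> False)"
| "safe \<kappa> (Minus e f) = safe \<kappa> e"
| "safe \<kappa> (Times e f) = False"
| "safe \<kappa> (Avg e f) = (safe \<kappa> e \<and> safe \<kappa> f)"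

fun csafe :: "nat \<Rightarrow> com \<Rightarrow> bool" where
  "csafe \<kappa> Nop = True"
| "csafe \<kappa> (Asg r e) = safe \<kappa> e"
| "csafe \<kappa> (Sto a i e) = safe \<kappa> e"
| "csafe \<kappa> (c ;; c') = (csafe \<kappa> c \<and> csafe \<kappa> c')"
| "csafe \<kappa> (Cond e c c') = (csafe \<kappa> c \<and> csafe \<kappa> c')"
| "csafe \<kappa> (Loop e c) = csafe \<kappa> c"

definition small :: "nat \<Rightarrow> st \<Rightarrow> bool" where
  "small X s \<longleftrightarrow> (\<forall>r. rg s r \<le> X) \<and> (\<forall>a i. ar s a i \<le> X)"

lemma small_mono: "small X s \<Longrightarrow> X \<le> Y \<Longrightarrow> small Y s"
  unfolding small_def by (meson le_trans)

lemma small_upd: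
  assumes "small X s" "v \<le> Y" "X \<le> Y"
  shows "small Y (s\<lparr>rg := (rg s)(r := v), tm := t\<rparr>)"
    "small Y (s\<lparr>ar := (ar s)(a := (ar s a)(i := v)), tm := t\<rparr>)" "small Y (tick s)"
  using small_mono[OF assms(1,3)] assms(2) by (auto simp: small_def)

text \<open>An array read is at most \<open>X\<close> whatever its index is, truncated subtraction
  only lowers a value, and a mean never exceeds the larger argument. Only constants count towards
  \<kappa>.\<close>

lemma eval_safe: "safe \<kappa> e \<Longrightarrow> small X s \<Longrightarrow> eval e s \<le> X + \<kappa>"
proof (induction e arbitrary: \<kappa>)
  case (Plus e f)
  then obtain c where c: "f = Cn c" "c \<le> \<kappa>" "safe (\<kappa> - c) e" by (auto split: exp.splits)
  then show ?case using Plus.IH(1)[OF c(3) Plus.prems(2)] by simp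
next
  case (Avg e f)
  then have "eval e s \<le> X + \<kappa>" "eval f s \<le> X + \<kappa>" by auto
  then show ?case by simp
next
  case (Minus e f)
  then show ?case by (metis diff_le_self eval.simps(5) le_trans safe.simps(5))
qed (auto simp: small_def trans_le_add1)

text \<open>Each assignment raises the maximum by at most \<kappa> and costs one tick, hence the
  maximum grows at most \<kappa> times as fast as time.\<close>

lemma small_sem:
  "csafe \<kappa> c \<Longrightarrow> small (X + \<kappa> * tm s) s \<Longrightarrow> small (X + \<kappa> * tm (sem c s)) (sem c s)"
proof (induction c arbitrary: s)
  case (Asg r e)
  then show ?case using eval_safe[of \<kappa> e "X + \<kappa> * tm s" s] by (auto intro!: small_upd(1)[of "X + \<kappa> * tm s"])
next
  case (Sto a i e)
  then show ?case using eval_safe[of \<kappa> e "X + \<kappa> * tm s" s] by (auto intro!: small_upd(2)[of "X + \<kappa> * tm s"])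
next
  case (Cond e c c')
  have "small (X + \<kappa> * tm (tick s)) (tick s)" using Cond.prems(2) by (auto intro!: small_upd(3)[of "X + \<kappa> * tm s"])
  then show ?case using Cond by simp
next
  case (Loop e c)
  have tick: "small (X + \<kappa> * tm (tick s)) (tick s)" if "small (X + \<kappa> * tm s) s" for s
    using that by (auto intro!: small_upd(3)[of "X + \<kappa> * tm s"])
  have "small (X + \<kappa> * tm (((\<lambda>s. sem c (tick s)) ^^ i) (tick s))) (((\<lambda>s. sem c (tick s)) ^^ i) (tick s))" for i
    by (induction i) (use Loop tick in auto)
  then show ?case by simp
qed auto

text \<open>An exponent that depends on the expression alone: if all stored values are at most
  \<open>Z\<close> \<ge> 2, the words occurring in the evaluation are at most
  \<open>Z ^ esz e\<close>. Sums add exponents just as products do.\<close>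

fun esz :: "exp \<Rightarrow> nat" where
  "esz (Cn c) = Suc c"
| "esz (Rg r) = 1"
| "esz (Ar a e) = esz e + a + 17"
| "esz (Plus e f) = esz e + esz f"
| "esz (Minus e f) = esz e + esz f"
| "esz (Times e f) = esz e + esz f"
| "esz (Avg e f) = esz e + esz f"

fun cesz :: "com \<Rightarrow> nat" where
  "cesz Nop = 1"
| "cesz (Asg r e) = esz e"
| "cesz (Sto a i e) = esz i + a + 17 + esz e"
| "cesz (c ;; c') = cesz c + cesz c'"
| "cesz (Cond e c c') = esz e + cesz c + cesz c'"
| "cesz (Loop e c) = esz e + cesz c"

lemma esz_pos: "0 < esz e"
  by (induction e) auto

lemma address_le:
  fixes Z :: nat
  assumes "2 \<le> Z" "v \<le> Z ^ k" "0 < k" "b \<le> Z"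
  shows "b + KA * v + a + KA \<le> Z ^ (k + a + 17)"
proof -
  have P: "Z \<le> Z ^ k" using assms by (simp add: self_le_power)
  \<comment> \<open>The 17 collects 1 for the base \<open>b\<close>, 8 for the factor
    \<open>KA\<close> and 8 for the last summand.\<close>
  have "a + 17 \<le> (2::nat) ^ (a + 17)" using less_exp[of "a + 17"] by linarith
  also have "\<dots> \<le> Z ^ (a + 17)" using assms by (simp add: power_mono)
  finally have 1: "Z ^ k * (a + 17) \<le> Z ^ k * Z ^ (a + 17)" by simp
  have "a \<le> Z ^ k * a" using P assms by simp
  then have "b + KA * v + a + KA \<le> Z ^ k * (a + 17)"
    using assms P unfolding KA_def add_mult_distrib2 by linarith
  also note 1
  also have "Z ^ k * Z ^ (a + 17) = Z ^ (k + a + 17)" by (simp add: power_add)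
  finally show ?thesis .
qed

text \<open>Numbers p, q \<ge> 2 satisfy p + q \<le> p * q.\<close>

lemma add_le_power_mult:
  fixes Z :: nat
  assumes "2 \<le> Z" "x \<le> Z ^ a" "y \<le> Z ^ b" "0 < a" "0 < b"
  shows "x + y \<le> Z ^ (a + b)"
proof -
  have "Z \<le> Z ^ a" "Z \<le> Z ^ b" using assms by (simp_all add: self_le_power)
  then obtain p q where "Z ^ a = 2 + p" "Z ^ b = 2 + q" using assms(1) by (meson le_Suc_ex le_trans)
  then have "Z ^ a + Z ^ b \<le> Z ^ a * Z ^ b" by (simp add: algebra_simps)
  then show ?thesis using assms by (simp add: power_add)
qed

lemma ebnd_small:
  assumes "small Z s" "2 \<le> Z"
  shows "eval e s \<le> Z ^ esz e \<and> (Z ^ esz e \<le> W \<longrightarrow> ebnd W e s)"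
proof (induction e)
  case (Cn c)
  have "c \<le> 2 ^ Suc c" using less_exp[of "Suc c"] by linarith
  also have "\<dots> \<le> Z ^ Suc c" using assms by (simp only: power_mono)
  finally show ?case by simp
next
  case (Rg r)
  then show ?case using assms by (simp add: small_def)
next
  case (Ar a e)
  have 1: "rg s 0 + KA * eval e s + a + KA \<le> Z ^ (esz e + a + 17)"
    using address_le[of Z "eval e s" "esz e" "rg s 0" a] Ar assms by (auto simp: esz_pos small_def)
  have "Z ^ 1 \<le> Z ^ (esz e + a + 17)" "Z ^ esz e \<le> Z ^ (esz e + a + 17)"
    using assms by (intro power_increasing; simp)+
  moreover have "ar s a (eval e s) \<le> Z" using assms by (simp add: small_def)
  ultimately show ?case using 1 Ar by auto
next
  case (Plus e f)
  then have "eval e s + eval f s \<le> Z ^ (esz e + esz f)" using assms by (auto intro!: add_le_power_mult simp: esz_pos)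
  moreover have "Z ^ esz e \<le> Z ^ (esz e + esz f)" "Z ^ esz f \<le> Z ^ (esz e + esz f)" using assms by (auto intro!: power_increasing)
  ultimately show ?case using Plus by auto
next
  case (Minus e f)
  have "Z ^ esz e \<le> Z ^ (esz e + esz f)" "Z ^ esz f \<le> Z ^ (esz e + esz f)" using assms by (auto intro!: power_increasing)
  then show ?case using Minus by auto
next
  case (Times e f)
  then have "eval e s * eval f s \<le> Z ^ (esz e + esz f)" by (simp add: power_add mult_le_mono)
  moreover have "Z ^ esz e \<le> Z ^ (esz e + esz f)" "Z ^ esz f \<le> Z ^ (esz e + esz f)" using assms by (auto intro!: power_increasing)
  ultimately show ?case using Times by auto
next
  case (Avg e f)
  then have 1: "eval e s + eval f s \<le> Z ^ (esz e + esz f)" using assms by (auto intro!: add_le_power_mult simp: esz_pos)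
  have "Z ^ 1 \<le> Z ^ (esz e + esz f)" using assms esz_pos[of e] by (intro power_increasing) auto
  then have "2 \<le> Z ^ (esz e + esz f)" using assms by simp
  moreover have "Z ^ esz e \<le> Z ^ (esz e + esz f)" "Z ^ esz f \<le> Z ^ (esz e + esz f)" using assms by (auto intro!: power_increasing)
  ultimately show ?case using Avg 1 by auto
qed

text \<open>Time only increases, so the final time bounds the stored values at every earlier moment,
  and one \<open>Z\<close> serves the whole run.\<close>

lemma cbnd_small:
  assumes "csafe \<kappa> c" "small (X + \<kappa> * tm s) s" "X + \<kappa> * tm (sem c s) \<le> Z" "2 \<le> Z" "Z ^ cesz c \<le> W"
  shows "cbnd W c s"
  using assms
proof (induction c arbitrary: s)
  case (Asg r e)
  have "small Z s" using Asg.prems by (auto intro!: small_mono[OF Asg.prems(2)])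
  then show ?case using ebnd_small[of Z s e W] Asg.prems by auto
next
  case (Sto a i e)
  have s: "small Z s" using Sto.prems by (auto intro!: small_mono[OF Sto.prems(2)])
  have "Z ^ (esz i + a + 17) \<le> Z ^ cesz (Sto a i e)" "Z ^ esz i \<le> Z ^ cesz (Sto a i e)" "Z ^ esz e \<le> Z ^ cesz (Sto a i e)"
    using Sto.prems by (auto intro!: power_increasing)
  moreover have "rg s 0 + KA * eval i s + a + KA \<le> Z ^ (esz i + a + 17)"
    using address_le[of Z "eval i s" "esz i" "rg s 0" a] ebnd_small[OF s, of i] Sto.prems s by (auto simp: esz_pos small_def)
  ultimately show ?case using ebnd_small[OF s, of i W] ebnd_small[OF s, of e W] Sto.prems(4,5)
    unfolding cbnd.simps by (meson le_trans)
next
  case (Seq c c')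
  have "Z ^ cesz c \<le> W" "Z ^ cesz c' \<le> W"
    by (rule le_trans[OF power_increasing Seq.prems(5)]; use Seq.prems in simp)+
  moreover have "X + \<kappa> * tm (sem c s) \<le> Z"
    using Seq.prems(3) mult_le_mono2[OF sem_tm[of "sem c s" c'], of \<kappa>] unfolding sem.simps by linarith
  ultimately show ?case using Seq small_sem[of \<kappa> c X s] by auto
next
  case (Cond e c c')
  have "Z ^ cesz c \<le> W" "Z ^ cesz c' \<le> W" "Z ^ esz e \<le> W"
    by (rule le_trans[OF power_increasing Cond.prems(5)]; use Cond.prems in simp)+
  moreover have "small (X + \<kappa> * tm (tick s)) (tick s)" using Cond.prems(2) by (auto intro!: small_upd(3)[of "X + \<kappa> * tm s"])
  moreover have "small Z s"
    using Cond.prems(3) mult_le_mono2[OF sem_tm[of s "Cond e c c'"], of \<kappa>]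
    by (intro small_mono[OF Cond.prems(2)]) linarith
  ultimately show ?case using Cond ebnd_small[of Z s e W] by auto
next
  case (Loop e c)
  define S where "S j = ((\<lambda>s. sem c (tick s)) ^^ j) (tick s)" for j
  have S: "S (Suc j) = sem c (tick (S j))" for j by (simp add: S_def)
  have Z: "Z ^ cesz c \<le> W" "Z ^ esz e \<le> W" "Z ^ 0 \<le> W"
    by (rule le_trans[OF power_increasing Loop.prems(5)]; use Loop.prems in simp)+
  have tick: "small (X + \<kappa> * tm (tick s)) (tick s)" if "small (X + \<kappa> * tm s) s" for s
    using that by (auto intro!: small_upd(3)[of "X + \<kappa> * tm s"])
  have small: "small (X + \<kappa> * tm (S j)) (S j)" for j
  proof (induction j)
    case 0
    then show ?case using tick[OF Loop.prems(2)] by (simp add: S_def)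
  next
    case (Suc j)
    then show ?case unfolding S using small_sem[of \<kappa> c X "tick (S j)"] Loop.prems(1) tick by simp
  qed
  have "tm (S j) \<le> tm (S (Suc j))" for j
    unfolding S using sem_tm[of "tick (S j)" c] by simp
  then have mono: "tm (S i) \<le> tm (S j)" if "i \<le> j" for i j
    using lift_Suc_mono_le[of "\<lambda>j. tm (S j)", OF _ that] by blast
  have "cbnd W c (tick (S i))" if "i < eval e s" for i
  proof (rule Loop.IH)
    show "small (X + \<kappa> * tm (tick (S i))) (tick (S i))" by (rule tick[OF small])
    have "X + \<kappa> * tm (S (Suc i)) \<le> X + \<kappa> * tm (S (eval e s))"
      by (intro add_left_mono mult_le_mono2 mono) (use that in simp)
    also have "\<dots> \<le> Z" using Loop.prems(3) by (simp add: S_def)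
    finally show "X + \<kappa> * tm (sem c (tick (S i))) \<le> Z" unfolding S .
  qed (use Loop.prems Z in auto)
  moreover have "small Z s"
    using Loop.prems(3) mult_le_mono2[OF sem_tm[of s "Loop e c"], of \<kappa>]
    by (intro small_mono[OF Loop.prems(2)]) linarith
  ultimately show ?case using ebnd_small[of Z s e W] Loop.prems Z by (auto simp: S_def)
qed auto

subsection \<open>Running a compiled program on an input\<close>

definition ini :: "nat list \<Rightarrow> st" where
  "ini xs = \<lparr>rg = (\<lambda>r. if r = 0 then length xs else 0),
     ar = (\<lambda>a i. if a = 0 \<and> i < length xs then xs ! i else 0), tm = 0\<rparr>"

text \<open>The input occupies the cells below \<open>n\<close> and array 0 the cells
  \<open>n + KA * i\<close>, so copying never overwrites what is still to be read. Counting down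
  suits the only conditional jump, which tests for zero.\<close>

definition prologue :: "nat \<Rightarrow> instr list" where
  "prologue D = [Const D 0, Add D D 0, Jump_Zero D 11, Const (D + 1) 1, Sub D D (D + 1), Load (D + 2) D,
     Const (D + 1) KA, Mul (D + 1) (D + 1) D, Add (D + 1) (D + 1) 0, Store (D + 1) (D + 2), Jump 2]"

text \<open>Register 0 holds the base of all arrays until the end, so the answer is formed in
  register 1 and moved only then.\<close>

definition compile :: "nat \<Rightarrow> com \<Rightarrow> instr list" where
  "compile D c = prologue D @ ccom c 11 D @ [Const 0 0, Add 0 0 1]"

lemma copy_runs:
  assumes "code_at prog 0 (prologue D)" "0 < D" "i \<le> length xs" "pc cfg = 2" "regs cfg D = i" "regs cfg 0 = length xs"
    "\<forall>j<length xs. mem cfg j = xs ! j" "bd W cfg" "(KA + 1) * length xs + KA \<le> W"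
  shows "\<exists>cfg'. runs prog W cfg (9 * i + 1) cfg' \<and> pc cfg' = 11 \<and> (\<forall>r<D. regs cfg' r = regs cfg r) \<and>
    mem cfg' = (\<lambda>x. if \<exists>j<i. x = length xs + KA * j then xs ! ((x - length xs) div KA) else mem cfg x)"
  using assms
proof (induction i arbitrary: cfg)
  case 0
  have "runs prog W cfg (Suc 0) (cfg\<lparr>pc := 11\<rparr>)"
    by (rule runs_Cons[OF _ refl]) (use 0 in \<open>simp_all add: prologue_def numeral_eq_Suc bd_def\<close>)
  then show ?case by (intro exI[of _ "cfg\<lparr>pc := 11\<rparr>"]) auto
next
  case (Suc i)
  define c1 where "c1 = cfg\<lparr>pc := 3\<rparr>"
  define c2 where "c2 = set_reg (D + 1) 1 c1"
  define c3 where "c3 = set_reg D i c2"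
  define c4 where "c4 = set_reg (D + 2) (xs ! i) c3"
  define c5 where "c5 = set_reg (D + 1) KA c4"
  define c6 where "c6 = set_reg (D + 1) (KA * i) c5"
  define c7 where "c7 = set_reg (D + 1) (length xs + KA * i) c6"
  define c8 where "c8 = c7\<lparr>pc := 10, mem := (mem c7)(length xs + KA * i := xs ! i)\<rparr>"
  define c9 where "c9 = c8\<lparr>pc := 2\<rparr>"
  have P: "prog ! 2 = Jump_Zero D 11" "prog ! 3 = Const (D + 1) 1" "prog ! 4 = Sub D D (D + 1)"
    "prog ! 5 = Load (D + 2) D" "prog ! 6 = Const (D + 1) KA" "prog ! 7 = Mul (D + 1) (D + 1) D"
    "prog ! 8 = Add (D + 1) (D + 1) 0" "prog ! 9 = Store (D + 1) (D + 2)" "prog ! 10 = Jump 2" "10 < length prog"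
    using Suc.prems(1) by (simp_all add: prologue_def numeral_eq_Suc)
  have x: "xs ! i \<le> W" using Suc.prems bd_le(2)[of W cfg i] by auto
  have ki: "KA * i \<le> KA * length xs" using Suc.prems(3) by simp
  have w: "length xs + KA * i \<le> W" "KA * i \<le> W" "KA \<le> W" "1 \<le> W" "i \<le> W"
    using Suc.prems(3,9) ki by (simp_all add: KA_def)
  have b1: "bd W c1" using Suc.prems(8) by (simp add: c1_def bd_def)
  have b2: "bd W c2" using b1 w by (simp add: c2_def)
  have b3: "bd W c3" using b2 w by (simp add: c3_def)
  have b4: "bd W c4" using b3 x by (simp add: c4_def)
  have b5: "bd W c5" using b4 w by (simp add: c5_def)
  have b6: "bd W c6" using b5 w by (simp add: c6_def)
  have b7: "bd W c7" using b6 w by (simp add: c7_def)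
  have b8: "bd W c8" using b7 x by (simp add: c8_def bd_def)
  have b9: "bd W c9" using b8 by (simp add: c9_def bd_def)
  have r7: "pc c7 = 9" "regs c7 (D + 1) = length xs + KA * i" "regs c7 (D + 2) = xs ! i" "mem c7 = mem cfg"
    "regs c7 D = i" "\<forall>r<D. regs c7 r = regs cfg r"
    by (auto simp: c7_def c6_def c5_def c4_def c3_def c2_def c1_def)
  have e1: "exec (prog ! pc cfg) cfg = c1" using Suc.prems P by (simp add: c1_def)
  have e2: "exec (prog ! pc c1) c1 = c2" using P by (simp add: c1_def c2_def)
  have e3: "exec (prog ! pc c2) c2 = c3" using Suc.prems P by (simp add: c1_def c2_def c3_def)
  have e4: "exec (prog ! pc c3) c3 = c4" using Suc.prems P by (simp add: c1_def c2_def c3_def c4_def)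
  have e5: "exec (prog ! pc c4) c4 = c5" using Suc.prems P by (simp add: c1_def c2_def c3_def c4_def c5_def)
  have e6: "exec (prog ! pc c5) c5 = c6" using Suc.prems P by (simp add: c1_def c2_def c3_def c4_def c5_def c6_def)
  have e7: "exec (prog ! pc c6) c6 = c7" using Suc.prems P
    by (simp add: c1_def c2_def c3_def c4_def c5_def c6_def c7_def ac_simps)
  have e8: "exec (prog ! pc c7) c7 = c8" using P r7 by (simp add: c8_def)
  have e9: "exec (prog ! pc c8) c8 = c9" using P by (simp add: c9_def c8_def)
  have p: "pc cfg < length prog" "pc c1 < length prog" "pc c2 < length prog" "pc c3 < length prog" "pc c4 < length prog"
    "pc c5 < length prog" "pc c6 < length prog" "pc c7 < length prog" "pc c8 < length prog"
    using Suc.prems P by (simp_all add: c1_def c2_def c3_def c4_def c5_def c6_def c7_def c8_def)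
  have m9: "mem c9 = (mem cfg)(length xs + KA * i := xs ! i)" by (simp add: c9_def c8_def r7)
  obtain cfg' where "runs prog W c9 (9 * i + 1) cfg'" "pc cfg' = 11" "\<forall>r<D. regs cfg' r = regs c9 r"
    "mem cfg' = (\<lambda>x. if \<exists>j<i. x = length xs + KA * j then xs ! ((x - length xs) div KA) else mem c9 x)"
    using Suc.IH[of c9] Suc.prems r7 b9 by (auto simp: c9_def c8_def)
  note c' = this
  have "runs prog W cfg (9 + (9 * i + 1)) cfg'"
    using runs_Cons[OF p(1) e1 Suc.prems(8) runs_Cons[OF p(2) e2 b1 runs_Cons[OF p(3) e3 b2 runs_Cons[OF p(4) e4 b3
      runs_Cons[OF p(5) e5 b4 runs_Cons[OF p(6) e6 b5 runs_Cons[OF p(7) e7 b6 runs_Cons[OF p(8) e8 b7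
      runs_Cons[OF p(9) e9 b8 c'(1)]]]]]]]]]
    by (simp add: numeral_eq_Suc)
  moreover have "mem cfg' = (\<lambda>x. if \<exists>j<Suc i. x = length xs + KA * j then xs ! ((x - length xs) div KA) else mem cfg x)"
    unfolding c'(4) m9 by (rule ext) (auto simp: less_Suc_eq KA_def)
  moreover have "\<forall>r<D. regs cfg' r = regs cfg r" using c'(3) r7 by (auto simp: c9_def c8_def)
  ultimately show ?case using c'(2) by (intro exI[of _ cfg']) auto
qed

text \<open>In the time factor, \<open>csize c D\<close> pays for machine steps, \<kappa> makes
  \<open>length xs + t\<close> exceed every stored value, and 20 covers copying the input and the
  addresses used for it. The exponent depends on the program only.\<close>

theorem compile_decides:
  assumes wf: "wfc D c" "1 < D" and safe: "csafe \<kappa> c"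
    and xs: "2 \<le> length xs" "\<forall>x\<in>set xs. x \<le> length xs"
    and t: "(csize c D + \<kappa> + 20) * (tm (sem c (ini xs)) + length xs) \<le> t"
  shows "decides_in (compile D c) (cesz c + 8) xs (rg (sem c (ini xs)) 1 \<noteq> 0) t"
proof -
  let ?s = "sem c (ini xs)" and ?p = "compile D c"
  define n where "n = length xs"
  define Z where "Z = n + t"
  define W where "W = Z ^ (cesz c + 8)"
  have "(csize c D + \<kappa> + 20) * (tm ?s + n) = csize c D * tm ?s + \<kappa> * tm ?s + 20 * tm ?s + (csize c D + \<kappa>) * n + 20 * n"
    by (simp add: algebra_simps)
  then have t': "csize c D * tm ?s + \<kappa> * tm ?s + 20 * n \<le> t" using t by (simp add: n_def)
  have n: "2 \<le> n" using xs by (simp add: n_def)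
  have Z: "2 \<le> Z" "n \<le> Z" "20 * n \<le> Z" using n t' by (auto simp: Z_def)
  have W1: "Z ^ cesz c \<le> W" "Z ^ 1 \<le> W" unfolding W_def using Z by (intro power_increasing; simp)+
  have "(KA + 1) * n + KA \<le> 20 * n" using n by (simp add: KA_def)
  then have W2: "(KA + 1) * n + KA \<le> W" using Z W1 by simp
  have nth: "xs ! i \<le> n" if "i < n" for i using xs that by (simp add: n_def)
  have small: "small (n + \<kappa> * tm (ini xs)) (ini xs)" using nth by (auto simp: small_def ini_def n_def)
  have cb: "cbnd W c (ini xs)"
    by (rule cbnd_small[OF safe small, where Z = Z]) (use Z W1 t' in \<open>auto simp: Z_def\<close>)
  have code: "code_at ?p 0 (prologue D)" "code_at ?p 11 (ccom c 11 D)"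
    "code_at ?p (11 + length (ccom c 11 D)) [Const 0 0, Add 0 0 1]"
  proof -
    have "code_at ?p 0 ?p" by (simp add: code_at_def)
    moreover have "length (prologue D) = 11" by (simp add: prologue_def)
    ultimately show "code_at ?p 0 (prologue D)" "code_at ?p 11 (ccom c 11 D)"
      "code_at ?p (11 + length (ccom c 11 D)) [Const 0 0, Add 0 0 1]"
      unfolding compile_def by (simp_all only: code_at_append add_0 conj_assoc) 
  qed
  have plen: "length ?p = 11 + length (ccom c 11 D) + 2" by (simp add: compile_def prologue_def)
  have P: "?p ! 0 = Const D 0" "?p ! Suc 0 = Add D D 0" "Suc 0 < length ?p" "?p \<noteq> []"
    using code(1) by (simp_all add: prologue_def)
  have "xs ! i \<le> W" if "i < n" for i using nth[OF that] Z W1 by simp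
  then have bi: "bd W (init xs)" using Z W1 by (auto simp: bd_def init_def n_def)
  define c1 where "c1 = set_reg D n (set_reg D 0 (init xs))"
  have b1: "bd W (set_reg D 0 (init xs))" "bd W c1" using bi Z W1 by (auto simp: c1_def)
  have 1: "runs ?p W (init xs) (Suc (Suc 0)) c1"
    by (rule runs_Cons[OF _ _ bi runs_Cons]) (use P b1 wf in \<open>simp_all add: c1_def init_def n_def set_reg_def\<close>)
  obtain c2 where c2: "runs ?p W c1 (9 * n + 1) c2" "pc c2 = 11" "\<forall>r<D. regs c2 r = regs c1 r"
    "mem c2 = (\<lambda>x. if \<exists>j<n. x = length xs + KA * j then xs ! ((x - length xs) div KA) else mem c1 x)"
    using copy_runs[OF code(1), of n xs c1 W] wf b1 W2 by (auto simp: n_def c1_def init_def set_reg_def)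
  have rel2: "rel D c2 (ini xs)"
    unfolding rel_def
  proof (intro conjI allI impI)
    fix a i assume a: "a < KA"
    have "(\<exists>j<n. n + KA * i + a = n + KA * j) \<longleftrightarrow> i < n \<and> a = 0"
    proof
      assume "\<exists>j<n. n + KA * i + a = n + KA * j"
      then obtain j where j: "j < n" "n + KA * i + a = n + KA * j + 0" by auto
      then show "i < n \<and> a = 0" using address_inj[OF a _ j(2)] by (auto simp: KA_def)
    qed auto
    then show "mem c2 (rg (ini xs) 0 + KA * i + a) = ar (ini xs) a i"
      using a by (auto simp: c2(4) ini_def n_def[symmetric] KA_def c1_def init_def)
  qed (use c2(3) wf in \<open>auto simp: c1_def init_def ini_def\<close>)
  obtain t3 c3 where c3: "runs ?p W c2 t3 c3" "pc c3 = 11 + length (ccom c 11 D)" "rel D c3 ?s"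
    "t3 + csize c D * tm (ini xs) \<le> csize c D * tm ?s"
    using ccom_runs[OF code(2) c2(2) _ rel2 wf(1) _ _ cb] runs_bd[OF c2(1)] wf by auto
  define c4 where "c4 = set_reg 0 (rg ?s 1) (set_reg 0 0 c3)"
  have r3: "regs c3 1 = rg ?s 1" using relD(1)[OF c3(3), of 1] wf by simp
  have b3: "bd W c3" using runs_bd[OF c3(1)] by simp
  have b4: "bd W c4" "bd W (set_reg 0 0 c3)" using b3 r3 bd_le(1)[OF b3, of 1] by (auto simp: c4_def)
  have 4: "runs ?p W c3 (Suc (Suc 0)) c4"
    by (rule runs_Cons[OF _ refl b3 runs_Cons[OF _ refl]]) (use code(3) b4 r3 c3(2) in \<open>simp_all add: c4_def\<close>)
  define T where "T = Suc (Suc 0) + (9 * n + 1) + (t3 + Suc (Suc 0))"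
  have run: "runs ?p W (init xs) T c4"
    using runs_trans[OF runs_trans[OF 1 c2(1)] runs_trans[OF c3(1) 4]] by (simp add: T_def)
  have Tt: "T \<le> t" using c3(4) t' n by (simp add: T_def)
  have halt: "halted ?p c4" using c3(2) by (simp add: halted_def c4_def plen)
  \<comment> \<open>A halted machine keeps its configuration, so every \<open>t\<close> beyond the
    actual running time is admissible.\<close>
  have stay: "(step ?p ^^ j) c4 = c4" for j
    by (induction j) (simp_all add: step_def halt)
  have after: "run ?p xs j = c4" if "T \<le> j" for j
  proof -
    have "run ?p xs j = (step ?p ^^ (j - T)) ((step ?p ^^ T) (init xs))"
      using that by (simp add: run_def flip: funpow_add o_apply[of "step ?p ^^ (j - T)"])
    then show ?thesis using run stay by (simp add: runs_def)
  qed
  have bd: "bd W (run ?p xs j)" for j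
  proof (cases "T \<le> j")
    case False
    then show ?thesis using run by (simp add: runs_def run_def)
  qed (simp add: after b4)
  show ?thesis
    unfolding decides_in_def after[OF Tt] using bd halt
    by (auto simp: c4_def W_def Z_def n_def bd_def)
qed

subsection \<open>Reasoning about programs\<close>

fun wr :: "com \<Rightarrow> nat set" where
  "wr Nop = {}"
| "wr (Asg r e) = {r}"
| "wr (Sto a i e) = {}"
| "wr (c ;; c') = wr c \<union> wr c'"
| "wr (Cond e c c') = wr c \<union> wr c'"
| "wr (Loop e c) = wr c"

fun wa :: "com \<Rightarrow> nat set" where
  "wa Nop = {}"
| "wa (Asg r e) = {}"
| "wa (Sto a i e) = {a}"
| "wa (c ;; c') = wa c \<union> wa c'"
| "wa (Cond e c c') = wa c \<union> wa c'"
| "wa (Loop e c) = wa c"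

lemma sem_frame_rg: "r \<notin> wr c \<Longrightarrow> rg (sem c s) r = rg s r"
proof (induction c arbitrary: s)
  case (Loop e c)
  have "rg (((\<lambda>s. sem c (tick s)) ^^ i) s) r = rg s r" for i s
    by (induction i) (use Loop in auto)
  then show ?case by simp
qed auto

lemma sem_frame_ar: "a \<notin> wa c \<Longrightarrow> ar (sem c s) a = ar s a"
proof (induction c arbitrary: s)
  case (Loop e c)
  have "ar (((\<lambda>s. sem c (tick s)) ^^ i) s) a = ar s a" for i s
    by (induction i) (use Loop in auto)
  then show ?case by simp
qed auto

text \<open>The index is an ordinary variable that the body can read, distinct from the machine's
  own loop counter. The bound is evaluated once, when the index is already 0.\<close>

definition For :: "nat \<Rightarrow> exp \<Rightarrow> com \<Rightarrow> com" where
  "For i e c = Asg i (Cn 0) ;; Loop e (c ;; Asg i (Plus (Rg i) (Cn 1)))"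

lemma wr_For [simp]: "wr (For i e c) = insert i (wr c)"
  and wa_For [simp]: "wa (For i e c) = wa c"
  by (auto simp: For_def)

text \<open>The step may assume that everything the body never writes still has its value from
  before the loop, so invariants mention only what changes.\<close>

lemma Loop_rule:
  assumes "I 0 (tick s)"
    and "\<And>j s'. j < eval e s \<Longrightarrow> I j s' \<Longrightarrow> (\<And>r. r \<notin> wr c \<Longrightarrow> rg s' r = rg s r) \<Longrightarrow>
      (\<And>a. a \<notin> wa c \<Longrightarrow> ar s' a = ar s a) \<Longrightarrow> I (Suc j) (sem c (tick s'))"
  shows "I (eval e s) (sem (Loop e c) s)"
proof -
  have "I j (((\<lambda>s. sem c (tick s)) ^^ j) (tick s)) \<and>
     (\<forall>r. r \<notin> wr c \<longrightarrow> rg (((\<lambda>s. sem c (tick s)) ^^ j) (tick s)) r = rg s r) \<and>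
     (\<forall>a. a \<notin> wa c \<longrightarrow> ar (((\<lambda>s. sem c (tick s)) ^^ j) (tick s)) a = ar s a)" if "j \<le> eval e s" for j
    using that by (induction j) (use assms in \<open>auto simp: sem_frame_rg sem_frame_ar\<close>)
  then show ?thesis by auto
qed

abbreviation (input) loop_step :: "nat \<Rightarrow> com \<Rightarrow> nat \<Rightarrow> st \<Rightarrow> st" where
  "loop_step i c j s \<equiv> (sem c (tick s))\<lparr>rg := (rg (sem c (tick s)))(i := j), tm := Suc (tm (sem c (tick s)))\<rparr>"

lemma For_rule:
  assumes "I 0 (s\<lparr>rg := (rg s)(i := 0), tm := tm s + 2\<rparr>)" "i \<notin> wr c" "eval e (s\<lparr>rg := (rg s)(i := 0)\<rparr>) = n"
    and step: "\<And>j s'. j < n \<Longrightarrow> I j s' \<Longrightarrow> rg s' i = j \<Longrightarrow> (\<And>r. r \<noteq> i \<Longrightarrow> r \<notin> wr c \<Longrightarrow> rg s' r = rg s r) \<Longrightarrow>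
      (\<And>a. a \<notin> wa c \<Longrightarrow> ar s' a = ar s a) \<Longrightarrow>
      I (Suc j) (loop_step i c (Suc j) s')"
  shows "I n (sem (For i e c) s)"
proof -
  let ?s = "s\<lparr>rg := (rg s)(i := 0), tm := Suc (tm s)\<rparr>"
  have n: "eval e ?s = n"
    unfolding assms(3)[symmetric] by (rule eval_cong) auto
  have "I (eval e ?s) (sem (Loop e (c ;; Asg i (Plus (Rg i) (Cn 1)))) ?s) \<and>
    rg (sem (Loop e (c ;; Asg i (Plus (Rg i) (Cn 1)))) ?s) i = eval e ?s"
  proof (rule Loop_rule[where I = "\<lambda>j s. I j s \<and> rg s i = j"])
    show "I 0 (tick ?s) \<and> rg (tick ?s) i = 0" using assms(1) by (simp add: tick_def)
  next
    fix j s'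
    assume a: "j < eval e ?s" "I j s' \<and> rg s' i = j"
      "\<And>r. r \<notin> wr (c ;; Asg i (Plus (Rg i) (Cn 1))) \<Longrightarrow> rg s' r = rg ?s r"
      "\<And>a. a \<notin> wa (c ;; Asg i (Plus (Rg i) (Cn 1))) \<Longrightarrow> ar s' a = ar ?s a"
    have "rg (sem c (tick s')) i = j" using a(2) assms(2) by (simp add: sem_frame_rg)
    then show "I (Suc j) (sem (c ;; Asg i (Plus (Rg i) (Cn 1))) (tick s')) \<and>
        rg (sem (c ;; Asg i (Plus (Rg i) (Cn 1))) (tick s')) i = Suc j"
      using step[of j s'] a n by simp
  qed
  then show ?thesis unfolding n by (simp add: For_def)
qed

subsection \<open>Disjoint paths as an integer program\<close>

definition separated :: "('a \<times> 'a) set \<Rightarrow> bool" where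
  "separated P \<longleftrightarrow> (\<forall>x\<in>P. \<forall>y\<in>P. x \<noteq> y \<longrightarrow> {fst x, snd x} \<inter> {fst y, snd y} = {})"

definition terms :: "('a \<times> 'a) set \<Rightarrow> 'a set" where
  "terms P = fst ` P \<union> snd ` P"

lemma terms_iff: "x \<in> terms P \<longleftrightarrow> (\<exists>s t. (s, t) \<in> P \<and> (x = s \<or> x = t))"
  by (force simp: terms_def)

lemma separatedD:
  assumes "separated P" "(s, t) \<in> P" "(x, y) \<in> P - {(s, t)}"
  shows "x \<noteq> s \<and> y \<noteq> s \<and> x \<noteq> t \<and> y \<noteq> t"
  using assms(1)[unfolded separated_def, rule_format, of "(x, y)" "(s, t)"] assms(2,3) by auto

text \<open>Confining the paths to terminals and vertices of \<open>F\<close> is what carries the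
  induction: a vertex put in front of one path is then known to avoid all the others.\<close>

definition linked :: "'a set \<Rightarrow> 'a set set \<Rightarrow> ('a \<times> 'a) set \<Rightarrow> 'a set \<Rightarrow> bool" where
  "linked V E P F \<longleftrightarrow> (\<exists>p. (\<forall>(s, t)\<in>P. path_between V E s t (p (s, t))) \<and>
     disjoint_family_on (\<lambda>x. set (p x)) P \<and> (\<forall>x\<in>P. set (p x) \<subseteq> terms P \<union> F))"

lemma path_between_terms: "path_between V E s t p \<Longrightarrow> s \<in> set p \<and> t \<in> set p"
  by (auto simp: path_between_def)

lemma has_disjoint_paths_separated:
  assumes "has_disjoint_paths V E P"
  shows "separated P"
  unfolding separated_def
proof (intro ballI impI)
  obtain p where p: "\<forall>(s, t)\<in>P. path_between V E s t (p (s, t))" "disjoint_family_on (\<lambda>x. set (p x)) P"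
    using assms by (auto simp: has_disjoint_paths_def)
  fix x y assume xy: "x \<in> P" "y \<in> P" "x \<noteq> y"
  then have "{fst x, snd x} \<subseteq> set (p x)" "{fst y, snd y} \<subseteq> set (p y)"
    using p(1) path_between_terms by fastforce+
  then show "{fst x, snd x} \<inter> {fst y, snd y} = {}"
    using p(2) xy unfolding disjoint_family_on_def by blast
qed

section \<open>Routing through types\<close>

locale typed_graph =
  fixes V :: "'a set" and E :: "'a set set" and cl :: "'a \<Rightarrow> nat" and m :: nat
  assumes simple: "simple_graph V E"
    and cl_less: "v \<in> V \<Longrightarrow> cl v < m"
    and cl_type: "u \<in> V \<Longrightarrow> v \<in> V \<Longrightarrow> cl u = cl v \<Longrightarrow> same_type E u v"
begin

definition AD :: "nat \<Rightarrow> nat \<Rightarrow> bool" where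
  "AD a b \<longleftrightarrow> (\<exists>u\<in>V. \<exists>w\<in>V. {u, w} \<in> E \<and> cl u = a \<and> cl w = b)"

text \<open>
  A variable \<open>(a, b, c)\<close> counts how often a path ending in class \<open>b\<close> steps from class \<open>a\<close>
  to a free vertex of class \<open>c\<close>. Paths are only tracked until they reach a class
  adjacent to \<open>b\<close>.
\<close>

definition usable :: "nat \<times> nat \<times> nat \<Rightarrow> bool" where
  "usable = (\<lambda>(a, b, c). AD a c \<and> \<not> AD a b)"

text \<open>Row \<open>(a', b')\<close> balances moves out of class \<open>a'\<close> against moves
  into it, for paths bound for \<open>b'\<close>. A path whose head lies in a class adjacent to
  \<open>b'\<close> needs no further move, so such rows vanish.\<close>

definition colD :: "nat \<times> nat \<times> nat \<Rightarrow> nat \<Rightarrow> nat \<Rightarrow> int" where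
  "colD = (\<lambda>(a, b, c) a' b'. if usable (a, b, c) \<and> \<not> AD a' b'
     then of_bool (a' = a \<and> b' = b) - of_bool (a' = c \<and> b' = b) else 0)"

definition colF :: "nat \<times> nat \<times> nat \<Rightarrow> nat \<Rightarrow> int" where
  "colF = (\<lambda>(a, b, c) c'. if usable (a, b, c) \<and> c' = c then - 1 else 0)"

definition demand :: "('a \<times> 'a) set \<Rightarrow> nat \<Rightarrow> nat \<Rightarrow> int" where
  "demand P a b = (\<Sum>(s, t)\<in>P. of_bool (s \<noteq> t \<and> cl s = a \<and> cl t = b \<and> \<not> AD a b))"

definition stock :: "'a set \<Rightarrow> nat \<Rightarrow> int" where
  "stock F c = int (card {v \<in> F. cl v = c})"

definition X :: "(nat \<times> nat \<times> nat) set" where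
  "X = {..<m} \<times> {..<m} \<times> {..<m}"

text \<open>A solution may contain more moves than the pairs call for; the surplus is never carried
  out. Hence inequalities instead of flow conservation.\<close>

definition feasible :: "('a \<times> 'a) set \<Rightarrow> 'a set \<Rightarrow> (nat \<times> nat \<times> nat \<Rightarrow> nat) \<Rightarrow> bool" where
  "feasible P F y \<longleftrightarrow>
     (\<forall>a<m. \<forall>b<m. 0 \<le> - demand P a b + (\<Sum>x\<in>X. int (y x) * colD x a b)) \<and>
     (\<forall>c<m. 0 \<le> stock F c + (\<Sum>x\<in>X. int (y x) * colF x c))"

lemma finite_V: "finite V"
  using simple by (simp add: simple_graph_def)

lemma finite_X [simp]: "finite X"
  by (simp add: X_def)

lemma edge_neq: "{u, w} \<in> E \<Longrightarrow> u \<noteq> w"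
  using simple by (auto simp: simple_graph_def)

lemma AD_edge: "u \<in> V \<Longrightarrow> w \<in> V \<Longrightarrow> {u, w} \<in> E \<Longrightarrow> AD (cl u) (cl w)"
  by (auto simp: AD_def)

lemma twin: "u \<in> V \<Longrightarrow> v \<in> V \<Longrightarrow> cl u = cl v \<Longrightarrow> {u, w} \<in> E \<Longrightarrow> w \<noteq> v \<Longrightarrow> {v, w} \<in> E"
  using cl_type[of u v] edge_neq[of u w] by (auto simp: same_type_def nbhd_def set_eq_iff)

text \<open>The ends of a given edge are exchanged for twins one after the other. A twin
  \<open>v\<close> of \<open>u\<close> inherits the edge to \<open>w\<close> only if
  \<open>w \<noteq> v\<close>, so the order of the exchanges depends on whether the second end of
  the given edge is already \<open>u\<close>. The case of equal classes is included: a type is a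
  clique or independent.\<close>

lemma edge_AD:
  assumes uw: "u \<in> V" "w \<in> V" "u \<noteq> w" and ad: "AD (cl u) (cl w)"
  shows "{u, w} \<in> E"
proof -
  obtain u' w' where 1: "u' \<in> V" "w' \<in> V" "{u', w'} \<in> E" "cl u' = cl u" "cl w' = cl w"
    using ad by (auto simp: AD_def)
  show ?thesis
  proof (cases "w' = u")
    case False
    then have "{u, w'} \<in> E" using twin[of u' u w'] 1 uw by simp
    then have "{w', u} \<in> E" by (simp add: insert_commute)
    then show ?thesis using twin[of w' w u] 1 uw by (simp add: insert_commute)
  next
    case True
    show ?thesis
    proof (cases "u' = w")
      case True
      then show ?thesis using 1 \<open>w' = u\<close> by (simp add: insert_commute)
    next
      case False
      have "{w', u'} \<in> E" using 1 by (simp add: insert_commute)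
      then have "{w, u'} \<in> E" using twin[of w' w u'] 1 uw False by simp
      then have "{u', w} \<in> E" by (simp add: insert_commute)
      then show ?thesis using twin[of u' u w] 1 uw by simp
    qed
  qed
qed

lemma linked_direct:
  assumes "P \<subseteq> V \<times> V" "separated P" "\<And>s t. (s, t) \<in> P \<Longrightarrow> s \<noteq> t \<Longrightarrow> {s, t} \<in> E"
  shows "linked V E P F"
  unfolding linked_def
proof (intro exI conjI)
  let ?p = "\<lambda>(s, t). if s = t then [s] else [s, t]"
  show "\<forall>(s, t)\<in>P. path_between V E s t (?p (s, t))"
    using assms by (auto simp: path_between_def)
  show "disjoint_family_on (\<lambda>x. set (?p x)) P"
    unfolding disjoint_family_on_def
  proof (intro ballI impI)
    fix x y assume "x \<in> P" "y \<in> P" "x \<noteq> y"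
    then have "{fst x, snd x} \<inter> {fst y, snd y} = {}" using assms(2) by (simp add: separated_def)
    then show "set (?p x) \<inter> set (?p y) = {}" by (auto split: prod.splits if_splits)
  qed
  have "fst x \<in> terms P \<and> snd x \<in> terms P" if "x \<in> P" for x
    using that by (auto simp: terms_def)
  then show "\<forall>x\<in>P. set (?p x) \<subseteq> terms P \<union> F"
    by (fastforce split: if_splits)
qed

text \<open>The path of \<open>(v, t)\<close> is extended by \<open>s\<close>. Since
  \<open>s\<close> is neither a terminal nor a free vertex of the remaining problem, it lies on none
  of its paths.\<close>

lemma linked_step:
  assumes P: "P \<subseteq> V \<times> V" "separated P" "(s, t) \<in> P" "s \<noteq> t"
    and F: "F \<inter> terms P = {}" "v \<in> F" "F \<subseteq> V" and e: "{s, v} \<in> E"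
    and l: "linked V E (insert (v, t) (P - {(s, t)})) (F - {v})"
  shows "linked V E P F"
proof -
  let ?P = "insert (v, t) (P - {(s, t)})"
  obtain p where p: "\<forall>(s, t)\<in>?P. path_between V E s t (p (s, t))"
    "disjoint_family_on (\<lambda>x. set (p x)) ?P" "\<forall>x\<in>?P. set (p x) \<subseteq> terms ?P \<union> (F - {v})"
    using l by (auto simp: linked_def)
  define p' where "p' = p((s, t) := s # p (v, t))"
  have other: "x \<noteq> s \<and> y \<noteq> s \<and> x \<noteq> t \<and> y \<noteq> t" if "(x, y) \<in> P - {(s, t)}" for x y
    using separatedD[OF P(2,3) that] .
  have st: "s \<in> terms P" "t \<in> terms P" using P(3) by (auto simp: terms_iff)
  then have vst: "v \<noteq> s" "v \<noteq> t" "s \<notin> F" using F by blast+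
  have tP: "terms ?P = {v, t} \<union> terms (P - {(s, t)})" by (auto simp: terms_def)
  have "s \<notin> terms (P - {(s, t)})" using other unfolding terms_iff by blast
  then have s: "s \<notin> terms ?P \<union> (F - {v})"
    using vst P(4) unfolding tP by blast
  have "terms (P - {(s, t)}) \<subseteq> terms P" by (auto simp: terms_def)
  then have sub: "terms ?P \<union> (F - {v}) \<subseteq> terms P \<union> F"
    using st F(2) unfolding tP by blast
  have vt: "(v, t) \<notin> P" using F by (metis disjoint_iff terms_iff)
  have pv: "path_between V E v t (p (v, t))" using p(1) by simp
  have "set (p (v, t)) \<subseteq> terms ?P \<union> (F - {v})" using p(3) by blast
  then have pv2: "s \<notin> set (p (v, t))" using s by blast
  have sV: "s \<in> V" using P by auto
  have "path_between V E s t (s # p (v, t))"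
    using pv pv2 e sV by (cases "p (v, t)") (auto simp: path_between_def)
  then have 1: "\<forall>(s, t)\<in>P. path_between V E s t (p' (s, t))"
    using p(1) vt by (auto simp: p'_def)
  have 2: "disjoint_family_on (\<lambda>x. set (p' x)) P"
    unfolding disjoint_family_on_def
  proof (intro ballI impI)
    fix x y assume xy: "x \<in> P" "y \<in> P" "x \<noteq> y"
    have "s \<notin> set (p z)" if "z \<in> ?P" for z using p(3) s that by blast
    moreover have "set (p z) \<inter> set (p z') = {}" if "z \<in> ?P" "z' \<in> ?P" "z \<noteq> z'" for z z'
      using p(2) that unfolding disjoint_family_on_def by blast
    ultimately show "set (p' x) \<inter> set (p' y) = {}"
      using xy vt by (simp add: p'_def) blast
  qed
  have "set (p' x) \<subseteq> terms P \<union> F" if "x \<in> P" for x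
  proof (cases "x = (s, t)")
    case True
    have "set (p (v, t)) \<subseteq> terms P \<union> F" using p(3) sub by blast
    then show ?thesis using True st by (simp add: p'_def)
  next
    case False
    then have "set (p x) \<subseteq> terms P \<union> F" using p(3) sub that by blast
    then show ?thesis using False by (simp add: p'_def)
  qed
  then show ?thesis unfolding linked_def using 1 2 by blast
qed

lemma sum_decrement:
  assumes "x0 \<in> X" "0 < y x0"
  shows "(\<Sum>x\<in>X. int ((y(x0 := y x0 - 1)) x) * g x) = (\<Sum>x\<in>X. int (y x) * g x) - g x0"
proof -
  have "(\<Sum>x\<in>X. int ((y(x0 := y x0 - 1)) x) * g x) = (\<Sum>x\<in>X. int (y x) * g x - (if x = x0 then g x0 else 0))"
    using assms(2) by (intro sum.cong) (auto simp: of_nat_diff algebra_simps)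
  then show ?thesis using assms(1) by (simp add: sum_subtractf)
qed

text \<open>Moving the start of a pair changes the right-hand side by exactly one column, so
  lowering the corresponding entry of \<open>y\<close> by 1 preserves feasibility.\<close>

lemma demand_step:
  assumes "finite P" "(s, t) \<in> P" "(v, t) \<notin> P" "s \<noteq> t" "v \<noteq> t"
    and "usable (cl s, cl t, cl v)"
  shows "demand (insert (v, t) (P - {(s, t)})) a b = demand P a b - colD (cl s, cl t, cl v) a b"
proof -
  have "demand P a b = of_bool (s \<noteq> t \<and> cl s = a \<and> cl t = b \<and> \<not> AD a b) + demand (P - {(s, t)}) a b"
    unfolding demand_def using assms by (subst sum.remove[of P "(s, t)"]) auto
  moreover have "demand (insert (v, t) (P - {(s, t)})) a b =
      of_bool (v \<noteq> t \<and> cl v = a \<and> cl t = b \<and> \<not> AD a b) + demand (P - {(s, t)}) a b"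
    unfolding demand_def using assms by (subst sum.insert) auto
  ultimately show ?thesis using assms by (auto simp: colD_def)
qed

lemma stock_step:
  assumes "finite F" "v \<in> F" "usable (a, b, cl v)"
  shows "stock (F - {v}) c = stock F c + colF (a, b, cl v) c"
proof (cases "cl v = c")
  case True
  have "{u \<in> F. cl u = c} = insert v {u \<in> F - {v}. cl u = c}" using assms True by auto
  moreover have "finite {u \<in> F - {v}. cl u = c}" using assms by simp
  ultimately have "card {u \<in> F. cl u = c} = Suc (card {u \<in> F - {v}. cl u = c})" by simp
  then show ?thesis using True assms by (simp add: stock_def colF_def)
next
  case False
  then have "{u \<in> F - {v}. cl u = c} = {u \<in> F. cl u = c}" by auto
  then show ?thesis using False by (simp add: stock_def colF_def)
qed

text \<open>Induction on the total number of moves. A pair with non-adjacent ends makes a demand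
  positive, which yields a positive variable, whose capacity row yields a free vertex to move to.
  The finite supply of moves replaces any argument about cycles.\<close>

lemma feasible_linked:
  assumes "P \<subseteq> V \<times> V" "separated P" "F \<subseteq> V" "F \<inter> terms P = {}" "feasible P F y"
  shows "linked V E P F"
  using assms
proof (induction "\<Sum>x\<in>X. y x" arbitrary: P F y rule: less_induct)
  case less
  have finP: "finite P" and finF: "finite F"
    using less.prems finite_V finite_subset[of P "V \<times> V"] finite_subset[of F V] by auto
  show ?case
  proof (cases "\<forall>(s, t)\<in>P. s \<noteq> t \<longrightarrow> {s, t} \<in> E")
    case True
    then show ?thesis using less.prems by (intro linked_direct) auto
  next
    case False
    then obtain s t where st: "(s, t) \<in> P" "s \<noteq> t" "{s, t} \<notin> E" by auto
    define a b where "a = cl s" and "b = cl t"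
    have V: "s \<in> V" "t \<in> V" using st less.prems by auto
    have ab: "a < m" "b < m" using cl_less V by (auto simp: a_def b_def)
    have nad: "\<not> AD a b" using edge_AD[of s t] st V by (auto simp: a_def b_def)
    have "of_bool (s \<noteq> t \<and> cl s = a \<and> cl t = b \<and> \<not> AD a b) \<le> demand P a b"
      unfolding demand_def
      using member_le_sum[of "(s, t)" P "\<lambda>(s, t). of_bool (s \<noteq> t \<and> cl s = a \<and> cl t = b \<and> \<not> AD a b) :: int"]
        finP st(1) by (auto split: prod.splits)
    then have "1 \<le> demand P a b" using st nad by (simp add: a_def b_def)
    then have "0 < (\<Sum>x\<in>X. int (y x) * colD x a b)"
      using less.prems(5) ab unfolding feasible_def by fastforce
    then obtain x where x: "x \<in> X" "0 < int (y x) * colD x a b"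
      by (meson not_less sum_nonpos)
    then have yx: "0 < y x" "0 < colD x a b" by (auto simp: zero_less_mult_iff)
    \<comment> \<open>Only a variable of the form \<open>(a, b, c)\<close> has a positive
      coefficient in row \<open>(a, b)\<close>.\<close>
    then obtain c where c: "x = (a, b, c)" "usable x"
      by (cases x) (auto simp: colD_def of_bool_def split: if_splits)
    have cm: "c < m" using x(1) c by (simp add: X_def)
    \<comment> \<open>No coefficient of a capacity row is positive, so the term of \<open>x\<close>
      alone already forces a positive stock.\<close>
    have "(\<Sum>x\<in>X. int (y x) * colF x c) \<le> (\<Sum>z\<in>{x}. int (y z) * colF z c)"
      by (rule sum_mono2[where B = X, of "{x}" "\<lambda>z. - (int (y z) * colF z c)", simplified sum_negf neg_le_iff_le])
        (use x in \<open>auto simp: colF_def\<close>)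
    also have "\<dots> \<le> - 1" using yx c by (simp add: colF_def)
    finally have "1 \<le> stock F c" using less.prems(5) cm unfolding feasible_def by fastforce
    then have "{v \<in> F. cl v = c} \<noteq> {}" unfolding stock_def by (metis card.empty of_nat_0 not_one_le_zero)
    then obtain v where v: "v \<in> F" "cl v = c" by auto
    have vT: "v \<notin> terms P" using v less.prems(4) by blast
    have stT: "s \<in> terms P" "t \<in> terms P" using st by (auto simp: terms_iff)
    have vt: "(v, t) \<notin> P" "v \<noteq> t" "v \<noteq> s" using vT stT by (auto simp: terms_iff)
    have vV: "v \<in> V" using v less.prems by auto
    have e: "{s, v} \<in> E" using edge_AD[of s v] c(2) V vV vt v by (auto simp: usable_def c(1) a_def)
    let ?P = "insert (v, t) (P - {(s, t)})" and ?y = "y(x := y x - 1)"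
    have other: "x \<noteq> s \<and> y \<noteq> s \<and> x \<noteq> t \<and> y \<noteq> t" if "(x, y) \<in> P - {(s, t)}" for x y
      using separatedD[OF less.prems(2) st(1) that] .
    have xx: "x = (cl s, cl t, cl v)" using c v by (simp add: a_def b_def)
    have "linked V E ?P (F - {v})"
    proof (rule less.hyps)
      have "(\<Sum>z\<in>X. ?y z) < (\<Sum>z\<in>X. y z)"
        by (rule sum_strict_mono_ex1) (use x(1) yx in auto)
      then show "(\<Sum>z\<in>X. ?y z) < (\<Sum>z\<in>X. y z)" .
      show "?P \<subseteq> V \<times> V" using less.prems(1) vV V by auto
      show "separated ?P"
        unfolding separated_def
      proof (intro ballI impI)
        fix z z' assume z: "z \<in> ?P" "z' \<in> ?P" "z \<noteq> z'"
        have 1: "{fst z, snd z} \<inter> {v, t} = {}" if "z \<in> P - {(s, t)}" for z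
          using that vT other[of "fst z" "snd z"] by (auto simp: terms_def)
        show "{fst z, snd z} \<inter> {fst z', snd z'} = {}"
        proof (cases "z = (v, t) \<or> z' = (v, t)")
          case True
          then show ?thesis using 1[of z] 1[of z'] z by (elim disjE) auto
        next
          case False
          then show ?thesis using z less.prems(2) by (auto simp: separated_def)
        qed
      qed
      show "F - {v} \<subseteq> V" using less.prems by auto
      have "terms ?P \<subseteq> {v} \<union> terms P" using stT by (auto simp: terms_def)
      then show "(F - {v}) \<inter> terms ?P = {}" using less.prems(4) by blast
      have u: "usable (cl s, cl t, cl v)" using c(2) xx by simp
      show "feasible ?P (F - {v}) ?y"
        unfolding feasible_def sum_decrement[of x y, OF x(1) yx(1)]
          demand_step[OF finP st(1) vt(1) st(2) vt(2) u] stock_step[OF finF v(1) u]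
        using less.prems(5) unfolding feasible_def xx[symmetric] by simp
    qed
    then show ?thesis
      using linked_step[OF less.prems(1,2) st(1,2) less.prems(4) v(1) less.prems(3) e] by simp
  qed
qed

text \<open>\<open>y\<close> counts the steps of the given paths by the types involved. Distinct
  steps enter distinct free vertices, which gives both the capacity rows and the bound on
  \<open>y\<close>.\<close>

lemma paths_feasible:
  assumes P: "P \<subseteq> V \<times> V" and paths: "has_disjoint_paths V E P"
  shows "\<exists>y. feasible P (V - terms P) y \<and> (\<forall>x. y x \<le> card V)"
proof -
  obtain p where p: "\<And>s t. (s, t) \<in> P \<Longrightarrow> path_between V E s t (p (s, t))"
    and disj: "disjoint_family_on (\<lambda>x. set (p x)) P"
    using paths by (auto simp: has_disjoint_paths_def)
  have finP: "finite P" using P finite_V finite_subset[of P "V \<times> V"] by auto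
  have pV: "set (p x) \<subseteq> V" and pd: "distinct (p x)" and pn: "p x \<noteq> []" and p0: "p x ! 0 = fst x"
    and pl: "p x ! (length (p x) - 1) = snd x" if "x \<in> P" for x
    using p[of "fst x" "snd x"] that by (auto simp: path_between_def hd_conv_nth last_conv_nth)
  have pE: "{p x ! i, p x ! Suc i} \<in> E" if "x \<in> P" "Suc i < length (p x)" for x i
    using p[of "fst x" "snd x"] that by (auto simp: path_between_def successively_conv_nth)
  have uniq: "x = x' \<and> i = i'" if "x \<in> P" "x' \<in> P" "i < length (p x)" "i' < length (p x')" "p x ! i = p x' ! i'" for x x' i i'
  proof -
    have "x = x'" using disj that unfolding disjoint_family_on_def by (metis disjoint_iff nth_mem)
    then show ?thesis using that pd[of x] by (simp add: nth_eq_iff_index_eq)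
  qed
  \<comment> \<open>Steps into the target and steps out of a class adjacent to that of the target
    are left out. A path may pass through such a class and go on, so the counted steps out of a
    class can outnumber the starts and the counted arrivals there; the demand rows ask only for this
    direction.\<close>
  define St where "St = {(x, i). x \<in> P \<and> Suc i < length (p x) \<and> p x ! Suc i \<noteq> snd x \<and> \<not> AD (cl (p x ! i)) (cl (snd x))}"
  define \<phi> where "\<phi> = (\<lambda>(x, i). (cl (p x ! i), cl (snd x), cl (p x ! Suc i)))"
  define y where "y z = card {q \<in> St. \<phi> q = z}" for z
  have "St \<subseteq> Sigma P (\<lambda>x. {..<length (p x)})" by (auto simp: St_def)
  then have finSt: "finite St" using finP finite_subset by blast
  have inj: "inj_on (\<lambda>(x, i). p x ! Suc i) St"
  proof (rule inj_onI)
    fix q q' assume q: "q \<in> St" "q' \<in> St" "(\<lambda>(x, i). p x ! Suc i) q = (\<lambda>(x, i). p x ! Suc i) q'"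
    obtain x i x' i' where xi: "q = (x, i)" "q' = (x', i')" by (metis prod.exhaust)
    have "x = x' \<and> Suc i = Suc i'" using q xi by (intro uniq) (auto simp: St_def)
    then show "q = q'" using xi by simp
  qed
  have free: "p x ! Suc i \<in> V - terms P" if "(x, i) \<in> St" for x i
  proof
    have xi: "x \<in> P" "Suc i < length (p x)" "p x ! Suc i \<noteq> snd x" using that by (auto simp: St_def)
    show "p x ! Suc i \<in> V" using pV[of x] xi nth_mem by blast
    show "p x ! Suc i \<notin> terms P"
    proof
      assume "p x ! Suc i \<in> terms P"
      then obtain z where z: "z \<in> P" "p x ! Suc i = fst z \<or> p x ! Suc i = snd z" by (auto simp: terms_def)
      from z(2) show False
      proof
        assume "p x ! Suc i = fst z"
        then show False using uniq[of x z "Suc i" 0] xi z(1) p0[of z] pn[of z] by simp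
      next
        assume "p x ! Suc i = snd z"
        then show False using uniq[of x z "Suc i" "length (p z) - 1"] xi z(1) pl[of z] pn[of z] by auto
      qed
    qed
  qed
  have \<phi>X: "\<phi> q \<in> X" "usable (\<phi> q)" if q: "q \<in> St" for q
  proof -
    obtain x i where xi: "q = (x, i)" "x \<in> P" "Suc i < length (p x)" "\<not> AD (cl (p x ! i)) (cl (snd x))"
      using q by (auto simp: St_def)
    have V: "p x ! i \<in> V" "p x ! Suc i \<in> V" "snd x \<in> V"
      using subsetD[OF pV[OF xi(2)] nth_mem] xi(2,3) P by auto
    show "\<phi> q \<in> X" using V cl_less by (simp add: \<phi>_def xi X_def)
    show "usable (\<phi> q)" using AD_edge[OF V(1,2) pE[OF xi(2,3)]] xi by (simp add: \<phi>_def usable_def)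
  qed
  \<comment> \<open>Sums over variables become sums over steps, in which each row is a difference of
    cardinalities.\<close>
  have group: "(\<Sum>z\<in>X. int (y z) * g z) = (\<Sum>q\<in>St. g (\<phi> q))" for g :: "nat \<times> nat \<times> nat \<Rightarrow> int"
  proof -
    have "(\<Sum>q\<in>St. g (\<phi> q)) = (\<Sum>z\<in>X. \<Sum>q\<in>{q \<in> St. \<phi> q = z}. g (\<phi> q))"
      using \<phi>X by (intro sum.group[symmetric] finSt) auto
    also have "\<dots> = (\<Sum>z\<in>X. int (y z) * g z)"
      by (intro sum.cong) (auto simp: y_def)
    finally show ?thesis by simp
  qed
  have D: "0 \<le> - demand P a b + (\<Sum>x\<in>X. int (y x) * colD x a b)" for a b
  proof (cases "AD a b")
    case True
    then have "colD z a b = 0" for z by (cases z) (simp add: colD_def)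
    moreover have "demand P a b = 0" using True by (simp add: demand_def)
    ultimately show ?thesis by simp
  next
    case False
    define A where "A = {(s, t) \<in> P. s \<noteq> t \<and> cl s = a \<and> cl t = b}"
    define B where "B = {(x, i) \<in> St. cl (p x ! Suc i) = a \<and> cl (snd x) = b}"
    define C where "C = {(x, i) \<in> St. cl (p x ! i) = a \<and> cl (snd x) = b}"
    have fin: "finite A" "finite B" "finite C"
      using finP finSt by (auto simp: A_def B_def C_def intro: finite_subset[of _ P] finite_subset[of _ St])
    have dA: "demand P a b = int (card A)"
    proof -
      have "demand P a b = (\<Sum>x\<in>P. of_bool (x \<in> A))"
        unfolding demand_def using False by (intro sum.cong) (auto simp: A_def)
      also have "\<dots> = int (card A)"
      proof -
        have "P \<inter> {x. x \<in> A} = A" by (auto simp: A_def)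
        then show ?thesis using finP by simp
      qed
      finally show ?thesis .
    qed
    have "(\<Sum>q\<in>St. colD (\<phi> q) a b) = (\<Sum>q\<in>St. of_bool (q \<in> C) - of_bool (q \<in> B))"
    proof (rule sum.cong[OF refl])
      fix q assume "q \<in> St"
      then show "colD (\<phi> q) a b = of_bool (q \<in> C) - of_bool (q \<in> B)"
        using \<phi>X[of q] False by (cases q) (auto simp: \<phi>_def colD_def B_def C_def)
    qed
    also have "\<dots> = int (card C) - int (card B)"
    proof -
      have "St \<inter> {q. q \<in> C} = C" "St \<inter> {q. q \<in> B} = B" by (auto simp: B_def C_def)
      then show ?thesis using finSt by (simp add: sum_subtractf)
    qed
    finally have sum: "(\<Sum>q\<in>St. colD (\<phi> q) a b) = int (card C) - int (card B)" .
    \<comment> \<open>A head in class \<open>a\<close> is not yet the target, and it has no edge to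
      the target, as that would make \<open>a\<close> and \<open>b\<close> adjacent. So a counted
      step leaves it.\<close>
    have next_free: "(x, i) \<in> St" if x: "x \<in> P" "i < length (p x)" "p x ! i \<noteq> snd x" "cl (p x ! i) = a" "cl (snd x) = b" for x i
    proof -
      have l: "Suc i < length (p x)"
      proof (rule ccontr)
        assume "\<not> Suc i < length (p x)"
        then have "i = length (p x) - 1" using x(2) by simp
        then show False using x(3) pl[OF x(1)] by simp
      qed
      have V: "p x ! i \<in> V" "p x ! Suc i \<in> V" using subsetD[OF pV[OF x(1)] nth_mem] l by auto
      have "p x ! Suc i \<noteq> snd x"
        using AD_edge[OF V pE[OF x(1) l]] False x by auto
      then show ?thesis using x l False by (simp add: St_def)
    qed
    \<comment> \<open>Every start and every counted arrival in class \<open>a\<close> is matched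
      with the step that leaves the same vertex.\<close>
    define \<psi> where "\<psi> = (\<lambda>z :: ('a \<times> 'a) + ('a \<times> 'a) \<times> nat. case z of Inl x \<Rightarrow> (x, 0) | Inr (x, i) \<Rightarrow> (x, Suc i))"
    have "card (A <+> B) \<le> card C"
    proof (rule card_inj_on_le[of \<psi>])
      show "inj_on \<psi> (A <+> B)" by (auto simp: inj_on_def \<psi>_def)
      show "\<psi> ` (A <+> B) \<subseteq> C"
      proof
        fix q assume "q \<in> \<psi> ` (A <+> B)"
        then consider x where "x \<in> A" "q = (x, 0)" | x i where "(x, i) \<in> B" "q = (x, Suc i)"
          by (auto simp: \<psi>_def)
        then show "q \<in> C"
        proof cases
          case 1
          then show ?thesis using next_free[of x 0] p0[of x] pn[of x] by (auto simp: A_def C_def)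
        next
          case 2
          then have "x \<in> P" "Suc i < length (p x)" "p x ! Suc i \<noteq> snd x" "cl (p x ! Suc i) = a" "cl (snd x) = b"
            by (auto simp: B_def St_def)
          then show ?thesis using next_free[of x "Suc i"] 2 by (auto simp: C_def)
        qed
      qed
    qed (rule fin)
    then have "card A + card B \<le> card C" using fin by (simp add: card_Plus)
    then show ?thesis unfolding group sum dA by linarith
  qed
  have Fr: "0 \<le> stock (V - terms P) c + (\<Sum>x\<in>X. int (y x) * colF x c)" for c
  proof -
    define B where "B = {(x, i) \<in> St. cl (p x ! Suc i) = c}"
    have "(\<Sum>q\<in>St. colF (\<phi> q) c) = (\<Sum>q\<in>St. - of_bool (q \<in> B))"
    proof (rule sum.cong[OF refl])
      fix q assume "q \<in> St"
      then show "colF (\<phi> q) c = - of_bool (q \<in> B)"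
        using \<phi>X[of q] by (cases q) (auto simp: \<phi>_def colF_def B_def)
    qed
    also have "\<dots> = - int (card B)"
    proof -
      have "St \<inter> {q. q \<in> B} = B" by (auto simp: B_def)
      then show ?thesis using finSt by (simp add: sum_negf)
    qed
    finally have sum: "(\<Sum>q\<in>St. colF (\<phi> q) c) = - int (card B)" .
    have "card B \<le> card {v \<in> V - terms P. cl v = c}"
    proof (rule card_inj_on_le)
      show "inj_on (\<lambda>(x, i). p x ! Suc i) B" by (rule inj_on_subset[OF inj]) (auto simp: B_def)
      show "(\<lambda>(x, i). p x ! Suc i) ` B \<subseteq> {v \<in> V - terms P. cl v = c}"
        using free by (auto simp: B_def)
      show "finite {v \<in> V - terms P. cl v = c}" using finite_V by simp
    qed
    then show ?thesis unfolding group sum by (simp add: stock_def)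
  qed
  have "y z \<le> card V" for z
  proof -
    have "y z \<le> card St" unfolding y_def using finSt by (intro card_mono) auto
    also have "\<dots> \<le> card V" using free by (intro card_inj_on_le[OF inj _ finite_V]) auto
    finally show ?thesis .
  qed
  then show ?thesis using D Fr by (intro exI[of _ y]) (auto simp: feasible_def)
qed

text \<open>The bound \<open>2 ^ card V\<close> is generous, as counts never exceed
  \<open>card V\<close>. It fixes one binary digit, hence one halving round, per vertex, which
  linear time can afford.\<close>

theorem disjoint_paths_iff:
  assumes "P \<subseteq> V \<times> V"
  shows "has_disjoint_paths V E P \<longleftrightarrow>
    separated P \<and> (\<exists>y. feasible P (V - terms P) y \<and> (\<forall>x. y x < 2 ^ card V))"
proof
  assume l: "has_disjoint_paths V E P"
  then obtain y where y: "feasible P (V - terms P) y" "\<And>x. y x \<le> card V"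
    using paths_feasible[OF assms] by auto
  moreover have "y x < 2 ^ card V" for x using y(2)[of x] less_exp[of "card V"] by (rule le_less_trans)
  ultimately show "separated P \<and> (\<exists>y. feasible P (V - terms P) y \<and> (\<forall>x. y x < 2 ^ card V))"
    using has_disjoint_paths_separated[OF l] by auto
next
  assume "separated P \<and> (\<exists>y. feasible P (V - terms P) y \<and> (\<forall>x. y x < 2 ^ card V))"
  then have "linked V E P (V - terms P)" using assms feasible_linked by blast
  then show "has_disjoint_paths V E P" by (auto simp: linked_def has_disjoint_paths_def)
qed

end

subsection \<open>Integer feasibility by successive halving\<close>

text \<open>A subset \<open>Z\<close> of the variables stands for the parity vector that is 1
  exactly on \<open>Z\<close>.\<close>

definition expand :: "('x \<Rightarrow> nat \<Rightarrow> int) \<Rightarrow> 'x set \<Rightarrow> (nat \<Rightarrow> int) set \<Rightarrow> (nat \<Rightarrow> int) set" where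
  "expand col Y R = (\<lambda>(v, Z). \<lambda>i. v i + (\<Sum>x\<in>Z. col x i)) ` (R \<times> Pow Y)"

definition halve :: "(nat \<Rightarrow> int) \<Rightarrow> nat \<Rightarrow> int" where
  "halve v i = v i div 2"

definition level :: "('x \<Rightarrow> nat \<Rightarrow> int) \<Rightarrow> 'x set \<Rightarrow> (nat \<Rightarrow> int) set \<Rightarrow> (nat \<Rightarrow> int) set" where
  "level col Y R = halve ` expand col Y R"

lemma expand_empty [simp]: "expand col {} R = R"
  by (force simp: expand_def)

text \<open>This turns the choice among all subsets into one pass per variable over a list of
  vectors, each pass appending the shifted copies of the list.\<close>

lemma expand_insert:
  assumes "finite Y" "x \<notin> Y"
  shows "expand col (insert x Y) R = expand col Y R \<union> (\<lambda>v i. v i + col x i) ` expand col Y R"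
proof -
  have "(\<Sum>z\<in>insert x Z. col z i) = (\<Sum>z\<in>Z. col z i) + col x i" if "Z \<in> Pow Y" for Z i
  proof -
    have "finite Z" "x \<notin> Z" using assms that finite_subset by auto
    then show ?thesis by simp
  qed
  then have "(\<lambda>(v, Z). \<lambda>i. v i + (\<Sum>x\<in>Z. col x i)) ` (R \<times> insert x ` Pow Y) =
      (\<lambda>v i. v i + col x i) ` expand col Y R"
    unfolding expand_def image_image
    by (auto simp: image_iff add.assoc intro!: bexI) 
  then show ?thesis by (simp add: expand_def Pow_insert Sigma_Un_distrib2 image_Un)
qed

text \<open>Write \<open>y\<close> as twice its half plus its parities. Rounding down in
  \<open>halve\<close> loses nothing, because the remaining sum is an integer: a + 2 * c \<ge> 0 is
  the same as a div 2 + c \<ge> 0.\<close>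

lemma doubling_step:
  assumes "finite Y"
  shows "(\<exists>y. (\<forall>x. y x < 2 ^ Suc L) \<and> (\<forall>i. 0 \<le> v i + (\<Sum>x\<in>Y. int (y x) * col x i))) \<longleftrightarrow>
    (\<exists>Z\<subseteq>Y. \<exists>y. (\<forall>x. y x < 2 ^ L) \<and> (\<forall>i. 0 \<le> halve (\<lambda>i. v i + (\<Sum>x\<in>Z. col x i)) i + (\<Sum>x\<in>Y. int (y x) * col x i)))"
    (is "?l \<longleftrightarrow> ?r")
proof -
  have split: "v i + (\<Sum>x\<in>Y. int (2 * y x + of_bool (x \<in> Z)) * col x i) =
     (v i + (\<Sum>x\<in>Z. col x i)) + 2 * (\<Sum>x\<in>Y. int (y x) * col x i)" if "Z \<subseteq> Y" for Z y i
  proof -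
    have "(\<Sum>x\<in>Y. of_bool (x \<in> Z) * col x i) = (\<Sum>x\<in>Z. col x i)"
      using assms that by (intro sum.mono_neutral_cong_right) auto
    moreover have "(\<Sum>x\<in>Y. int (2 * y x + of_bool (x \<in> Z)) * col x i) =
      (\<Sum>x\<in>Y. 2 * (int (y x) * col x i) + of_bool (x \<in> Z) * col x i)"
      by (intro sum.cong) (auto simp: algebra_simps)
    ultimately show ?thesis by (simp add: sum.distrib sum_distrib_left)
  qed
  have half: "0 \<le> a + 2 * c \<longleftrightarrow> 0 \<le> a div 2 + c" for a c :: int by presburger
  show ?thesis
  proof
    assume ?l
    then obtain y where y: "\<And>x. y x < 2 ^ Suc L" "\<And>i. 0 \<le> v i + (\<Sum>x\<in>Y. int (y x) * col x i)" by auto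
    define Z where "Z = {x \<in> Y. odd (y x)}"
    have Z: "Z \<subseteq> Y" by (auto simp: Z_def)
    have e: "2 * (y x div 2) + of_bool (x \<in> Z) = y x" if "x \<in> Y" for x using that by (auto simp: Z_def)
    have "(\<Sum>x\<in>Y. int (y x) * col x i) = (\<Sum>x\<in>Y. int (2 * (y x div 2) + of_bool (x \<in> Z)) * col x i)" for i
      by (intro sum.cong refl) (simp only: e)
    then have "0 \<le> halve (\<lambda>i. v i + (\<Sum>x\<in>Z. col x i)) i + (\<Sum>x\<in>Y. int (y x div 2) * col x i)" for i
      using y(2)[of i] split[OF Z, of i "\<lambda>x. y x div 2"] half unfolding halve_def by metis
    moreover have "y x div 2 < 2 ^ L" for x using y(1)[of x] by simp
    ultimately show ?r using Z by (intro exI[of _ Z] conjI exI[of _ "\<lambda>x. y x div 2"]) auto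
  next
    assume ?r
    then obtain Z y where y: "Z \<subseteq> Y" "\<And>x. y x < 2 ^ L"
      "\<And>i. 0 \<le> halve (\<lambda>i. v i + (\<Sum>x\<in>Z. col x i)) i + (\<Sum>x\<in>Y. int (y x) * col x i)" by auto
    have "0 \<le> v i + (\<Sum>x\<in>Y. int (2 * y x + of_bool (x \<in> Z)) * col x i)" for i
      unfolding split[OF y(1)] half using y(3)[of i] by (simp add: halve_def)
    moreover have "2 * y x + of_bool (x \<in> Z) < 2 ^ Suc L" for x using y(2)[of x] by (auto simp: of_bool_def)
    ultimately show ?l by (intro exI[of _ "\<lambda>x. 2 * y x + of_bool (x \<in> Z)"]) auto
  qed
qed

lemma bex_level: "(\<exists>w\<in>level col Y R. P w) \<longleftrightarrow> (\<exists>v\<in>R. \<exists>Z\<subseteq>Y. P (halve (\<lambda>i. v i + (\<Sum>x\<in>Z. col x i))))"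
  unfolding level_def expand_def image_image bex_simps by (simp add: Bex_def split_beta)

text \<open>A set \<open>R\<close> of vectors is needed because one round turns a single vector into
  many. When no digits are left, \<open>y\<close> is 0 and only the signs remain to be
  tested.\<close>

lemma doubling:
  fixes Y :: "'x set"
  assumes "finite Y"
  shows "(\<exists>v\<in>R. \<exists>y. (\<forall>x. y x < 2 ^ L) \<and> (\<forall>i. 0 \<le> v i + (\<Sum>x\<in>Y. int (y x) * col x i))) \<longleftrightarrow>
    (\<exists>v\<in>(level col Y ^^ L) R. \<forall>i. 0 \<le> v i)"
proof (induction L arbitrary: R)
  case 0
  have "(\<forall>x. y x < (2::nat) ^ 0) \<longleftrightarrow> y = (\<lambda>_. 0)" for y :: "'x \<Rightarrow> nat" by auto
  then show ?case by simp
next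
  case (Suc L)
  have "(\<exists>v\<in>R. \<exists>y. (\<forall>x. y x < 2 ^ Suc L) \<and> (\<forall>i. 0 \<le> v i + (\<Sum>x\<in>Y. int (y x) * col x i))) \<longleftrightarrow>
    (\<exists>v\<in>level col Y R. \<exists>y. (\<forall>x. y x < 2 ^ L) \<and> (\<forall>i. 0 \<le> v i + (\<Sum>x\<in>Y. int (y x) * col x i)))"
    unfolding doubling_step[OF assms] bex_level ..
  also have "\<dots> \<longleftrightarrow> (\<exists>v\<in>(level col Y ^^ Suc L) R. \<forall>i. 0 \<le> v i)"
    unfolding Suc by (simp add: funpow_swap1)
  finally show ?case .
qed

lemma expand_bound:
  assumes "\<And>x i. \<bar>col x i\<bar> \<le> 1" "finite Y" "card Y \<le> Q" "w \<in> expand col Y R"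
  shows "\<exists>v\<in>R. \<forall>i. \<bar>w i - v i\<bar> \<le> int Q"
proof -
  obtain v Z where v: "v \<in> R" "Z \<subseteq> Y" "w = (\<lambda>i. v i + (\<Sum>x\<in>Z. col x i))"
    using assms(4) by (auto simp: expand_def)
  have "\<bar>\<Sum>x\<in>Z. col x i\<bar> \<le> int Q" for i
  proof -
    have "\<bar>\<Sum>x\<in>Z. col x i\<bar> \<le> (\<Sum>x\<in>Z. \<bar>col x i\<bar>)" by (rule sum_abs)
    also have "\<dots> \<le> (\<Sum>x\<in>Z. 1)" by (intro sum_mono assms)
    also have "\<dots> \<le> int (card Y)" using card_mono[OF assms(2) v(2)] by simp
    finally show ?thesis using assms(3) by simp
  qed
  then show ?thesis using v(1) unfolding v(3) by (intro bexI[of _ v]) auto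
qed

lemma levelE:
  assumes "w \<in> (level col Y ^^ Suc L) R"
  obtains v Z where "v \<in> (level col Y ^^ L) R" "Z \<subseteq> Y" "w = halve (\<lambda>i. v i + (\<Sum>x\<in>Z. col x i))"
    "(\<lambda>i. v i + (\<Sum>x\<in>Z. col x i)) \<in> expand col Y ((level col Y ^^ L) R)"
proof -
  have "w \<in> level col Y ((level col Y ^^ L) R)" using assms by simp
  then obtain u where u: "u \<in> expand col Y ((level col Y ^^ L) R)" "w = halve u"
    unfolding level_def by (elim imageE)
  then obtain v Z where v: "v \<in> (level col Y ^^ L) R" "Z \<subseteq> Y" "u = (\<lambda>i. v i + (\<Sum>x\<in>Z. col x i))"
    unfolding expand_def by (elim imageE SigmaE) simp
  show thesis by (rule that[OF v(1,2)]) (use u v in simp_all)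
qed

text \<open>A round adds at most \<open>Q\<close> to the deviation and then halves it, so a
  deviation of \<open>Q\<close> reproduces itself; rounding down costs one more on the lower
  side.\<close>

lemma level_window:
  assumes "\<And>x i. \<bar>col x i\<bar> \<le> 1" "finite Y" "card Y \<le> Q" "w \<in> (level col Y ^^ L) {b}"
  shows "b i div 2 ^ L - int Q - 1 \<le> w i \<and> w i \<le> b i div 2 ^ L + int Q"
  using assms(4)
proof (induction L arbitrary: w)
  case (Suc L)
  from Suc.prems obtain u where u: "u \<in> expand col Y ((level col Y ^^ L) {b})" "w = halve u"
    by (rule levelE)
  obtain v where v: "v \<in> (level col Y ^^ L) {b}" "\<bar>u i - v i\<bar> \<le> int Q"
    using expand_bound[OF assms(1-3) u(1)] by auto
  have "b i div 2 ^ Suc L = b i div 2 ^ L div 2" unfolding power_Suc2 by (rule zdiv_zmult2_eq) simp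
  moreover have "w i = u i div 2" by (simp add: u halve_def)
  ultimately show ?case using Suc.IH[OF v(1)] v(2) by linarith
qed simp

text \<open>Halving never takes a number below \<open>- int B\<close> if it starts above. The bound
  is uniform in \<open>L\<close> and determines how far entries must be shifted to be stored as
  natural numbers.\<close>

lemma level_lower:
  assumes "\<And>x i. \<bar>col x i\<bar> \<le> 1" "finite Y" "card Y \<le> Q" "w \<in> (level col Y ^^ L) {b}" "- int B \<le> b i"
  shows "- int (B + Q + 1) \<le> w i"
proof -
  have "- int B \<le> b i div 2 ^ L"
  proof (cases "0 \<le> b i")
    case False
    have "b i * 2 ^ L \<le> b i * 1" using False by (intro mult_left_mono_neg) auto
    then have "b i * 2 ^ L div 2 ^ L \<le> b i div 2 ^ L" by (intro zdiv_mono1) auto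
    then show ?thesis using assms(5) by simp
  qed (use pos_imp_zdiv_nonneg_iff[of "2 ^ L" "b i"] in simp)
  then show ?thesis using level_window[OF assms(1-4), of i] by simp
qed

lemma level_zero:
  assumes "\<And>x. col x i = 0" "w \<in> (level col Y ^^ L) {b}" "b i = 0"
  shows "w i = 0"
  using assms(2)
proof (induction L arbitrary: w)
  case (Suc L)
  from Suc.prems obtain v Z where v: "v \<in> (level col Y ^^ L) {b}" "w = halve (\<lambda>i. v i + (\<Sum>x\<in>Z. col x i))"
    by (rule levelE)
  then show ?case using Suc.IH[OF v(1)] assms(1) by (simp add: halve_def)
qed (use assms in simp)

text \<open>The window moves with \<open>L\<close> but always offers \<open>2 * Q + 2\<close> values
  per row, and the rows from \<open>M\<close> on stay 0, so a vector is determined by its first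
  \<open>M\<close> entries.\<close>

lemma level_card:
  assumes "\<And>x i. \<bar>col x i\<bar> \<le> 1" "finite Y" "card Y \<le> Q"
    and "\<And>x i. M \<le> i \<Longrightarrow> col x i = 0" "\<And>i. M \<le> i \<Longrightarrow> b i = 0"
  shows "finite ((level col Y ^^ L) {b}) \<and> card ((level col Y ^^ L) {b}) \<le> (2 * Q + 2) ^ M"
proof -
  let ?R = "(level col Y ^^ L) {b}"
  define A where "A i = {b i div 2 ^ L - int Q - 1 .. b i div 2 ^ L + int Q}" for i
  have inj: "inj_on (\<lambda>v. restrict v {..<M}) ?R"
  proof (rule inj_onI)
    fix v w assume vw: "v \<in> ?R" "w \<in> ?R" "restrict v {..<M} = restrict w {..<M}"
    show "v = w"
    proof
      fix i
      show "v i = w i"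
      proof (cases "i < M")
        case True
        then show ?thesis using vw(3) by (metis lessThan_iff restrict_apply')
      next
        case False
        then show ?thesis using level_zero[of col i v L Y b] level_zero[of col i w L Y b] assms(4,5) vw by simp
      qed
    qed
  qed
  have sub: "(\<lambda>v. restrict v {..<M}) ` ?R \<subseteq> PiE {..<M} A"
    using level_window[of col Y Q _ L b, OF assms(1-3)] by (auto simp: A_def split: if_splits)
  have fin: "finite (PiE {..<M} A)" by (intro finite_PiE) (auto simp: A_def)
  have "card (PiE {..<M} A) = (\<Prod>i<M. card (A i))" by (simp add: card_PiE)
  also have "\<dots> = (2 * Q + 2) ^ M"
  proof -
    have "card (A i) = 2 * Q + 2" for i unfolding A_def by simp
    then show ?thesis by simp
  qed
  finally show ?thesis
    using card_inj_on_le[OF inj sub fin] finite_subset[OF sub fin] finite_imageD[OF _ inj] by simp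
qed

subsection \<open>The decision program\<close>

text \<open>With truncated subtraction the two differences add up to the distance of the
  values.\<close>

definition Eq :: "exp \<Rightarrow> exp \<Rightarrow> exp" where
  "Eq e f = Minus (Cn 1) (Plus (Minus e f) (Minus f e))"

lemma eval_Eq [simp]: "eval (Eq e f) s = of_bool (eval e s = eval f s)"
  by (auto simp: Eq_def)

definition Inc :: "nat \<Rightarrow> com" where
  "Inc r = Asg r (Plus (Rg r) (Cn 1))"

lemma sem_Inc [simp]: "sem (Inc r) s = s\<lparr>rg := (rg s)(r := Suc (rg s r)), tm := Suc (tm s)\<rparr>"
  and wr_Inc [simp]: "wr (Inc r) = {r}" and wa_Inc [simp]: "wa (Inc r) = {}"
  by (auto simp: Inc_def)

text \<open>\<open>rp\<close> and \<open>rpp\<close> hold the input positions of the current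
  adjacency list and of the list of pairs, \<open>rm\<close> the number of types, \<open>rM\<close>
  the number of rows and \<open>rK\<close> the offset of stored entries. The vectors of the current
  round lie in the slots from \<open>rlo\<close> to below \<open>rhi\<close>; \<open>rmid\<close>
  separates those before halving from those after it. \<open>rbad\<close> records a vertex that is a
  terminal of two pairs. The answer is left in register 1.\<close>

abbreviation (input) rN :: nat where "rN \<equiv> 2"
abbreviation (input) rv :: nat where "rv \<equiv> 3"
abbreviation (input) rp :: nat where "rp \<equiv> 4"
abbreviation (input) ri :: nat where "ri \<equiv> 5"
abbreviation (input) ru :: nat where "ru \<equiv> 6"
abbreviation (input) rm :: nat where "rm \<equiv> 7"
abbreviation (input) rj :: nat where "rj \<equiv> 8"
abbreviation (input) rr :: nat where "rr \<equiv> 9"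
abbreviation (input) rok :: nat where "rok \<equiv> 10"
abbreviation (input) rfd :: nat where "rfd \<equiv> 11"
abbreviation (input) rM :: nat where "rM \<equiv> 12"
abbreviation (input) rK :: nat where "rK \<equiv> 13"
abbreviation (input) ra :: nat where "ra \<equiv> 14"
abbreviation (input) rb :: nat where "rb \<equiv> 15"
abbreviation (input) rc :: nat where "rc \<equiv> 16"
abbreviation (input) rlo :: nat where "rlo \<equiv> 17"
abbreviation (input) rhi :: nat where "rhi \<equiv> 18"
abbreviation (input) rmid :: nat where "rmid \<equiv> 19"
abbreviation (input) rbad :: nat where "rbad \<equiv> 20"
abbreviation (input) rs :: nat where "rs \<equiv> 21"
abbreviation (input) rt :: nat where "rt \<equiv> 22"
abbreviation (input) re :: nat where "re \<equiv> 23"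
abbreviation (input) rq :: nat where "rq \<equiv> 24"
abbreviation (input) rpp :: nat where "rpp \<equiv> 25"
abbreviation (input) rlv :: nat where "rlv \<equiv> 26"

text \<open>
  Arrays: input, start of each adjacency list, marks, representative of each type, type of each
  vertex, adjacency of types, terminals, and the list of states of the search.
\<close>

abbreviation (input) IN :: nat where "IN \<equiv> 0"
abbreviation (input) STA :: nat where "STA \<equiv> 1"
abbreviation (input) MK :: nat where "MK \<equiv> 2"
abbreviation (input) REP :: nat where "REP \<equiv> 3"
abbreviation (input) CLS :: nat where "CLS \<equiv> 4"
abbreviation (input) ADJ :: nat where "ADJ \<equiv> 5"
abbreviation (input) TRM :: nat where "TRM \<equiv> 6"
abbreviation (input) ST :: nat where "ST \<equiv> 7"

section \<open>Positions in the code word\<close>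

locale code_word =
  fixes adj :: "nat list list" and ps :: "(nat \<times> nat) list" and xs :: "nat list" and N :: nat
  assumes xs: "xs = N # concat (map (\<lambda>l. length l # l) adj) @ length ps # concat (map (\<lambda>(i, j). [i, j]) ps)"
    and N: "N = length adj"
    and adj_less: "v < N \<Longrightarrow> w \<in> set (adj ! v) \<Longrightarrow> w < N"
    and adj_distinct: "v < N \<Longrightarrow> distinct (adj ! v)"
    and adj_sym: "v < N \<Longrightarrow> w \<in> set (adj ! v) \<Longrightarrow> v \<in> set (adj ! w)"
    and adj_irrefl: "v < N \<Longrightarrow> v \<notin> set (adj ! v)"
    and ps_less: "(i, j) \<in> set ps \<Longrightarrow> i < N \<and> j < N"
begin

abbreviation n :: nat where "n \<equiv> length xs"

text \<open>The position of the length field of the \<open>v\<close>-th adjacency list; for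
  \<open>v = N\<close> it is the position of the number of pairs.\<close>

definition list_pos :: "nat \<Rightarrow> nat" where
  "list_pos v = Suc (\<Sum>u<v. Suc (length (adj ! u)))"

definition inp :: "nat \<Rightarrow> nat" where
  "inp i = (if i < n then xs ! i else 0)"

lemma list_pos_0 [simp]: "list_pos 0 = 1"
  and list_pos_Suc: "list_pos (Suc v) = list_pos v + length (adj ! v) + 1"
  by (simp_all add: list_pos_def)

lemma list_pos_eq: "v \<le> N \<Longrightarrow> list_pos v = Suc (length (concat (map (\<lambda>l. length l # l) (take v adj))))"
proof (induction v)
  case (Suc v)
  then show ?case by (simp add: list_pos_Suc N take_Suc_conv_app_nth)
qed simp

lemma length_pairs: "length (concat (map (\<lambda>(i, j). [i, j]) qs)) = 2 * length qs"
  by (induction qs) auto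

lemma nth_pairs:
  "i < length qs \<Longrightarrow> concat (map (\<lambda>(i, j). [i, j]) qs) ! (2 * i) = fst (qs ! i) \<and>
     concat (map (\<lambda>(i, j). [i, j]) qs) ! Suc (2 * i) = snd (qs ! i)"
proof (induction qs arbitrary: i)
  case (Cons q qs)
  then show ?case by (cases i; cases q) auto
qed simp

lemma n_eq: "n = list_pos N + 1 + 2 * length ps"
  using list_pos_eq[of N] by (simp add: xs N length_pairs)

lemma list_pos_mono: "u \<le> v \<Longrightarrow> list_pos u \<le> list_pos v"
  by (auto simp: list_pos_def intro: sum_mono2)

lemma list_pos_ge: "v < list_pos v"
  by (induction v) (auto simp: list_pos_Suc)

lemma inp_vertex:
  assumes "v < N"
  shows "inp (list_pos v) = length (adj ! v)" "i < length (adj ! v) \<Longrightarrow> inp (Suc (list_pos v + i)) = adj ! v ! i"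
proof -
  let ?B = "concat (map (\<lambda>l. length l # l) (drop (Suc v) adj)) @ length ps # concat (map (\<lambda>(i, j). [i, j]) ps)"
  let ?A = "N # concat (map (\<lambda>l. length l # l) (take v adj))"
  have "adj = take v adj @ adj ! v # drop (Suc v) adj"
    using assms by (simp add: N id_take_nth_drop)
  then have "concat (map (\<lambda>l. length l # l) adj) = concat (map (\<lambda>l. length l # l) (take v adj)) @
      (length (adj ! v) # adj ! v) @ concat (map (\<lambda>l. length l # l) (drop (Suc v) adj))"
    by (metis (no_types, lifting) append_Cons concat.simps(2) concat_append list.simps(9) map_append)
  then have e: "xs = ?A @ length (adj ! v) # adj ! v @ ?B"
    by (simp add: xs)
  have l: "length ?A = list_pos v" using list_pos_eq[of v] assms by simp
  have "list_pos (Suc v) \<le> list_pos N" using assms by (intro list_pos_mono) simp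
  then have b: "list_pos v + length (adj ! v) < n" using n_eq by (simp add: list_pos_Suc)
  show "inp (list_pos v) = length (adj ! v)"
    using b unfolding inp_def l[symmetric] by (subst e) (simp add: nth_append)
  assume i: "i < length (adj ! v)"
  have "(?A @ length (adj ! v) # adj ! v @ ?B) ! (length ?A + Suc i) = adj ! v ! i"
    using i by (simp only: nth_append_length_plus nth_Cons_Suc) (simp add: nth_append)
  then show "inp (Suc (list_pos v + i)) = adj ! v ! i"
    using b i unfolding inp_def e[symmetric] l by simp
qed

lemma inp_pairs:
  shows "inp (list_pos N) = length ps"
    "i < length ps \<Longrightarrow> inp (Suc (list_pos N + 2 * i)) = fst (ps ! i)"
    "i < length ps \<Longrightarrow> inp (Suc (Suc (list_pos N + 2 * i))) = snd (ps ! i)"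
proof -
  let ?A = "N # concat (map (\<lambda>l. length l # l) adj)" and ?B = "concat (map (\<lambda>(i, j). [i, j]) ps)"
  have e: "xs = ?A @ length ps # ?B" by (simp add: xs)
  have l: "length ?A = list_pos N" using list_pos_eq[of N] by (simp add: N)
  have b: "list_pos N < n" using n_eq by simp
  show "inp (list_pos N) = length ps"
    using b unfolding inp_def l[symmetric] by (subst e) (simp add: nth_append)
  assume i: "i < length ps"
  have "(?A @ length ps # ?B) ! (length ?A + Suc (2 * i)) = fst (ps ! i)"
    "(?A @ length ps # ?B) ! (length ?A + Suc (Suc (2 * i))) = snd (ps ! i)"
    using nth_pairs[OF i] by (simp_all only: nth_append_length_plus nth_Cons_Suc)
  then show "inp (Suc (list_pos N + 2 * i)) = fst (ps ! i)" "inp (Suc (Suc (list_pos N + 2 * i))) = snd (ps ! i)"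
    using n_eq i unfolding inp_def e[symmetric] l by simp_all
qed

lemma inp_0: "inp 0 = N"
proof -
  have "xs ! 0 = N" "0 < n" by (simp_all add: xs)
  then show ?thesis by (simp add: inp_def)
qed

lemma xs_le:
  assumes "x \<in> set xs"
  shows "x \<le> n"
proof -
  have N_le: "N \<le> n" using list_pos_ge[of N] n_eq by simp
  have adj: "length l \<le> n \<and> (\<forall>w\<in>set l. w \<le> n)" if l: "l \<in> set adj" for l
  proof -
    obtain v where v: "v < N" "l = adj ! v" using l by (auto simp: in_set_conv_nth N)
    have "list_pos (Suc v) \<le> list_pos N" using v by (intro list_pos_mono) simp
    then show ?thesis using v adj_less[of v] N_le n_eq by (force simp: list_pos_Suc)
  qed
  have "i \<le> n \<and> j \<le> n" if "(i, j) \<in> set ps" for i j using ps_less[OF that] N_le by simp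
  moreover have "x = N \<or> (\<exists>l\<in>set adj. x = length l \<or> x \<in> set l) \<or> x = length ps \<or> (\<exists>i j. (i, j) \<in> set ps \<and> (x = i \<or> x = j))"
    using assms by (subst (asm) xs) auto
  ultimately show ?thesis using adj N_le n_eq by auto
qed

end

text \<open>The double subtraction from the input length truncates the sum to it and makes the assignment safe.\<close>

definition locate_lists :: com where
  "locate_lists = Asg rN (Ar IN (Cn 0)) ;; Asg rp (Cn 1) ;;
     For rv (Rg rN) (Sto STA (Rg rv) (Rg rp) ;;
       Asg rp (Minus (Rg 0) (Minus (Rg 0) (Plus (Plus (Rg rp) (Ar IN (Rg rp))) (Cn 1))))) ;;
     Asg rpp (Rg rp)"

text \<open>Marks are stamped with \<open>Suc v\<close>, so that they need not be erased for the next vertex.\<close>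

definition mark_neighbours :: com where
  "mark_neighbours = For ri (Ar IN (Rg rp)) (Sto MK (Ar IN (Plus (Plus (Rg rp) (Cn 1)) (Rg ri))) (Plus (Rg rv) (Cn 1)))"

text \<open>The bound is the length of the list of the current vertex, whereas the list being read
  is that of the representative. The test for equal lengths in \<open>find_type\<close> justifies
  this and keeps the cost proportional to the degree of the current vertex.\<close>

definition compare_lists :: com where
  "compare_lists = Asg rok (Cn 1) ;;
     For ri (Ar IN (Rg rp)) (Asg ru (Ar IN (Plus (Plus (Rg rr) (Cn 1)) (Rg ri))) ;;
       Cond (Eq (Rg ru) (Rg rv)) Nop (Cond (Eq (Ar MK (Rg ru)) (Plus (Rg rv) (Cn 1))) Nop (Asg rok (Cn 0))))"

definition find_type :: com where
  "find_type = Asg rfd (Cn 0) ;;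
     For rj (Rg rm) (Asg rr (Ar STA (Ar REP (Rg rj))) ;;
       Cond (Eq (Ar IN (Rg rr)) (Ar IN (Rg rp)))
         (compare_lists ;; Cond (Rg rok) (Sto CLS (Rg rv) (Rg rj) ;; Asg rfd (Cn 1)) Nop) Nop)"

definition classify :: com where
  "classify = For rv (Rg rN) (Asg rp (Ar STA (Rg rv)) ;; mark_neighbours ;; find_type ;;
     Cond (Rg rfd) Nop (Sto REP (Rg rm) (Rg rv) ;; Sto CLS (Rg rv) (Rg rm) ;; Inc rm))"

lemma wr_classify [simp]:
  "wr mark_neighbours = {ri}" "wa mark_neighbours = {MK}" "wr compare_lists = {rok, ri, ru}" "wa compare_lists = {}"
  "wr find_type = {rfd, rj, rr, rok, ri, ru}" "wa find_type = {CLS}"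
  by (auto simp: mark_neighbours_def compare_lists_def find_type_def)

context code_word
begin

lemma sem_locate_lists:
  assumes "ar s IN = inp" "rg s 0 = n"
  defines "s' \<equiv> sem locate_lists s"
  shows "rg s' rN = N" "rg s' rpp = list_pos N" "\<forall>v<N. ar s' STA v = list_pos v" "tm s' \<le> tm s + 10 + 10 * N"
proof -
  define s1 where "s1 = sem (Asg rN (Ar IN (Cn 0)) ;; Asg rp (Cn 1)) s"
  define body where "body = (Sto STA (Rg rv) (Rg rp) ;;
       Asg rp (Minus (Rg 0) (Minus (Rg 0) (Plus (Plus (Rg rp) (Ar IN (Rg rp))) (Cn 1)))))"
  define I where "I v s' \<longleftrightarrow> rg s' rp = list_pos v \<and> (\<forall>u<v. ar s' STA u = list_pos u) \<and> tm s' \<le> tm s + 4 + 4 * v" for v and s' :: st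
  have "I N (sem (For rv (Rg rN) body) s1)"
  proof (rule For_rule)
    show "I 0 (s1\<lparr>rg := (rg s1)(rv := 0), tm := tm s1 + 2\<rparr>)" by (simp add: s1_def I_def)
    show "eval (Rg rN) (s1\<lparr>rg := (rg s1)(rv := 0)\<rparr>) = N" by (simp add: s1_def assms inp_0)
  next
    fix j s'
    assume j: "j < N" and I: "I j s'" "rg s' rv = j" and f: "\<And>r. r \<noteq> rv \<Longrightarrow> r \<notin> wr body \<Longrightarrow> rg s' r = rg s1 r"
      "\<And>a. a \<notin> wa body \<Longrightarrow> ar s' a = ar s1 a"
    have e: "rg s' 0 = n" "ar s' IN = inp" using f(1)[of 0] f(2)[of IN] assms by (simp_all add: body_def s1_def)
    have "list_pos (Suc j) \<le> n" using list_pos_mono[of "Suc j" N] j n_eq by simp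
    \<comment> \<open>List positions up to \<open>N\<close> do not exceed \<open>n\<close>, so the
      truncation has no effect here.\<close>
    then have h: "n - (n - Suc (list_pos j + length (adj ! j))) = list_pos (Suc j)" by (simp add: list_pos_Suc)
    show "I (Suc j) (loop_step rv body (Suc j) s')"
      using I e h by (auto simp: body_def I_def inp_vertex[OF j] less_Suc_eq)
  qed (simp add: body_def)
  then show "rg s' rpp = list_pos N" "\<forall>v<N. ar s' STA v = list_pos v" "tm s' \<le> tm s + 10 + 10 * N" "rg s' rN = N"
    by (auto simp: s'_def locate_lists_def s1_def I_def body_def sem_frame_rg assms inp_0)
qed


definition twin :: "nat \<Rightarrow> nat \<Rightarrow> bool" where
  "twin i j \<longleftrightarrow> set (adj ! i) - {j} = set (adj ! j) - {i}"

text \<open>Between finite sets of equal size one inclusion is equality, and the exclusions remove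
  the same number of elements on both sides by symmetry of adjacency. So it suffices to mark the
  neighbours of \<open>v\<close> once and to scan the list of each candidate
  \<open>r\<close>.\<close>

lemma twin_iff:
  assumes "v < N" "r < N" "v \<noteq> r"
  shows "twin v r \<longleftrightarrow> length (adj ! r) = length (adj ! v) \<and> set (adj ! r) \<subseteq> insert v (set (adj ! v))"
proof -
  let ?A = "set (adj ! v)" and ?B = "set (adj ! r)"
  have l: "length (adj ! v) = card ?A" "length (adj ! r) = card ?B"
    using adj_distinct assms by (simp_all add: distinct_card)
  have i: "v \<notin> ?A" "r \<notin> ?B" "r \<in> ?A \<longleftrightarrow> v \<in> ?B" using adj_irrefl adj_sym assms by auto
  then have c: "card (?A - {r}) = card ?A - of_bool (v \<in> ?B)" "card (?B - {v}) = card ?B - of_bool (v \<in> ?B)"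
    by auto
  have pos: "v \<in> ?B \<Longrightarrow> 0 < card ?A \<and> 0 < card ?B" using i(3) by (auto simp: card_gt_0_iff)
  show ?thesis
  proof
    assume t: "twin v r"
    then have "card ?A - of_bool (v \<in> ?B) = card ?B - of_bool (v \<in> ?B)" using c by (simp add: twin_def)
    then have "card ?A = card ?B" using pos by (cases "v \<in> ?B") auto
    then show "length (adj ! r) = length (adj ! v) \<and> ?B \<subseteq> insert v ?A" using t l by (auto simp: twin_def)
  next
    assume a: "length (adj ! r) = length (adj ! v) \<and> ?B \<subseteq> insert v ?A"
    then have "?B - {v} \<subseteq> ?A - {r}" using i by auto
    moreover have "card (?B - {v}) = card (?A - {r})" using a c l by simp
    ultimately have "?B - {v} = ?A - {r}" by (intro card_subset_eq) auto
    then show "twin v r" by (simp add: twin_def)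
  qed
qed

lemma twin_sym: "twin i j \<longleftrightarrow> twin j i"
  by (auto simp: twin_def)

lemma sem_mark_neighbours:
  assumes "v < N" "rg s rp = list_pos v" "rg s rv = v" "ar s IN = inp" "\<forall>u. ar s MK u \<le> v"
  defines "s' \<equiv> sem mark_neighbours s"
  shows "\<forall>u. (ar s' MK u = Suc v) = (u \<in> set (adj ! v))" "\<forall>u. ar s' MK u \<le> Suc v"
    "tm s' \<le> tm s + 2 + 3 * length (adj ! v)"
proof -
  define body where "body = Sto MK (Ar IN (Plus (Plus (Rg rp) (Cn 1)) (Rg ri))) (Plus (Rg rv) (Cn 1))"
  define I where "I j s' \<longleftrightarrow> (\<forall>u. ar s' MK u = Suc v \<longleftrightarrow> (\<exists>i<j. u = adj ! v ! i)) \<and> (\<forall>u. ar s' MK u \<le> Suc v) \<and>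
    tm s' \<le> tm s + 2 + 3 * j" for j and s' :: st
  have "I (length (adj ! v)) (sem (For ri (Ar IN (Rg rp)) body) s)"
  proof (rule For_rule)
    \<comment> \<open>Stamps left by earlier vertices are at most \<open>v\<close>, so the stamp
      \<open>Suc v\<close> is fresh.\<close>
    have "ar s MK u \<noteq> Suc v" "ar s MK u \<le> Suc v" for u using assms(5)[rule_format, of u] by simp_all
    then show "I 0 (s\<lparr>rg := (rg s)(ri := 0), tm := tm s + 2\<rparr>)" by (simp add: I_def)
  next
    fix j s'
    assume j: "j < length (adj ! v)" and I: "I j s'" "rg s' ri = j" and f: "\<And>r. r \<noteq> ri \<Longrightarrow> r \<notin> wr body \<Longrightarrow> rg s' r = rg s r"
      "\<And>a. a \<notin> wa body \<Longrightarrow> ar s' a = ar s a"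
    have e: "rg s' rp = list_pos v" "rg s' rv = v" "ar s' IN = inp"
      using f(1)[of rp] f(1)[of rv] f(2)[of IN] assms by (simp_all add: body_def)
    show "I (Suc j) (loop_step ri body (Suc j) s')"
      using I e j by (auto simp: body_def I_def inp_vertex[OF assms(1)] less_Suc_eq)
  qed (use assms in \<open>simp_all add: body_def inp_vertex\<close>)
  then show "\<forall>u. (ar s' MK u = Suc v) = (u \<in> set (adj ! v))" "\<forall>u. ar s' MK u \<le> Suc v"
    "tm s' \<le> tm s + 2 + 3 * length (adj ! v)"
    by (auto simp: s'_def mark_neighbours_def body_def I_def in_set_conv_nth)
qed

lemma sem_compare_lists:
  assumes "v < N" "r < N" "length (adj ! r) = length (adj ! v)" "rg s rp = list_pos v" "rg s rv = v" "rg s rr = list_pos r" "ar s IN = inp"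
    and "\<forall>u. (ar s MK u = Suc v) = (u \<in> set (adj ! v))"
  defines "s' \<equiv> sem compare_lists s"
  shows "rg s' rok \<noteq> 0 \<longleftrightarrow> set (adj ! r) \<subseteq> insert v (set (adj ! v))"
    "tm s' \<le> tm s + 3 + 6 * length (adj ! v)"
proof -
  define s1 where "s1 = sem (Asg rok (Cn 1)) s"
  define body where "body = (Asg ru (Ar IN (Plus (Plus (Rg rr) (Cn 1)) (Rg ri))) ;;
       Cond (Eq (Rg ru) (Rg rv)) Nop (Cond (Eq (Ar MK (Rg ru)) (Plus (Rg rv) (Cn 1))) Nop (Asg rok (Cn 0))))"
  define I where "I j s' \<longleftrightarrow> (rg s' rok \<noteq> 0 \<longleftrightarrow> (\<forall>i<j. adj ! r ! i \<in> insert v (set (adj ! v)))) \<and>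
    tm s' \<le> tm s + 3 + 6 * j" for j and s' :: st
  have "I (length (adj ! v)) (sem (For ri (Ar IN (Rg rp)) body) s1)"
  proof (rule For_rule)
    show "I 0 (s1\<lparr>rg := (rg s1)(ri := 0), tm := tm s1 + 2\<rparr>)" by (simp add: I_def s1_def)
  next
    fix j s'
    assume j: "j < length (adj ! v)" and I: "I j s'" "rg s' ri = j" and f: "\<And>r. r \<noteq> ri \<Longrightarrow> r \<notin> wr body \<Longrightarrow> rg s' r = rg s1 r"
      "\<And>a. a \<notin> wa body \<Longrightarrow> ar s' a = ar s1 a"
    have e: "rg s' rp = list_pos v" "rg s' rv = v" "rg s' rr = list_pos r" "ar s' IN = inp" "ar s' MK = ar s MK"
      using f(1)[of rp] f(1)[of rv] f(1)[of rr] f(2)[of IN] f(2)[of MK] assms by (simp_all add: body_def s1_def)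
    show "I (Suc j) (loop_step ri body (Suc j) s')"
      using I e j assms(3,8) by (auto simp: body_def I_def inp_vertex[OF assms(2)] less_Suc_eq)
  qed (use assms in \<open>simp_all add: body_def inp_vertex s1_def\<close>)
  moreover have "set (adj ! r) \<subseteq> insert v (set (adj ! v)) \<longleftrightarrow>
      (\<forall>i<length (adj ! v). adj ! r ! i \<in> insert v (set (adj ! v)))"
    unfolding subset_eq assms(3)[symmetric] by (rule all_set_conv_all_nth)
  ultimately show "rg s' rok \<noteq> 0 \<longleftrightarrow> set (adj ! r) \<subseteq> insert v (set (adj ! v))"
    "tm s' \<le> tm s + 3 + 6 * length (adj ! v)"
    by (auto simp: s'_def compare_lists_def body_def I_def s1_def)
qed

lemma sem_find_type:
  assumes v: "v < N" and s: "rg s rp = list_pos v" "rg s rv = v" "ar s IN = inp" "\<forall>v<N. ar s STA v = list_pos v"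
    and mk: "\<forall>u. (ar s MK u = Suc v) = (u \<in> set (adj ! v))"
    and rep: "\<forall>j<rg s rm. ar s REP j < v"
  defines "s' \<equiv> sem find_type s"
  shows "rg s' rfd \<noteq> 0 \<Longrightarrow> ar s' CLS v < rg s rm \<and> twin v (ar s REP (ar s' CLS v))"
    "rg s' rfd = 0 \<Longrightarrow> \<forall>j<rg s rm. \<not> twin v (ar s REP j)"
    "\<forall>u. u \<noteq> v \<longrightarrow> ar s' CLS u = ar s CLS u"
    "tm s' \<le> tm s + 3 + (12 + 6 * length (adj ! v)) * rg s rm"
proof -
  define s1 where "s1 = sem (Asg rfd (Cn 0)) s"
  define body where "body = (Asg rr (Ar STA (Ar REP (Rg rj))) ;;
       Cond (Eq (Ar IN (Rg rr)) (Ar IN (Rg rp)))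
         (compare_lists ;; Cond (Rg rok) (Sto CLS (Rg rv) (Rg rj) ;; Asg rfd (Cn 1)) Nop) Nop)"
  define I where "I j s' \<longleftrightarrow> (rg s' rfd \<noteq> 0 \<longrightarrow> ar s' CLS v < rg s rm \<and> twin v (ar s REP (ar s' CLS v))) \<and>
    (rg s' rfd = 0 \<longrightarrow> (\<forall>i<j. \<not> twin v (ar s REP i))) \<and> (\<forall>u. u \<noteq> v \<longrightarrow> ar s' CLS u = ar s CLS u) \<and>
    tm s' \<le> tm s + 3 + (12 + 6 * length (adj ! v)) * j" for j and s' :: st
  have wb: "wr body = {rr, rok, ri, ru, rfd}" "wa body = {CLS}" by (auto simp: body_def)
  have "I (rg s rm) (sem (For rj (Rg rm) body) s1)"
  proof (rule For_rule)
    show "I 0 (s1\<lparr>rg := (rg s1)(rj := 0), tm := tm s1 + 2\<rparr>)" by (simp add: I_def s1_def)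
  next
    fix j s'
    assume j: "j < rg s rm" and I: "I j s'" "rg s' rj = j" and f: "\<And>r. r \<noteq> rj \<Longrightarrow> r \<notin> wr body \<Longrightarrow> rg s' r = rg s1 r"
      "\<And>a. a \<notin> wa body \<Longrightarrow> ar s' a = ar s1 a"
    have e: "rg s' rp = list_pos v" "rg s' rv = v" "rg s' rm = rg s rm" "ar s' IN = inp" "ar s' MK = ar s MK"
      "ar s' STA = ar s STA" "ar s' REP = ar s REP"
      using f(1)[of rp] f(1)[of rv] f(1)[of rm] f(2)[of IN] f(2)[of MK] f(2)[of STA] f(2)[of REP] s
      by (simp_all add: wb s1_def)
    let ?r = "ar s REP j"
    have r: "?r < v" "?r < N" "?r \<noteq> v" "v \<noteq> ?r" using rep j v by (auto intro: less_trans)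
    define s2 where "s2 = sem (Asg rr (Ar STA (Ar REP (Rg rj)))) (tick s')"
    have s2: "rg s2 rr = list_pos ?r" "rg s2 rp = list_pos v" "rg s2 rv = v" "ar s2 IN = inp" "ar s2 MK = ar s MK" "ar s2 CLS = ar s' CLS"
      "rg s2 rj = j" "rg s2 rfd = rg s' rfd" "tm s2 = tm s' + 2"
      using e I(2) r(2) s by (simp_all add: s2_def)
    show "I (Suc j) (loop_step rj body (Suc j) s')"
    proof (cases "length (adj ! ?r) = length (adj ! v)")
      case False
      then have "\<not> twin v ?r" using twin_iff[OF v r(2) r(4)] by simp
      moreover have "sem body (tick s') = tick s2"
        using False s2 by (simp add: body_def s2_def inp_vertex v r)
      ultimately show ?thesis using I(1) s2 by (auto simp: I_def less_Suc_eq)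
    next
      case True
      define s3 where "s3 = sem compare_lists (tick s2)"
      have b: "sem body (tick s') = sem (Cond (Rg rok) (Sto CLS (Rg rv) (Rg rj) ;; Asg rfd (Cn 1)) Nop) s3"
        using True s2 by (simp add: body_def s2_def s3_def inp_vertex v r)
      have s3: "rg s3 rok \<noteq> 0 \<longleftrightarrow> twin v ?r" "tm s3 \<le> tm s' + 6 + 6 * length (adj ! v)"
        using sem_compare_lists[OF v r(2) True, of "tick s2"] s2 mk twin_iff[OF v r(2) r(4)] True by (simp_all add: s3_def)
      have s3': "rg s3 rv = v" "rg s3 rj = j" "ar s3 CLS = ar s' CLS" "rg s3 rfd = rg s' rfd"
        using s2 by (simp_all add: s3_def sem_frame_rg sem_frame_ar)
      show ?thesis unfolding b using I(1) s3 s3' j by (auto simp: I_def less_Suc_eq)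
    qed
  qed (use assms in \<open>simp_all add: wb s1_def\<close>)
  then have I: "I (rg s rm) s'" by (simp add: s'_def find_type_def body_def s1_def)
  show "rg s' rfd \<noteq> 0 \<Longrightarrow> ar s' CLS v < rg s rm \<and> twin v (ar s REP (ar s' CLS v))"
    "rg s' rfd = 0 \<Longrightarrow> \<forall>j<rg s rm. \<not> twin v (ar s REP j)"
    "\<forall>u. u \<noteq> v \<longrightarrow> ar s' CLS u = ar s CLS u"
    "tm s' \<le> tm s + 3 + (12 + 6 * length (adj ! v)) * rg s rm"
    using I by (auto simp: I_def)
qed

text \<open>Representatives are pairwise no twins, so \<open>k\<close> bounds their number at every
  stage. Each vertex costs at most a constant times \<open>k + 1\<close> times the space of its
  list, and these spaces add up to \<open>list_pos N\<close>.\<close>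

lemma sem_classify:
  assumes s: "rg s rN = N" "ar s IN = inp" "\<forall>v<N. ar s STA v = list_pos v" "rg s rm = 0" "ar s MK = (\<lambda>_. 0)"
    and k: "\<And>R. R \<subseteq> {..<N} \<Longrightarrow> (\<And>i j. i \<in> R \<Longrightarrow> j \<in> R \<Longrightarrow> twin i j \<Longrightarrow> i = j) \<Longrightarrow> card R \<le> k"
  defines "s' \<equiv> sem classify s"
  shows "rg s' rm \<le> k" "\<forall>v<N. ar s' CLS v < rg s' rm \<and> ar s' REP (ar s' CLS v) < N \<and> twin v (ar s' REP (ar s' CLS v))"
    "tm s' \<le> tm s + 2 + 20 * (k + 1) * list_pos N"
proof -
  define body where "body = (Asg rp (Ar STA (Rg rv)) ;; mark_neighbours ;; find_type ;;
     Cond (Rg rfd) Nop (Sto REP (Rg rm) (Rg rv) ;; Sto CLS (Rg rv) (Rg rm) ;; Inc rm))"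
  define I where "I v s' \<longleftrightarrow> (\<forall>u<v. ar s' CLS u < rg s' rm \<and> twin u (ar s' REP (ar s' CLS u))) \<and>
    (\<forall>j<rg s' rm. ar s' REP j < v) \<and> (\<forall>j<rg s' rm. \<forall>j'<rg s' rm. twin (ar s' REP j) (ar s' REP j') \<longrightarrow> j = j') \<and>
    (\<forall>u. ar s' MK u \<le> v) \<and> tm s' \<le> tm s + 2 + 20 * (k + 1) * list_pos v" for v and s' :: st
  have wb: "wr body = {rp, ri, rfd, rj, rr, rok, ru, rm}" "wa body = {MK, CLS, REP}" by (auto simp: body_def)
  have mk: "rg s' rm \<le> k" if I: "I v s'" and v: "v \<le> N" for v s'
  proof -
    let ?R = "ar s' REP ` {..<rg s' rm}"
    have inj: "inj_on (ar s' REP) {..<rg s' rm}"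
      using I unfolding I_def inj_on_def by (auto simp: twin_def)
    have "card ?R \<le> k"
    proof (rule k)
      show "?R \<subseteq> {..<N}" using I v by (force simp: I_def)
    qed (use I in \<open>auto simp: I_def\<close>)
    then show ?thesis using card_image[OF inj] by simp
  qed
  have "I N (sem (For rv (Rg rN) body) s)"
  proof (rule For_rule)
    show "I 0 (s\<lparr>rg := (rg s)(rv := 0), tm := tm s + 2\<rparr>)" using s by (simp add: I_def)
  next
    fix v s'
    assume v: "v < N" and I: "I v s'" "rg s' rv = v" and f: "\<And>r. r \<noteq> rv \<Longrightarrow> r \<notin> wr body \<Longrightarrow> rg s' r = rg s r"
      "\<And>a. a \<notin> wa body \<Longrightarrow> ar s' a = ar s a"
    have e: "ar s' IN = inp" "ar s' STA = ar s STA"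
      using f(2)[of IN] f(2)[of STA] s by (simp_all add: wb)
    define m where "m = rg s' rm"
    have m: "m \<le> k" using mk[OF I(1)] v by (simp add: m_def)
    define s1 where "s1 = sem (Asg rp (Ar STA (Rg rv))) (tick s')"
    have s1: "rg s1 rp = list_pos v" "rg s1 rv = v" "ar s1 = ar s'" "rg s1 rm = m" "tm s1 = tm s' + 2"
      using I(2) e s v by (simp_all add: s1_def m_def)
    define s2 where "s2 = sem mark_neighbours s1"
    have "\<forall>u. ar s1 MK u \<le> v" using I s1 by (simp add: I_def)
    note sem_mark_neighbours[OF v s1(1,2) _ this, folded s2_def]
    then have s2: "\<forall>u. (ar s2 MK u = Suc v) = (u \<in> set (adj ! v))" "\<forall>u. ar s2 MK u \<le> Suc v"
      "tm s2 \<le> tm s' + 4 + 3 * length (adj ! v)"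
      using s1 e by simp_all
    have s2': "rg s2 rp = list_pos v" "rg s2 rv = v" "rg s2 rm = m" "ar s2 IN = inp" "ar s2 STA = ar s STA" "ar s2 REP = ar s' REP"
      "ar s2 CLS = ar s' CLS"
      using s1 e by (simp_all add: s2_def sem_frame_rg sem_frame_ar)
    define s3 where "s3 = sem find_type s2"
    have rep2: "\<forall>j<rg s2 rm. ar s2 REP j < v" using I(1) s2' by (simp add: I_def m_def)
    have sta2: "\<forall>v<N. ar s2 STA v = list_pos v" using s s2' by simp
    note s3 = sem_find_type[OF v s2'(1,2,4) sta2 s2(1) rep2, folded s3_def, unfolded s2']
    have s3': "rg s3 rv = v" "rg s3 rm = m" "ar s3 REP = ar s' REP" "ar s3 MK = ar s2 MK"
      using s2' by (simp_all add: s3_def sem_frame_rg sem_frame_ar)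
    have b: "sem body (tick s') = sem (Cond (Rg rfd) Nop (Sto REP (Rg rm) (Rg rv) ;; Sto CLS (Rg rv) (Rg rm) ;; Inc rm)) s3"
      by (simp add: body_def s1_def s2_def s3_def)
    have "(12 + 6 * length (adj ! v)) * m \<le> (12 + 6 * length (adj ! v)) * k" using m by simp
    then have t: "tm s3 + 5 \<le> tm s + 2 + 20 * (k + 1) * list_pos (Suc v)"
      using s3(4) s2(3) I(1) unfolding I_def by (simp add: list_pos_Suc algebra_simps)
    have I': "\<forall>u<v. ar s' CLS u < m \<and> twin u (ar s' REP (ar s' CLS u))" "\<forall>j<m. ar s' REP j < v"
      "\<forall>j<m. \<forall>j'<m. twin (ar s' REP j) (ar s' REP j') \<longrightarrow> j = j'"
      using I(1) by (auto simp: I_def m_def)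
    have old: "\<forall>u<v. ar s3 CLS u < m \<and> twin u (ar s' REP (ar s3 CLS u))" using I'(1) s3(3) by auto
    show "I (Suc v) (loop_step rv body (Suc v) s')"
    proof (cases "rg s3 rfd = 0")
      case False
      then show ?thesis unfolding b using s3(1) s3' old I' s2(2) t
        by (simp add: I_def less_Suc_eq)
    next
      case True
      have new: "\<forall>j<m. \<not> twin v (ar s' REP j)" using s3(2)[OF True] .
      then have new': "\<forall>j<m. \<not> twin (ar s' REP j) v" using twin_sym by blast
      have vv: "twin v v" by (simp add: twin_def)
      show ?thesis unfolding b using True s3' old I' s2(2) t new new' vv
        by (auto simp: I_def less_Suc_eq)
    qed
  qed (use assms in \<open>simp_all add: wb\<close>)
  then have I: "I N s'" by (simp add: s'_def classify_def body_def)
  show "rg s' rm \<le> k" using mk[OF I] by simp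
  show "\<forall>v<N. ar s' CLS v < rg s' rm \<and> ar s' REP (ar s' CLS v) < N \<and> twin v (ar s' REP (ar s' CLS v))"
    using I by (auto simp: I_def)
  show "tm s' \<le> tm s + 2 + 20 * (k + 1) * list_pos N" using I by (auto simp: I_def)
qed

end

section \<open>Building the integer program in memory\<close>

definition connect_types :: com where
  "connect_types = For rv (Rg rN) (Asg rp (Ar STA (Rg rv)) ;;
     For ri (Ar IN (Rg rp)) (Sto ADJ (Plus (Times (Rg rm) (Ar CLS (Rg rv)))
       (Ar CLS (Ar IN (Plus (Plus (Rg rp) (Cn 1)) (Rg ri))))) (Cn 1)))"

text \<open>A product may not be assigned, since its value need not be small, but it may serve as a
  loop bound; hence \<open>rM\<close> and \<open>rK\<close> are counted up. Every entry starts at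
  the offset \<open>rK\<close>, which represents 0.\<close>

definition fill_state :: com where
  "fill_state = Asg rM (Cn 0) ;; Loop (Plus (Times (Rg rm) (Rg rm)) (Rg rm)) (Inc rM) ;;
     Asg rK (Rg 0) ;; Loop (Plus (Times (Cn 2) (Times (Rg rm) (Times (Rg rm) (Rg rm)))) (Cn 2)) (Inc rK) ;;
     For ri (Rg rM) (Sto ST (Rg ri) (Rg rK))"

text \<open>A vertex that is already marked is a terminal of an earlier pair. For equal ends the
  second test is skipped, as the pair would otherwise clash with itself.\<close>

definition read_pair :: com where
  "read_pair = Asg rs (Ar IN (Plus (Plus (Rg rpp) (Cn 1)) (Times (Cn 2) (Rg ri)))) ;;
     Asg rt (Ar IN (Plus (Plus (Rg rpp) (Cn 2)) (Times (Cn 2) (Rg ri)))) ;;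
     Cond (Ar TRM (Rg rs)) (Asg rbad (Cn 1)) Nop ;; Sto TRM (Rg rs) (Cn 1) ;;
     Cond (Eq (Rg rs) (Rg rt)) Nop
       (Cond (Ar TRM (Rg rt)) (Asg rbad (Cn 1)) Nop ;; Sto TRM (Rg rt) (Cn 1) ;;
        Cond (Ar ADJ (Plus (Times (Rg rm) (Ar CLS (Rg rs))) (Ar CLS (Rg rt)))) Nop
          (Sto ST (Plus (Times (Rg rm) (Ar CLS (Rg rs))) (Ar CLS (Rg rt)))
             (Minus (Ar ST (Plus (Times (Rg rm) (Ar CLS (Rg rs))) (Ar CLS (Rg rt)))) (Cn 1))))"

definition read_pairs :: com where
  "read_pairs = Asg rbad (Cn 0) ;; For ri (Ar IN (Rg rpp)) read_pair"

definition count_free :: com where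
  "count_free = For rv (Rg rN) (Cond (Ar TRM (Rg rv)) Nop
     (Sto ST (Plus (Times (Rg rm) (Rg rm)) (Ar CLS (Rg rv)))
       (Plus (Ar ST (Plus (Times (Rg rm) (Rg rm)) (Ar CLS (Rg rv)))) (Cn 1))))"

lemma wr_setup [simp]:
  "wr connect_types = {rv, rp, ri}" "wa connect_types = {ADJ}" "wr fill_state = {rM, rK, ri}" "wa fill_state = {ST}"
  "wr read_pair = {rs, rt, rbad}" "wa read_pair = {TRM, ST}" "wr read_pairs = {rs, rt, rbad, ri}" "wa read_pairs = {TRM, ST}"
  "wr count_free = {rv}" "wa count_free = {ST}"
  by (auto simp: connect_types_def fill_state_def read_pair_def read_pairs_def count_free_def)

lemma sem_Loop_Inc:
  "sem (Loop e (Inc r)) s = s\<lparr>rg := (rg s)(r := rg s r + eval e s), tm := tm s + 1 + 2 * eval e s\<rparr>"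
proof -
  have "((\<lambda>s. sem (Inc r) (tick s)) ^^ j) (tick s) = s\<lparr>rg := (rg s)(r := rg s r + j), tm := tm s + 1 + 2 * j\<rparr>" for j
    by (induction j) (simp_all add: tick_def fun_upd_def cong: if_cong)
  then show ?thesis by simp
qed

lemma idx_eq:
  fixes m a b :: nat
  assumes "b < m" "b' < m"
  shows "m * a + b = m * a' + b' \<longleftrightarrow> a = a' \<and> b = b'"
proof
  assume e: "m * a + b = m * a' + b'"
  have "(m * a + b) div m = a" "(m * a' + b') div m = a'" using assms by simp_all
  with e show "a = a' \<and> b = b'" by simp
qed simp

lemma idx_less:
  fixes m a b :: nat
  assumes "a < m" "b < m"
  shows "m * a + b < m * m"
proof -
  have "m * a + b < m * Suc a" using assms by simp
  also have "\<dots> \<le> m * m" using assms by (intro mult_le_mono2) simp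
  finally show ?thesis .
qed

context code_word
begin

lemma sem_connect_types:
  assumes s: "rg s rN = N" "rg s rm = m" "ar s IN = inp" "\<forall>v<N. ar s STA v = list_pos v"
    and cls: "\<forall>v<N. ar s CLS v < m" and adj0: "ar s ADJ = (\<lambda>_. 0)"
  defines "s' \<equiv> sem connect_types s"
  shows "\<forall>a. \<forall>b<m. ar s' ADJ (m * a + b) \<noteq> 0 \<longleftrightarrow> (\<exists>u<N. \<exists>w\<in>set (adj ! u). ar s CLS u = a \<and> ar s CLS w = b)"
    "tm s' \<le> tm s + 2 + 10 * list_pos N"
proof -
  let ?c = "ar s CLS"
  define inner where "inner = Sto ADJ (Plus (Times (Rg rm) (Ar CLS (Rg rv)))
       (Ar CLS (Ar IN (Plus (Plus (Rg rp) (Cn 1)) (Rg ri))))) (Cn 1)"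
  define body where "body = (Asg rp (Ar STA (Rg rv)) ;; For ri (Ar IN (Rg rp)) inner)"
  define I where "I v s' \<longleftrightarrow> (\<forall>a. \<forall>b<m. ar s' ADJ (m * a + b) \<noteq> 0 \<longleftrightarrow> (\<exists>u<v. \<exists>w\<in>set (adj ! u). ?c u = a \<and> ?c w = b)) \<and>
     tm s' \<le> tm s + 2 + 10 * list_pos v" for v and s' :: st
  have wb: "wr body = {rp, ri}" "wa body = {ADJ}" by (auto simp: body_def inner_def)
  have "I N (sem (For rv (Rg rN) body) s)"
  proof (rule For_rule)
    show "I 0 (s\<lparr>rg := (rg s)(rv := 0), tm := tm s + 2\<rparr>)" using adj0 by (simp add: I_def)
  next
    fix v s'
    assume v: "v < N" and I: "I v s'" "rg s' rv = v" and f: "\<And>r. r \<noteq> rv \<Longrightarrow> r \<notin> wr body \<Longrightarrow> rg s' r = rg s r"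
      "\<And>a. a \<notin> wa body \<Longrightarrow> ar s' a = ar s a"
    have e: "ar s' IN = inp" "ar s' STA = ar s STA" "ar s' CLS = ?c" "rg s' rm = m"
      using f(2)[of IN] f(2)[of STA] f(2)[of CLS] f(1)[of rm] s by (simp_all add: wb)
    define s1 where "s1 = sem (Asg rp (Ar STA (Rg rv))) (tick s')"
    have s1: "rg s1 rp = list_pos v" "rg s1 rv = v" "ar s1 = ar s'" "rg s1 rm = m" "tm s1 = tm s' + 2"
      using I(2) e s v by (simp_all add: s1_def)
    define J where "J j s2 \<longleftrightarrow> (\<forall>a. \<forall>b<m. ar s2 ADJ (m * a + b) \<noteq> 0 \<longleftrightarrow>
        ar s' ADJ (m * a + b) \<noteq> 0 \<or> (\<exists>i<j. ?c v = a \<and> ?c (adj ! v ! i) = b)) \<and>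
      tm s2 \<le> tm s' + 4 + 3 * j" for j and s2 :: st
    have "J (length (adj ! v)) (sem (For ri (Ar IN (Rg rp)) inner) s1)"
    proof (rule For_rule)
      show "J 0 (s1\<lparr>rg := (rg s1)(ri := 0), tm := tm s1 + 2\<rparr>)" using s1 by (simp add: J_def)
    next
      fix j s2
      assume j: "j < length (adj ! v)" and J: "J j s2" "rg s2 ri = j" and f: "\<And>r. r \<noteq> ri \<Longrightarrow> r \<notin> wr inner \<Longrightarrow> rg s2 r = rg s1 r"
        "\<And>a. a \<notin> wa inner \<Longrightarrow> ar s2 a = ar s1 a"
      have e2: "ar s2 IN = inp" "ar s2 CLS = ?c" "rg s2 rm = m" "rg s2 rv = v" "rg s2 rp = list_pos v"
        using f(2)[of IN] f(2)[of CLS] f(1)[of rm] f(1)[of rv] f(1)[of rp] s1 e by (simp_all add: inner_def)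
      have "adj ! v ! j < N" using adj_less[OF v] j by simp
      then have c: "?c (adj ! v ! j) < m" using cls by simp
      show "J (Suc j) (loop_step ri inner (Suc j) s2)"
        using J e2 j c by (auto simp: inner_def J_def inp_vertex[OF v] less_Suc_eq idx_eq)
    qed (use s1 e v in \<open>simp_all add: inner_def inp_vertex\<close>)
    then have J: "J (length (adj ! v)) (sem body (tick s'))" by (simp add: body_def s1_def)
    show "I (Suc v) (loop_step rv body (Suc v) s')"
      using J I(1) unfolding I_def J_def
      by (simp add: list_pos_Suc less_Suc_eq in_set_conv_nth Bex_def) blast
  qed (use s in \<open>simp_all add: wb\<close>)
  then show "\<forall>a. \<forall>b<m. ar s' ADJ (m * a + b) \<noteq> 0 \<longleftrightarrow> (\<exists>u<N. \<exists>w\<in>set (adj ! u). ar s CLS u = a \<and> ar s CLS w = b)"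
    "tm s' \<le> tm s + 2 + 10 * list_pos N"
    by (auto simp: s'_def connect_types_def body_def inner_def I_def)
qed

lemma sem_fill_state:
  assumes s: "rg s rm = m" "rg s 0 = n"
  defines "s' \<equiv> sem fill_state s"
  shows "rg s' rM = m * m + m" "rg s' rK = n + 2 * (m * (m * m)) + 2" "\<forall>i<m * m + m. ar s' ST i = n + 2 * (m * (m * m)) + 2"
    "tm s' \<le> tm s + 10 + 5 * (m * m + m) + 4 * (m * (m * m))"
proof -
  define s1 where "s1 = sem (Asg rM (Cn 0) ;; Loop (Plus (Times (Rg rm) (Rg rm)) (Rg rm)) (Inc rM) ;;
     Asg rK (Rg 0) ;; Loop (Plus (Times (Cn 2) (Times (Rg rm) (Times (Rg rm) (Rg rm)))) (Cn 2)) (Inc rK)) s"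
  let ?K = "n + 2 * (m * (m * m)) + 2"
  have s1: "rg s1 rM = m * m + m" "rg s1 rK = ?K" "tm s1 = tm s + 8 + 2 * (m * m + m) + 4 * (m * (m * m))"
    using s by (simp_all add: s1_def sem_Loop_Inc del: sem.simps(6))
  define I where "I j s' \<longleftrightarrow> (\<forall>i<j. ar s' ST i = ?K) \<and> tm s' \<le> tm s1 + 2 + 3 * j" for j and s' :: st
  have "I (m * m + m) (sem (For ri (Rg rM) (Sto ST (Rg ri) (Rg rK))) s1)"
  proof (rule For_rule)
    fix j s'
    assume "I j s'" "rg s' ri = j"
      "\<And>r. r \<noteq> ri \<Longrightarrow> r \<notin> wr (Sto ST (Rg ri) (Rg rK)) \<Longrightarrow> rg s' r = rg s1 r"
    then show "I (Suc j) (loop_step ri (Sto ST (Rg ri) (Rg rK)) (Suc j) s')"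
      using s1 by (auto simp: I_def less_Suc_eq)
  qed (use s1 in \<open>simp_all add: I_def\<close>)
  then have I: "I (m * m + m) s'" by (simp add: s'_def fill_state_def s1_def)
  have f: "rg s' r = rg s1 r" if "r \<noteq> ri" for r
    using that by (simp add: s'_def fill_state_def s1_def sem_frame_rg)
  show "rg s' rM = m * m + m" "rg s' rK = ?K" "\<forall>i<m * m + m. ar s' ST i = ?K"
    "tm s' \<le> tm s + 10 + 5 * (m * m + m) + 4 * (m * (m * m))"
    using I s1 f[of rM] f[of rK] by (auto simp: I_def)
qed

lemma sem_read_pair:
  assumes i: "i < length ps" and s: "rg s rpp = list_pos N" "ar s IN = inp" "rg s ri = i" "rg s rm = m"
  defines "s' \<equiv> sem read_pair s" and "sv \<equiv> fst (ps ! i)" and "tv \<equiv> snd (ps ! i)"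
  defines "k \<equiv> m * ar s CLS sv + ar s CLS tv"
  shows "rg s' rbad \<noteq> 0 \<longleftrightarrow> rg s rbad \<noteq> 0 \<or> ar s TRM sv \<noteq> 0 \<or> ar s TRM tv \<noteq> 0"
    "\<forall>x. ar s' TRM x \<noteq> 0 \<longleftrightarrow> x = sv \<or> x = tv \<or> ar s TRM x \<noteq> 0"
    "\<forall>x. ar s' ST x = (if x = k \<and> sv \<noteq> tv \<and> ar s ADJ k = 0 then ar s ST x - 1 else ar s ST x)"
    "tm s' \<le> tm s + 12"
proof -
  note d = inp_pairs(2,3)[OF i, folded sv_def tv_def]
  define s1 where "s1 = sem (Asg rs (Ar IN (Plus (Plus (Rg rpp) (Cn 1)) (Times (Cn 2) (Rg ri)))) ;;
     Asg rt (Ar IN (Plus (Plus (Rg rpp) (Cn 2)) (Times (Cn 2) (Rg ri))))) s"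
  have s1: "rg s1 rs = sv" "rg s1 rt = tv" "rg s1 rm = m" "ar s1 = ar s" "rg s1 rbad = rg s rbad" "tm s1 = tm s + 2"
    using s d by (simp_all add: s1_def)
  define s2 where "s2 = sem (Cond (Ar TRM (Rg rs)) (Asg rbad (Cn 1)) Nop ;; Sto TRM (Rg rs) (Cn 1)) s1"
  have s2: "rg s2 rs = sv" "rg s2 rt = tv" "rg s2 rm = m" "ar s2 = (ar s)(TRM := (ar s TRM)(sv := 1))"
    "rg s2 rbad \<noteq> 0 \<longleftrightarrow> rg s rbad \<noteq> 0 \<or> ar s TRM sv \<noteq> 0" "tm s2 \<le> tm s + 5"
    using s1 by (simp_all add: s2_def)
  define c3 where "c3 = (Cond (Ar TRM (Rg rt)) (Asg rbad (Cn 1)) Nop ;; Sto TRM (Rg rt) (Cn 1) ;;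
        Cond (Ar ADJ (Plus (Times (Rg rm) (Ar CLS (Rg rs))) (Ar CLS (Rg rt)))) Nop
          (Sto ST (Plus (Times (Rg rm) (Ar CLS (Rg rs))) (Ar CLS (Rg rt)))
             (Minus (Ar ST (Plus (Times (Rg rm) (Ar CLS (Rg rs))) (Ar CLS (Rg rt)))) (Cn 1))))"
  have s': "s' = sem (Cond (Eq (Rg rs) (Rg rt)) Nop c3) s2"
    by (simp add: s'_def read_pair_def s2_def s1_def c3_def)
  show "rg s' rbad \<noteq> 0 \<longleftrightarrow> rg s rbad \<noteq> 0 \<or> ar s TRM sv \<noteq> 0 \<or> ar s TRM tv \<noteq> 0"
    "\<forall>x. ar s' TRM x \<noteq> 0 \<longleftrightarrow> x = sv \<or> x = tv \<or> ar s TRM x \<noteq> 0"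
    "\<forall>x. ar s' ST x = (if x = k \<and> sv \<noteq> tv \<and> ar s ADJ k = 0 then ar s ST x - 1 else ar s ST x)"
    "tm s' \<le> tm s + 12"
    using s2 by (auto simp: s' c3_def k_def)
qed

definition dem :: "(nat \<Rightarrow> nat) \<Rightarrow> (nat \<Rightarrow> nat \<Rightarrow> bool) \<Rightarrow> nat \<Rightarrow> nat \<Rightarrow> nat \<Rightarrow> nat" where
  "dem cls ad i a b = (\<Sum>j<i. of_bool (fst (ps ! j) \<noteq> snd (ps ! j) \<and> cls (fst (ps ! j)) = a \<and>
     cls (snd (ps ! j)) = b \<and> \<not> ad a b))"

lemma dem_le: "dem cls ad i a b \<le> i"
proof -
  have "dem cls ad i a b \<le> (\<Sum>j<i. 1)" unfolding dem_def by (intro sum_mono) simp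
  then show ?thesis by simp
qed

lemma sem_read_pairs:
  assumes s: "rg s rpp = list_pos N" "ar s IN = inp" "rg s rm = m"
    and cls: "\<forall>v<N. ar s CLS v < m" and trm: "ar s TRM = (\<lambda>_. 0)"
    and st: "\<forall>i<m * m + m. ar s ST i = K" and K: "n \<le> K"
    and ad: "\<And>a b. a < m \<Longrightarrow> b < m \<Longrightarrow> ar s ADJ (m * a + b) \<noteq> 0 \<longleftrightarrow> ad a b"
  defines "s' \<equiv> sem read_pairs s"
  shows "rg s' rbad \<noteq> 0 \<longleftrightarrow> (\<exists>j<length ps. \<exists>j'<j. {fst (ps ! j), snd (ps ! j)} \<inter> {fst (ps ! j'), snd (ps ! j')} \<noteq> {})"
    "\<forall>x. ar s' TRM x \<noteq> 0 \<longleftrightarrow> (\<exists>j<length ps. x = fst (ps ! j) \<or> x = snd (ps ! j))"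
    "\<forall>a<m. \<forall>b<m. int (ar s' ST (m * a + b)) = int K - int (dem (ar s CLS) ad (length ps) a b)"
    "\<forall>c<m. ar s' ST (m * m + c) = K"
    "tm s' \<le> tm s + 3 + 14 * length ps"
proof -
  let ?c = "ar s CLS"
  define s1 where "s1 = sem (Asg rbad (Cn 0)) s"
  define I where "I i s' \<longleftrightarrow>
    (rg s' rbad \<noteq> 0 \<longleftrightarrow> (\<exists>j<i. \<exists>j'<j. {fst (ps ! j), snd (ps ! j)} \<inter> {fst (ps ! j'), snd (ps ! j')} \<noteq> {})) \<and>
    (\<forall>x. ar s' TRM x \<noteq> 0 \<longleftrightarrow> (\<exists>j<i. x = fst (ps ! j) \<or> x = snd (ps ! j))) \<and>
    (\<forall>a<m. \<forall>b<m. int (ar s' ST (m * a + b)) = int K - int (dem ?c ad i a b)) \<and>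
    (\<forall>c<m. ar s' ST (m * m + c) = K) \<and> tm s' \<le> tm s + 3 + 14 * i" for i and s' :: st
  have "I (length ps) (sem (For ri (Ar IN (Rg rpp)) read_pair) s1)"
  proof (rule For_rule)
    show "I 0 (s1\<lparr>rg := (rg s1)(ri := 0), tm := tm s1 + 2\<rparr>)"
    proof -
      have "ar s ST (m * a + b) = K" if "a < m" "b < m" for a b using st idx_less[OF that] by simp
      then show ?thesis using trm st by (simp add: I_def s1_def dem_def)
    qed
  next
    fix i s'
    assume i: "i < length ps" and I: "I i s'" "rg s' ri = i" and f: "\<And>r. r \<noteq> ri \<Longrightarrow> r \<notin> wr read_pair \<Longrightarrow> rg s' r = rg s1 r"
      "\<And>a. a \<notin> wa read_pair \<Longrightarrow> ar s' a = ar s1 a"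
    have e: "rg (tick s') rpp = list_pos N" "ar (tick s') IN = inp" "rg (tick s') ri = i" "rg (tick s') rm = m"
      and e': "ar s' CLS = ?c" "ar s' ADJ = ar s ADJ"
      using f(1)[of rpp] f(1)[of rm] f(2)[of IN] f(2)[of CLS] f(2)[of ADJ] I(2) s by (simp_all add: s1_def)
    define sv tv where "sv = fst (ps ! i)" and "tv = snd (ps ! i)"
    define k where "k = m * ?c sv + ?c tv"
    define s2 where "s2 = sem read_pair (tick s')"
    note B = sem_read_pair[OF i e, folded s2_def sv_def tv_def, unfolded tick_simps e', folded k_def]
    have "(sv, tv) \<in> set ps" using i by (simp add: sv_def tv_def)
    then have lt: "?c sv < m" "?c tv < m" using ps_less cls by auto
    have in': "i < n" using i n_eq by simp
    have badI: "rg s' rbad \<noteq> 0 \<longleftrightarrow> (\<exists>j<i. \<exists>j'<j. {fst (ps ! j), snd (ps ! j)} \<inter> {fst (ps ! j'), snd (ps ! j')} \<noteq> {})"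
      and trmI: "ar s' TRM x \<noteq> 0 \<longleftrightarrow> (\<exists>j<i. x = fst (ps ! j) \<or> x = snd (ps ! j))"
      and STI: "a < m \<Longrightarrow> b < m \<Longrightarrow> int (ar s' ST (m * a + b)) = int K - int (dem ?c ad i a b)" for x a b
      using I(1) unfolding I_def by blast+
    have ex_Suc: "(\<exists>j<Suc i. Q j) \<longleftrightarrow> (\<exists>j<i. Q j) \<or> Q i" for Q by (auto simp: less_Suc_eq)
    have bad: "rg s2 rbad \<noteq> 0 \<longleftrightarrow> (\<exists>j<Suc i. \<exists>j'<j. {fst (ps ! j), snd (ps ! j)} \<inter> {fst (ps ! j'), snd (ps ! j')} \<noteq> {})"
    proof -
      have "(\<exists>j'<i. {sv, tv} \<inter> {fst (ps ! j'), snd (ps ! j')} \<noteq> {}) \<longleftrightarrow> ar s' TRM sv \<noteq> 0 \<or> ar s' TRM tv \<noteq> 0"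
        unfolding trmI by blast
      then show ?thesis unfolding B(1) ex_Suc badI sv_def[symmetric] tv_def[symmetric] by simp
    qed
    have trm': "\<forall>x. ar s2 TRM x \<noteq> 0 \<longleftrightarrow> (\<exists>j<Suc i. x = fst (ps ! j) \<or> x = snd (ps ! j))"
      unfolding ex_Suc using B(2) trmI sv_def tv_def by simp blast
    have D: "\<forall>a<m. \<forall>b<m. int (ar s2 ST (m * a + b)) = int K - int (dem ?c ad (Suc i) a b)"
    proof (intro allI impI)
      fix a b assume ab: "a < m" "b < m"
      have k: "m * a + b = k \<longleftrightarrow> a = ?c sv \<and> b = ?c tv" unfolding k_def by (rule idx_eq) (use ab lt in auto)
      \<comment> \<open>Fewer than \<open>K\<close> decrements have reached this entry, so the next
        one is not truncated.\<close>
      have "dem ?c ad i a b < K" using dem_le[of ?c ad i a b] in' K by simp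
      then have "0 < ar s' ST (m * a + b)" using STI[OF ab] by simp
      moreover have "ar s ADJ k = 0 \<longleftrightarrow> \<not> ad (?c sv) (?c tv)" using ad[OF lt] by (auto simp: k_def)
      moreover note STI[OF ab]
      moreover have "dem ?c ad (Suc i) a b = dem ?c ad i a b + of_bool (sv \<noteq> tv \<and> ?c sv = a \<and> ?c tv = b \<and> \<not> ad a b)"
        by (simp add: dem_def sv_def tv_def)
      ultimately show "int (ar s2 ST (m * a + b)) = int K - int (dem ?c ad (Suc i) a b)"
        using B(3) k by auto
    qed
    have F: "\<forall>c<m. ar s2 ST (m * m + c) = K"
    proof (intro allI impI)
      fix c assume c: "c < m"
      have "m * m + c \<noteq> k" using idx_less[OF lt] by (simp add: k_def)
      then show "ar s2 ST (m * m + c) = K" using B(3) I(1) c by (simp add: I_def)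
    qed
    show "I (Suc i) (loop_step ri read_pair (Suc i) s')"
      unfolding s2_def[symmetric] using bad trm' D F B(4) I(1) unfolding I_def by simp
  qed (use s in \<open>simp_all add: s1_def inp_pairs\<close>)
  then have "I (length ps) s'" by (simp add: s'_def read_pairs_def s1_def)
  then show "rg s' rbad \<noteq> 0 \<longleftrightarrow> (\<exists>j<length ps. \<exists>j'<j. {fst (ps ! j), snd (ps ! j)} \<inter> {fst (ps ! j'), snd (ps ! j')} \<noteq> {})"
    "\<forall>x. ar s' TRM x \<noteq> 0 \<longleftrightarrow> (\<exists>j<length ps. x = fst (ps ! j) \<or> x = snd (ps ! j))"
    "\<forall>a<m. \<forall>b<m. int (ar s' ST (m * a + b)) = int K - int (dem (ar s CLS) ad (length ps) a b)"
    "\<forall>c<m. ar s' ST (m * m + c) = K"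
    "tm s' \<le> tm s + 3 + 14 * length ps"
    unfolding I_def by blast+
qed

lemma sem_count_free:
  assumes s: "rg s rN = N" "rg s rm = m" and cls: "\<forall>v<N. ar s CLS v < m"
    and st: "\<forall>c<m. ar s ST (m * m + c) = K"
  defines "s' \<equiv> sem count_free s"
  shows "\<forall>c<m. ar s' ST (m * m + c) = K + card {v \<in> {..<N}. ar s TRM v = 0 \<and> ar s CLS v = c}"
    "\<forall>i<m * m. ar s' ST i = ar s ST i"
    "tm s' \<le> tm s + 2 + 5 * N"
proof -
  define body where "body = Cond (Ar TRM (Rg rv)) Nop
     (Sto ST (Plus (Times (Rg rm) (Rg rm)) (Ar CLS (Rg rv)))
       (Plus (Ar ST (Plus (Times (Rg rm) (Rg rm)) (Ar CLS (Rg rv)))) (Cn 1)))"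
  define I where "I v s' \<longleftrightarrow> (\<forall>c<m. ar s' ST (m * m + c) = K + card {u \<in> {..<v}. ar s TRM u = 0 \<and> ar s CLS u = c}) \<and>
    (\<forall>i<m * m. ar s' ST i = ar s ST i) \<and> tm s' \<le> tm s + 2 + 5 * v" for v and s' :: st
  have "I N (sem (For rv (Rg rN) body) s)"
  proof (rule For_rule)
    show "I 0 (s\<lparr>rg := (rg s)(rv := 0), tm := tm s + 2\<rparr>)" using st by (simp add: I_def)
  next
    fix v s'
    assume v: "v < N" and I: "I v s'" "rg s' rv = v" and f: "\<And>r. r \<noteq> rv \<Longrightarrow> r \<notin> wr body \<Longrightarrow> rg s' r = rg s r"
      "\<And>a. a \<notin> wa body \<Longrightarrow> ar s' a = ar s a"
    have e: "rg s' rm = m" "ar s' CLS = ar s CLS" "ar s' TRM = ar s TRM"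
      using f(1)[of rm] f(2)[of CLS] f(2)[of TRM] s by (simp_all add: body_def)
    have card: "card {u \<in> {..<Suc v}. ar s TRM u = 0 \<and> ar s CLS u = c} =
      card {u \<in> {..<v}. ar s TRM u = 0 \<and> ar s CLS u = c} + of_bool (ar s TRM v = 0 \<and> ar s CLS v = c)" for c
    proof (cases "ar s TRM v = 0 \<and> ar s CLS v = c")
      case True
      then have "{u \<in> {..<Suc v}. ar s TRM u = 0 \<and> ar s CLS u = c} = insert v {u \<in> {..<v}. ar s TRM u = 0 \<and> ar s CLS u = c}"
        by (auto simp: less_Suc_eq)
      then show ?thesis using True by simp
    next
      case False
      then have "{u \<in> {..<Suc v}. ar s TRM u = 0 \<and> ar s CLS u = c} = {u \<in> {..<v}. ar s TRM u = 0 \<and> ar s CLS u = c}"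
        by (auto simp: less_Suc_eq)
      then show ?thesis using False by simp
    qed
    show "I (Suc v) (loop_step rv body (Suc v) s')"
      using I e unfolding I_def card by (auto simp: body_def)
  qed (use s in \<open>simp_all add: body_def\<close>)
  then show "\<forall>c<m. ar s' ST (m * m + c) = K + card {v \<in> {..<N}. ar s TRM v = 0 \<and> ar s CLS v = c}"
    "\<forall>i<m * m. ar s' ST i = ar s ST i" "tm s' \<le> tm s + 2 + 5 * N"
    by (auto simp: I_def s'_def count_free_def body_def)
qed

end

section \<open>Search through the reachable vectors\<close>

abbreviation (input) slot :: "nat \<Rightarrow> exp \<Rightarrow> exp" where
  "slot r x \<equiv> Plus (Times (Rg r) (Rg rM)) x"

definition copy_state :: com where
  "copy_state = For ri (Rg rM) (Sto ST (slot rhi (Rg ri)) (Ar ST (slot re (Rg ri))))"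

text \<open>The increment comes first: if \<open>a = c\<close>, the first two updates hit the same
  entry, and decrementing first could be truncated at 0.\<close>

definition apply_column :: com where
  "apply_column = Sto ST (slot rhi (Plus (Times (Rg rm) (Rg ra)) (Rg rb))) (Plus (Ar ST (slot rhi (Plus (Times (Rg rm) (Rg ra)) (Rg rb)))) (Cn 1)) ;;
     Cond (Ar ADJ (Plus (Times (Rg rm) (Rg rc)) (Rg rb))) Nop
       (Sto ST (slot rhi (Plus (Times (Rg rm) (Rg rc)) (Rg rb))) (Minus (Ar ST (slot rhi (Plus (Times (Rg rm) (Rg rc)) (Rg rb)))) (Cn 1))) ;;
     Sto ST (slot rhi (Plus (Times (Rg rm) (Rg rm)) (Rg rc))) (Minus (Ar ST (slot rhi (Plus (Times (Rg rm) (Rg rm)) (Rg rc)))) (Cn 1))"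

definition branch_state :: com where
  "branch_state = copy_state ;; apply_column ;; Inc rhi ;; Inc re"

text \<open>The loop bound is evaluated once, so only the vectors present at the beginning are
  copied although \<open>rhi\<close> grows meanwhile. Columns that are not usable are zero and would
  only produce duplicates.\<close>

definition branch_column :: com where
  "branch_column = Cond (Ar ADJ (Plus (Times (Rg rm) (Rg ra)) (Rg rc)))
     (Cond (Ar ADJ (Plus (Times (Rg rm) (Rg ra)) (Rg rb))) Nop
       (Asg re (Rg rlo) ;; Loop (Minus (Rg rhi) (Rg rlo)) branch_state)) Nop"

definition branch_all :: com where
  "branch_all = For ra (Rg rm) (For rb (Rg rm) (For rc (Rg rm) branch_column))"

definition halve_state :: com where
  "halve_state = For ri (Rg rM) (Sto ST (slot rhi (Rg ri)) (Avg (Ar ST (slot re (Rg ri))) (Rg rK)))"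

definition compare_states :: com where
  "compare_states = Asg rok (Cn 1) ;;
     For ri (Rg rM) (Cond (Eq (Ar ST (slot rq (Rg ri))) (Ar ST (slot rhi (Rg ri)))) Nop (Asg rok (Cn 0)))"

text \<open>The candidate already stands in slot \<open>rhi\<close>, just behind the list; it joins
  the list when \<open>rhi\<close> is raised afterwards.\<close>

definition find_duplicate :: com where
  "find_duplicate = Asg rfd (Cn 0) ;; Asg rq (Rg rmid) ;;
     Loop (Minus (Rg rhi) (Rg rmid)) (compare_states ;; Cond (Rg rok) (Asg rfd (Cn 1)) Nop ;; Inc rq)"

definition halve_all :: com where
  "halve_all = Asg rmid (Rg rhi) ;; Asg re (Rg rlo) ;;
     Loop (Minus (Rg rmid) (Rg rlo)) (halve_state ;; find_duplicate ;; Cond (Rg rfd) Nop (Inc rhi) ;; Inc re)"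

text \<open>Earlier vectors are left in place and the current segment moves forward, which saves
  copying. Slot numbers grow by at most one per tick, so addresses stay polynomial.\<close>

definition run_level :: com where
  "run_level = branch_all ;; halve_all ;; Asg rlo (Rg rmid)"

definition run_levels :: com where
  "run_levels = Asg rlo (Cn 0) ;; Asg rhi (Cn 1) ;; For rlv (Rg rN) run_level"

definition test_state :: com where
  "test_state = Asg rok (Cn 1) ;; For ri (Rg rM) (Cond (Minus (Rg rK) (Ar ST (slot re (Rg ri)))) (Asg rok (Cn 0)) Nop)"

definition accept_states :: com where
  "accept_states = Asg 1 (Cn 0) ;; Asg re (Rg rlo) ;;
     Loop (Minus (Rg rhi) (Rg rlo)) (test_state ;; Cond (Rg rok) (Asg 1 (Cn 1)) Nop ;; Inc re) ;;
     Cond (Rg rbad) (Asg 1 (Cn 0)) Nop"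

lemma wr_search [simp]:
  "wr copy_state = {ri}" "wa copy_state = {ST}" "wr apply_column = {}" "wa apply_column = {ST}"
  "wr branch_state = {ri, rhi, re}" "wa branch_state = {ST}" "wr branch_column = {ri, rhi, re}" "wa branch_column = {ST}"
  "wr branch_all = {ra, rb, rc, ri, rhi, re}" "wa branch_all = {ST}" "wr halve_state = {ri}" "wa halve_state = {ST}"
  "wr compare_states = {rok, ri}" "wa compare_states = {}" "wr find_duplicate = {rok, ri, rfd, rq}" "wa find_duplicate = {}"
  "wr halve_all = {rmid, re, ri, rok, rfd, rq, rhi}" "wa halve_all = {ST}"
  "wr run_level = {ra, rb, rc, ri, rhi, re, rmid, rok, rfd, rq, rlo}" "wa run_level = {ST}"
  "wr run_levels = {ra, rb, rc, ri, rhi, re, rmid, rok, rfd, rq, rlo, rlv}" "wa run_levels = {ST}"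
  "wr test_state = {rok, ri}" "wa test_state = {}" "wr accept_states = {1, re, rok, ri}" "wa accept_states = {}"
  by (auto simp: copy_state_def apply_column_def branch_state_def branch_column_def branch_all_def halve_state_def compare_states_def find_duplicate_def halve_all_def
      run_level_def run_levels_def test_state_def accept_states_def)

text \<open>
  The row of demand \<open>(a, b)\<close> has index \<open>m * a + b\<close> and the row of the capacity of \<open>c\<close> has index
  \<open>m * m + c\<close>. In memory every entry is shifted by \<open>K\<close> to make it nonnegative.
\<close>

definition cv :: "(nat \<Rightarrow> nat \<Rightarrow> bool) \<Rightarrow> nat \<Rightarrow> nat \<times> nat \<times> nat \<Rightarrow> nat \<Rightarrow> int" where
  "cv ad m = (\<lambda>(a, b, c) i. if a < m \<and> b < m \<and> c < m \<and> ad a c \<and> \<not> ad a b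
     then of_bool (i = m * a + b) - of_bool (i = m * c + b \<and> \<not> ad c b) - of_bool (i = m * m + c) else 0)"

text \<open>The capacity row differs from both demand rows, and if the two demand rows coincide,
  their contributions have opposite signs.\<close>

lemma cv_abs: "\<bar>cv ad m x i\<bar> \<le> 1"
proof -
  obtain a b c where x: "x = (a, b, c)" by (cases x)
  have "m * a + b < m * m" "m * c + b < m * m" if "a < m" "b < m" "c < m"
    using idx_less that by auto
  then show ?thesis by (auto simp: x cv_def of_bool_def)
qed

lemma cv_zero: "m * m + m \<le> i \<Longrightarrow> cv ad m x i = 0"
proof -
  assume i: "m * m + m \<le> i"
  obtain a b c where x: "x = (a, b, c)" by (cases x)
  have "m * a + b < m * m" "m * c + b < m * m" if "a < m" "b < m" "c < m"
    using idx_less that by auto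
  then show ?thesis using i by (auto simp: x cv_def of_bool_def)
qed

lemma image_shift: "f ` {lo..<lo + d} = (\<lambda>i. f (lo + i)) ` {0..<d :: nat}"
proof -
  have "{lo..<lo + d} = (+) lo ` {0..<d}" using image_add_atLeastLessThan[of lo 0 d] by (simp add: add.commute)
  then show ?thesis by (simp only: image_image)
qed

locale layout =
  fixes m M K :: nat and ad :: "nat \<Rightarrow> nat \<Rightarrow> bool"
  assumes M: "M = m * m + m"
begin

text \<open>Undoes the offset \<open>K\<close>. The value 0 beyond \<open>M\<close> makes equality
  of vectors the same as equality of the stored entries.\<close>

definition vec :: "st \<Rightarrow> nat \<Rightarrow> nat \<Rightarrow> int" where
  "vec s e i = (if i < M then int (ar s ST (e * M + i)) - int K else 0)"

definition vecs :: "st \<Rightarrow> nat \<Rightarrow> nat \<Rightarrow> (nat \<Rightarrow> int) set" where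
  "vecs s lo hi = vec s ` {lo..<hi}"

definition ready :: "st \<Rightarrow> bool" where
  "ready s \<longleftrightarrow> rg s rM = M \<and> rg s rm = m \<and> rg s rK = K \<and>
     (\<forall>a<m. \<forall>b<m. ar s ADJ (m * a + b) \<noteq> 0 \<longleftrightarrow> ad a b)"

lemma readyD: "ready s \<Longrightarrow> rg s rM = M" "ready s \<Longrightarrow> rg s rm = m" "ready s \<Longrightarrow> rg s rK = K"
  by (auto simp: ready_def)

lemma ready_ADJ: "ready s \<Longrightarrow> a < m \<Longrightarrow> b < m \<Longrightarrow> ar s ADJ (m * a + b) = 0 \<longleftrightarrow> \<not> ad a b"
  unfolding ready_def by blast

lemma ready_cong: "ready s \<Longrightarrow> rg s' rM = rg s rM \<Longrightarrow> rg s' rm = rg s rm \<Longrightarrow> rg s' rK = rg s rK \<Longrightarrow>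
   ar s' ADJ = ar s ADJ \<Longrightarrow> ready s'"
  by (simp add: ready_def)

lemma slot_less: "e < h \<Longrightarrow> i < M \<Longrightarrow> e * M + i < h * M"
proof -
  assume a: "e < h" "i < M"
  have "e * M + i < Suc e * M" using a by simp
  also have "\<dots> \<le> h * M" using a by (intro mult_le_mono1) simp
  finally show ?thesis .
qed

lemma vec_cong: "(\<And>x. x < h * M \<Longrightarrow> ar s' ST x = ar s ST x) \<Longrightarrow> e < h \<Longrightarrow> vec s' e = vec s e"
  using slot_less by (auto simp: vec_def)

lemma vecs_cong: "(\<And>x. x < h * M \<Longrightarrow> ar s' ST x = ar s ST x) \<Longrightarrow> hi \<le> h \<Longrightarrow> vecs s' lo hi = vecs s lo hi"
  unfolding vecs_def by (intro image_cong refl vec_cong) auto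

lemma vecs_Suc: "lo \<le> hi \<Longrightarrow> vecs s lo (Suc hi) = insert (vec s hi) (vecs s lo hi)"
  by (simp add: vecs_def atLeastLessThanSuc)

lemma vec_same [simp]: "vec (s\<lparr>rg := f, tm := t\<rparr>) = vec s" "vec (tick s) = vec s"
  by (simp_all add: vec_def fun_eq_iff)

lemma sem_copy_state:
  assumes s: "rg s rM = M" "rg s rhi = h" "rg s re = e" "e < h"
  defines "s' \<equiv> sem copy_state s"
  shows "vec s' h = vec s e" "\<forall>x<h * M. ar s' ST x = ar s ST x" "tm s' \<le> tm s + 2 + 3 * M"
proof -
  define body where "body = Sto ST (slot rhi (Rg ri)) (Ar ST (slot re (Rg ri)))"
  define I where "I j s' \<longleftrightarrow> (\<forall>i<j. ar s' ST (h * M + i) = ar s ST (e * M + i)) \<and> (\<forall>x<h * M. ar s' ST x = ar s ST x) \<and>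
    tm s' \<le> tm s + 2 + 3 * j" for j and s' :: st
  have "I M (sem (For ri (Rg rM) body) s)"
  proof (rule For_rule)
    fix j s'
    assume j: "j < M" and I: "I j s'" "rg s' ri = j" and f: "\<And>r. r \<noteq> ri \<Longrightarrow> r \<notin> wr body \<Longrightarrow> rg s' r = rg s r"
    have e: "rg s' rM = M" "rg s' rhi = h" "rg s' re = e" using f s by (simp_all add: body_def)
    have "e * M + j < h * M" using slot_less s(4) j .
    then show "I (Suc j) (loop_step ri body (Suc j) s')"
      using I e by (auto simp: I_def body_def less_Suc_eq)
  qed (use s in \<open>simp_all add: I_def body_def\<close>)
  then show "vec s' h = vec s e" "\<forall>x<h * M. ar s' ST x = ar s ST x" "tm s' \<le> tm s + 2 + 3 * M"
    by (auto simp: I_def s'_def copy_state_def body_def vec_def)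
qed

text \<open>The assumption \<open>nn\<close> concerns the final vector only; together with the order
  of the updates it ensures that no decrement is truncated.\<close>

lemma sem_apply_column:
  assumes s: "ready s" "rg s rhi = h" "rg s ra = a" "rg s rb = b" "rg s rc = c" and lt: "a < m" "b < m" "c < m"
    and use: "ad a c" "\<not> ad a b" and nn: "\<And>i. - int K \<le> vec s h i + cv ad m (a, b, c) i"
  defines "s' \<equiv> sem apply_column s"
  shows "vec s' h = (\<lambda>i. vec s h i + cv ad m (a, b, c) i)" "\<forall>x<h * M. ar s' ST x = ar s ST x" "tm s' \<le> tm s + 4"
proof -
  define p1 p2 p3 where "p1 = m * a + b" and "p2 = m * c + b" and "p3 = m * m + c"
  have p: "p1 < m * m" "p2 < m * m" "p1 \<noteq> p3" "p2 \<noteq> p3" "p3 < M"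
    using idx_less[OF lt(1,2)] idx_less[OF lt(3,2)] lt by (auto simp: p1_def p2_def p3_def M)
  have p12: "p1 = p2 \<longleftrightarrow> a = c" unfolding p1_def p2_def using idx_eq[OF lt(2) lt(2)] by auto
  have cvi: "cv ad m (a, b, c) i = of_bool (i = p1) - of_bool (i = p2 \<and> \<not> ad c b) - of_bool (i = p3)" for i
    using lt use by (simp add: cv_def p1_def p2_def p3_def)
  define f where "f i = ar s ST (h * M + i)" for i
  define f1 where "f1 = f(p1 := Suc (f p1))"
  define f2 where "f2 = (if ad c b then f1 else f1(p2 := f1 p2 - 1))"
  define f3 where "f3 = f2(p3 := f2 p3 - 1)"
  have adj: "ar s ADJ (m * c + b) = 0 \<longleftrightarrow> \<not> ad c b" using ready_ADJ[OF s(1) lt(3,2)] .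
  define g1 where "g1 = (ar s ST)(h * M + p1 := Suc (ar s ST (h * M + p1)))"
  define g2 where "g2 = (if ad c b then g1 else g1(h * M + p2 := g1 (h * M + p2) - 1))"
  have "ar s' ST = g2(h * M + p3 := g2 (h * M + p3) - 1)"
    using s(2-5) readyD[OF s(1)] adj
    by (cases "ad c b") (simp_all add: s'_def apply_column_def g2_def g1_def p1_def p2_def p3_def)
  then have st: "ar s' ST (h * M + i) = f3 i" for i
    by (simp add: g2_def g1_def f3_def f2_def f1_def f_def)
  have nni: "0 \<le> int (f i) + cv ad m (a, b, c) i" if "i < M" for i
    using nn[of i] that by (simp add: vec_def f_def)
  have "int (f3 i) = int (f i) + cv ad m (a, b, c) i" if i: "i < M" for i
  proof -
    have M2: "p2 < M" using p M by simp
    have "1 \<le> f p3" using nni[of p3] p by (simp add: cvi)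
    moreover have "1 \<le> f1 p2" if "\<not> ad c b"
    proof (cases "p1 = p2")
      case False
      then show ?thesis using nni[of p2] that p M2 by (simp add: cvi f1_def)
    qed (simp add: f1_def)
    ultimately show ?thesis using p
      by (auto simp: f3_def f2_def f1_def cvi of_nat_diff split: if_splits)
  qed
  then have "vec s' h i = vec s h i + cv ad m (a, b, c) i" for i
    using cv_zero[of m i ad "(a, b, c)", folded M] by (cases "i < M") (simp_all add: vec_def st f_def)
  then show "vec s' h = (\<lambda>i. vec s h i + cv ad m (a, b, c) i)" by (simp add: fun_eq_iff)
  show "\<forall>x<h * M. ar s' ST x = ar s ST x" "tm s' \<le> tm s + 4"
    using s readyD[OF s(1)] by (auto simp: s'_def apply_column_def)
qed

text \<open>The list of old vectors followed by their shifted copies realises one step of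
  \<open>expand_insert\<close>. Repetitions are tolerated here, so the length at most doubles; the
  time is charged to the appended vectors.\<close>

lemma sem_branch_column:
  assumes s: "ready s" "rg s ra = a" "rg s rb = b" "rg s rc = c" "rg s rlo = lo" "rg s rhi = hi" "lo \<le> hi"
    and lt: "a < m" "b < m" "c < m"
    and nn: "\<forall>v\<in>vecs s lo hi. \<forall>i. - int K \<le> v i + cv ad m (a, b, c) i"
  defines "s' \<equiv> sem branch_column s"
  shows "vecs s' lo (rg s' rhi) = vecs s lo hi \<union> (\<lambda>v i. v i + cv ad m (a, b, c) i) ` vecs s lo hi"
    "hi \<le> rg s' rhi" "rg s' rhi \<le> hi + (hi - lo)" "\<forall>x<hi * M. ar s' ST x = ar s ST x"
    "tm s' \<le> tm s + 10 + (rg s' rhi - hi) * (3 * M + 12)"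
proof -
  have adj: "ar s ADJ (m * a + c) = 0 \<longleftrightarrow> \<not> ad a c" "ar s ADJ (m * a + b) = 0 \<longleftrightarrow> \<not> ad a b"
    using ready_ADJ[OF s(1)] lt by simp_all
  have "vecs s' lo (rg s' rhi) = vecs s lo hi \<union> (\<lambda>v i. v i + cv ad m (a, b, c) i) ` vecs s lo hi \<and>
    hi \<le> rg s' rhi \<and> rg s' rhi \<le> hi + (hi - lo) \<and> (\<forall>x<hi * M. ar s' ST x = ar s ST x) \<and>
    tm s' \<le> tm s + 10 + (rg s' rhi - hi) * (3 * M + 12)"
  proof (cases "ad a c \<and> \<not> ad a b")
    case False
    then have "cv ad m (a, b, c) i = 0" for i by (auto simp: cv_def)
    moreover have "rg s' rhi = hi" "ar s' = ar s" "tm s' \<le> tm s + 10"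
      using False adj s readyD[OF s(1)] by (auto simp: s'_def branch_column_def simp del: sem.simps(6))
    moreover have "vec s' = vec s" using \<open>ar s' = ar s\<close> by (intro ext) (simp add: vec_def)
    then have "vecs s' = vecs s" by (intro ext) (simp add: vecs_def)
    ultimately show ?thesis by simp
  next
    case True
    let ?add = "\<lambda>v i. v i + cv ad m (a, b, c) i"
    define s1 where "s1 = sem (Asg re (Rg rlo)) (tick (tick s))"
    have s1: "rg s1 re = lo" "rg s1 rhi = hi" "rg s1 rlo = lo" "rg s1 ra = a" "rg s1 rb = b" "rg s1 rc = c"
      "ar s1 = ar s" "tm s1 = tm s + 3" "ready s1"
      using s by (auto simp: s1_def intro!: ready_cong[OF s(1)])
    have s': "s' = sem (Loop (Minus (Rg rhi) (Rg rlo)) branch_state) s1"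
      using True adj s readyD[OF s(1)] by (simp add: s'_def branch_column_def s1_def del: sem.simps(6))
    define I where "I j s' \<longleftrightarrow> rg s' re = lo + j \<and> rg s' rhi = hi + j \<and> (\<forall>x<hi * M. ar s' ST x = ar s ST x) \<and>
      (\<forall>i<j. vec s' (hi + i) = ?add (vec s (lo + i))) \<and> tm s' \<le> tm s + 4 + j * (3 * M + 12)" for j and s' :: st
    have "I (eval (Minus (Rg rhi) (Rg rlo)) s1) s'" unfolding s'
    proof (rule Loop_rule)
      show "I 0 (tick s1)" using s1 by (simp add: I_def)
    next
      fix j s2
      assume j: "j < eval (Minus (Rg rhi) (Rg rlo)) s1" and I: "I j s2"
        and f: "\<And>r. r \<notin> wr branch_state \<Longrightarrow> rg s2 r = rg s1 r" "\<And>a. a \<notin> wa branch_state \<Longrightarrow> ar s2 a = ar s1 a"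
      have jl: "lo + j < hi" using j s1 by simp
      have r2: "ready s2" using s1 f by (auto intro!: ready_cong[OF s1(9)])
      define s3 where "s3 = sem copy_state (tick s2)"
      have c3: "vec s3 (hi + j) = vec s2 (lo + j)" "\<forall>x<(hi + j) * M. ar s3 ST x = ar s2 ST x" "tm s3 \<le> tm s2 + 3 + 3 * M"
        using sem_copy_state[of "tick s2" "hi + j" "lo + j"] I jl readyD(1)[OF r2] by (simp_all add: I_def s3_def)
      have v2: "vec s2 (lo + j) = vec s (lo + j)" using I jl by (intro vec_cong[of hi]) (auto simp: I_def)
      have s3: "ready s3" "rg s3 rhi = hi + j" "rg s3 re = lo + j" "rg s3 ra = a" "rg s3 rb = b" "rg s3 rc = c"
        using I s1 f by (auto simp: s3_def I_def sem_frame_rg sem_frame_ar intro!: ready_cong[OF r2])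
      define s4 where "s4 = sem apply_column s3"
      have "vec s (lo + j) \<in> vecs s lo hi" using jl by (simp add: vecs_def)
      then have "- int K \<le> vec s3 (hi + j) i + cv ad m (a, b, c) i" for i
        using nn c3(1) v2 by simp
      note a4 = sem_apply_column[OF s3(1,2,4,5,6) lt _ _ this, folded s4_def]
      have a4: "vec s4 (hi + j) = ?add (vec s (lo + j))" "\<forall>x<(hi + j) * M. ar s4 ST x = ar s3 ST x" "tm s4 \<le> tm s3 + 4"
        using a4 True c3(1) v2 by simp_all
      have keep: "ar s4 ST x = ar s2 ST x" if "x < (hi + j) * M" for x using a4(2) c3(2) that by simp
      have "vec s4 (hi + i) = vec s2 (hi + i)" if "i < j" for i
        using that keep by (intro vec_cong[of "hi + j"]) auto
      then have v4: "\<forall>i<Suc j. vec s4 (hi + i) = ?add (vec s (lo + i))"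
        using I a4(1) by (auto simp: I_def less_Suc_eq)
      have k4: "\<forall>x<hi * M. ar s4 ST x = ar s ST x"
      proof (intro allI impI)
        fix x assume "x < hi * M"
        then show "ar s4 ST x = ar s ST x" using keep[of x] I by (simp add: I_def add_mult_distrib)
      qed
      have e: "sem branch_state (tick s2) = sem (Inc re) (sem (Inc rhi) s4)"
        by (simp add: branch_state_def s3_def s4_def del: sem_Inc)
      have r4: "rg s4 rhi = hi + j" "rg s4 re = lo + j" using s3 by (simp_all add: s4_def sem_frame_rg)
      show "I (Suc j) (sem branch_state (tick s2))"
        unfolding e using v4 k4 r4 a4(3) c3(3) I by (simp add: I_def)
    qed
    then have I: "I (hi - lo) s'" using s1 by simp
    then have hi': "rg s' rhi = hi + (hi - lo)" by (simp add: I_def)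
    have "vecs s' lo (hi + (hi - lo)) = vecs s' lo hi \<union> vecs s' hi (hi + (hi - lo))"
      unfolding vecs_def using s(7) by (simp add: ivl_disj_un image_Un[symmetric])
    also have "vecs s' lo hi = vecs s lo hi" using I by (intro vecs_cong[of hi]) (auto simp: I_def)
    also have "vecs s' hi (hi + (hi - lo)) = ?add ` vecs s lo hi"
    proof -
      have "vecs s' hi (hi + (hi - lo)) = (\<lambda>i. vec s' (hi + i)) ` {0..<hi - lo}"
        unfolding vecs_def by (rule image_shift)
      also have "\<dots> = (\<lambda>i. ?add (vec s (lo + i))) ` {0..<hi - lo}"
        using I by (intro image_cong) (auto simp: I_def)
      also have "\<dots> = ?add ` (\<lambda>i. vec s (lo + i)) ` {0..<hi - lo}" by (simp add: image_image)
      also have "\<dots> = ?add ` vecs s lo hi"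
        using image_shift[of "vec s" lo "hi - lo"] s(7) by (simp add: vecs_def)
      finally show ?thesis .
    qed
    finally show ?thesis using I hi' s(7) by (simp add: I_def)
  qed
  then show "vecs s' lo (rg s' rhi) = vecs s lo hi \<union> (\<lambda>v i. v i + cv ad m (a, b, c) i) ` vecs s lo hi"
    "hi \<le> rg s' rhi" "rg s' rhi \<le> hi + (hi - lo)" "\<forall>x<hi * M. ar s' ST x = ar s ST x"
    "tm s' \<le> tm s + 10 + (rg s' rhi - hi) * (3 * M + 12)" by auto
qed


text \<open>The three loops run through the variables in lexicographic order. The time splits into
  the overhead of the loops and a charge per appended vector, so it is governed by the final length
  of the list.\<close>

lemma sem_branch_all:
  assumes s: "ready s" "rg s rlo = lo" "rg s rhi = hi" "lo \<le> hi"
  defines "X \<equiv> {..<m} \<times> {..<m} \<times> {..<m}"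
  assumes nn: "\<forall>v\<in>expand (cv ad m) X (vecs s lo hi). \<forall>i. - int K \<le> v i"
  defines "s' \<equiv> sem branch_all s"
  shows "vecs s' lo (rg s' rhi) = expand (cv ad m) X (vecs s lo hi)" "hi \<le> rg s' rhi"
    "rg s' rhi - lo \<le> (hi - lo) * 2 ^ (m * (m * m))" "\<forall>x<hi * M. ar s' ST x = ar s ST x"
    "tm s' \<le> tm s + 2 + (4 + (4 + 12 * m) * m) * m + (rg s' rhi - hi) * (3 * M + 12)"
proof -
  let ?E = "\<lambda>Y. expand (cv ad m) Y (vecs s lo hi)"
  define J where "J Y T s' \<longleftrightarrow> vecs s' lo (rg s' rhi) = ?E Y \<and> hi \<le> rg s' rhi \<and>
    rg s' rhi - lo \<le> (hi - lo) * 2 ^ card Y \<and> (\<forall>x<hi * M. ar s' ST x = ar s ST x) \<and>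
    tm s' \<le> tm s + T + (rg s' rhi - hi) * (3 * M + 12)" for Y T and s' :: st
  have Jt: "J Y T s1 \<Longrightarrow> J Y (T + d) (s1\<lparr>rg := (rg s1)(r := x), tm := tm s1 + d\<rparr>)" if "r \<noteq> rhi" for Y T s1 r x d
    using that by (simp add: J_def vecs_def)
  have finX: "finite X" by (simp add: X_def)
  \<comment> \<open>Every partial expansion is contained in the full one, so the lower bound
    \<open>- int K\<close> assumed for the latter protects all intermediate vectors.\<close>
  have mono: "?E Y \<subseteq> ?E X" if "Y \<subseteq> X" for Y
    using that unfolding expand_def by (intro image_mono) auto
  have step: "J (insert (a, b, c) Y) (T + 12) (s1'\<lparr>rg := (rg s1')(rc := x), tm := Suc (tm s1')\<rparr>)"
    if J: "J Y T s1" and r: "ready s1" "rg s1 rlo = lo" "rg s1 ra = a" "rg s1 rb = b" "rg s1 rc = c"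
      and lt: "a < m" "b < m" "c < m" and Y: "(a, b, c) \<notin> Y" "Y \<subseteq> X" and s1': "s1' = sem branch_column (tick s1)"
    for a b c Y T s1 s1' x
  proof -
    define h where "h = rg s1 rhi"
    have Ji: "vecs s1 lo h = ?E Y" "hi \<le> h" "h - lo \<le> (hi - lo) * 2 ^ card Y" "\<forall>x<hi * M. ar s1 ST x = ar s ST x"
      "tm s1 \<le> tm s + T + (h - hi) * (3 * M + 12)"
      using J by (simp_all add: J_def h_def)
    have fY: "finite Y" using Y finX finite_subset by blast
    have ins: "?E (insert (a, b, c) Y) = ?E Y \<union> (\<lambda>v i. v i + cv ad m (a, b, c) i) ` ?E Y"
      by (rule expand_insert[OF fY Y(1)])
    have "insert (a, b, c) Y \<subseteq> X" using Y lt by (auto simp: X_def)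
    from mono[OF this] have mem: "(\<lambda>i. v i + cv ad m (a, b, c) i) \<in> ?E X" if "v \<in> ?E Y" for v
      using that ins by auto
    have nn': "\<forall>v\<in>vecs (tick s1) lo h. \<forall>i. - int K \<le> v i + cv ad m (a, b, c) i"
    proof
      fix v assume "v \<in> vecs (tick s1) lo h"
      then have "v \<in> ?E Y" using Ji(1) by (simp add: vecs_def)
      from bspec[OF nn mem[OF this]] show "\<forall>i. - int K \<le> v i + cv ad m (a, b, c) i" .
    qed
    have r': "ready (tick s1)" "rg (tick s1) ra = a" "rg (tick s1) rb = b" "rg (tick s1) rc = c"
      "rg (tick s1) rlo = lo" "rg (tick s1) rhi = h" "lo \<le> h"
      using r Ji(2) s(4) by (auto simp: h_def intro: ready_cong)
    note c' = sem_branch_column[of "tick s1" a b c lo h, OF r' lt nn', folded s1']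
    have C: "vecs s1' lo (rg s1' rhi) = vecs s1 lo h \<union> (\<lambda>v i. v i + cv ad m (a, b, c) i) ` vecs s1 lo h"
      "h \<le> rg s1' rhi" "rg s1' rhi \<le> h + (h - lo)" "\<forall>x<h * M. ar s1' ST x = ar s1 ST x"
      "tm s1' \<le> tm s1 + 11 + (rg s1' rhi - h) * (3 * M + 12)"
      using c' by (simp_all add: vecs_def)
    have 1: "vecs s1' lo (rg s1' rhi) = ?E (insert (a, b, c) Y)" using C(1) Ji(1) ins by simp
    have "rg s1' rhi - lo \<le> 2 * (h - lo)" using C(2,3) by linarith
    also have "\<dots> \<le> 2 * ((hi - lo) * 2 ^ card Y)" using Ji(3) by simp
    also have "\<dots> = (hi - lo) * 2 ^ card (insert (a, b, c) Y)" using fY Y by simp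
    finally have 2: "rg s1' rhi - lo \<le> (hi - lo) * 2 ^ card (insert (a, b, c) Y)" .
    have 3: "\<forall>x<hi * M. ar s1' ST x = ar s ST x"
    proof (intro allI impI)
      fix x assume x: "x < hi * M"
      also have "\<dots> \<le> h * M" using Ji(2) by simp
      finally show "ar s1' ST x = ar s ST x" using C(4) Ji(4) x by simp
    qed
    have "rg s1' rhi - hi = (h - hi) + (rg s1' rhi - h)" using Ji(2) C(2) by simp
    then have "tm s1' + 1 \<le> tm s + (T + 12) + (rg s1' rhi - hi) * (3 * M + 12)"
      using C(5) Ji(5) by (simp add: add_mult_distrib)
    then show ?thesis using 1 2 3 C(2) Ji(2) by (simp add: J_def vecs_def)
  qed
  \<comment> \<open>The variables lexicographically before \<open>(a, 0, 0)\<close>,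
    \<open>(a, b, 0)\<close> and \<open>(a, b, c)\<close>: the progress of the outer, middle and
    inner loop.\<close>
  define Ya Yb Yc where "Ya a = {..<a} \<times> {..<m} \<times> {..<m}" and "Yb a b = Ya a \<union> {a} \<times> {..<b} \<times> {..<m}"
    and "Yc a b c = Yb a b \<union> {a} \<times> {b} \<times> {..<c}" for a b c :: nat
  have Yc: "insert (a, b, c) (Yc a b c) = Yc a b (Suc c)" "(a, b, c) \<notin> Yc a b c" for a b c
    by (auto simp: Ya_def Yb_def Yc_def less_Suc_eq)
  have Ycs: "Yc a b c \<subseteq> X" if "a < m" "b < m" "c < m" for a b c
    using that by (auto simp: Ya_def Yb_def Yc_def X_def)
  have Yb: "Yc a b 0 = Yb a b" "Yc a b m = Yb a (Suc b)" "Yb a 0 = Ya a" "Yb a m = Ya (Suc a)" "Ya 0 = {}" "Ya m = X" for a b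
    by (auto simp: Ya_def Yb_def Yc_def X_def less_Suc_eq)
  define Rd where "Rd s' \<longleftrightarrow> ready s' \<and> rg s' rlo = lo" for s'
  have Rd: "Rd s'" if "Rd s1" "\<And>r. r \<noteq> ra \<Longrightarrow> r \<noteq> rb \<Longrightarrow> r \<noteq> rc \<Longrightarrow> r \<noteq> ri \<Longrightarrow> r \<noteq> rhi \<Longrightarrow> r \<noteq> re \<Longrightarrow> rg s' r = rg s1 r"
    "\<And>a. a \<noteq> ST \<Longrightarrow> ar s' a = ar s1 a" for s1 s'
    using that by (auto simp: Rd_def intro!: ready_cong[of s1])
  have loop_c: "J (Yb a (Suc b)) (T + (2 + 12 * m)) (sem (For rc (Rg rm) branch_column) s1)"
    if J: "J (Yb a b) T s1" and r: "Rd s1" "rg s1 ra = a" "rg s1 rb = b" and lt: "a < m" "b < m" for a b T s1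
    unfolding Yb(2)[symmetric]
  proof (rule For_rule[where I = "\<lambda>c. J (Yc a b c) (T + (2 + 12 * c))"])
    show "J (Yc a b 0) (T + (2 + 12 * 0)) (s1\<lparr>rg := (rg s1)(rc := 0), tm := tm s1 + 2\<rparr>)"
      using Jt[OF _ J, of rc 2] by (simp add: Yb)
    show "eval (Rg rm) (s1\<lparr>rg := (rg s1)(rc := 0)\<rparr>) = m" using r readyD by (simp add: Rd_def)
  next
    fix c s2
    assume c: "c < m" and J: "J (Yc a b c) (T + (2 + 12 * c)) s2" "rg s2 rc = c"
      and f: "\<And>r. r \<noteq> rc \<Longrightarrow> r \<notin> wr branch_column \<Longrightarrow> rg s2 r = rg s1 r" "\<And>a. a \<notin> wa branch_column \<Longrightarrow> ar s2 a = ar s1 a"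
    have "Rd s2" using f by (intro Rd[OF r(1)]) auto
    then show "J (Yc a b (Suc c)) (T + (2 + 12 * Suc c)) (loop_step rc branch_column (Suc c) s2)"
      using step[OF J(1) _ _ _ _ J(2) lt c Yc(2) Ycs[OF lt c] refl, of "Suc c"] r f
      by (simp add: Rd_def Yc(1) ac_simps)
  qed simp
  have loop_b: "J (Ya (Suc a)) (T + (2 + (4 + 12 * m) * m)) (sem (For rb (Rg rm) (For rc (Rg rm) branch_column)) s1)"
    if J: "J (Ya a) T s1" and r: "Rd s1" "rg s1 ra = a" and lt: "a < m" for a T s1
    unfolding Yb(4)[symmetric]
  proof (rule For_rule[where I = "\<lambda>b. J (Yb a b) (T + (2 + (4 + 12 * m) * b))"])
    show "J (Yb a 0) (T + (2 + (4 + 12 * m) * 0)) (s1\<lparr>rg := (rg s1)(rb := 0), tm := tm s1 + 2\<rparr>)"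
      using Jt[OF _ J, of rb 2] by (simp add: Yb)
    show "eval (Rg rm) (s1\<lparr>rg := (rg s1)(rb := 0)\<rparr>) = m" using r readyD by (simp add: Rd_def)
  next
    fix b s2
    let ?c = "For rc (Rg rm) branch_column"
    assume b: "b < m" and J: "J (Yb a b) (T + (2 + (4 + 12 * m) * b)) s2" "rg s2 rb = b"
      and f: "\<And>r. r \<noteq> rb \<Longrightarrow> r \<notin> wr ?c \<Longrightarrow> rg s2 r = rg s1 r" "\<And>a. a \<notin> wa ?c \<Longrightarrow> ar s2 a = ar s1 a"
    have R: "Rd (tick s2)" using f by (intro Rd[OF r(1)]) auto
    have J': "J (Yb a b) (T + (2 + (4 + 12 * m) * b) + 1) (tick s2)" using J(1) by (simp add: J_def vecs_def)
    have "J (Yb a (Suc b)) (T + (2 + (4 + 12 * m) * b) + 1 + (2 + 12 * m)) (sem ?c (tick s2))"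
      using J(2) r f by (intro loop_c[OF J' R _ _ lt b]) simp_all
    moreover have e: "T + (2 + (4 + 12 * m) * Suc b) = T + (2 + (4 + 12 * m) * b) + 1 + (2 + 12 * m) + 1"
      by simp
    ultimately have "J (Yb a (Suc b)) (T + (2 + (4 + 12 * m) * Suc b)) ((sem ?c (tick s2))\<lparr>rg := (rg (sem ?c (tick s2)))(rb := Suc b),
        tm := tm (sem ?c (tick s2)) + 1\<rparr>)"
      unfolding e by (intro Jt) simp_all
    then
    show "J (Yb a (Suc b)) (T + (2 + (4 + 12 * m) * Suc b)) (loop_step rb ?c (Suc b) s2)"
      by (simp only: Suc_eq_plus1)
  qed simp
  have "J (Ya m) (2 + (4 + (4 + 12 * m) * m) * m) s'"
    unfolding s'_def branch_all_def
  proof (rule For_rule[where I = "\<lambda>a. J (Ya a) (2 + (4 + (4 + 12 * m) * m) * a)"])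
    show "J (Ya 0) (2 + (4 + (4 + 12 * m) * m) * 0) (s\<lparr>rg := (rg s)(ra := 0), tm := tm s + 2\<rparr>)"
      using s by (simp add: Yb J_def vecs_def)
    show "eval (Rg rm) (s\<lparr>rg := (rg s)(ra := 0)\<rparr>) = m" using s readyD by simp
  next
    fix a s2
    let ?c = "For rb (Rg rm) (For rc (Rg rm) branch_column)"
    assume a: "a < m" and J: "J (Ya a) (2 + (4 + (4 + 12 * m) * m) * a) s2" "rg s2 ra = a"
      and f: "\<And>r. r \<noteq> ra \<Longrightarrow> r \<notin> wr ?c \<Longrightarrow> rg s2 r = rg s r" "\<And>a. a \<notin> wa ?c \<Longrightarrow> ar s2 a = ar s a"
    have "Rd s" using s by (simp add: Rd_def)
    have R: "Rd (tick s2)" using f by (intro Rd[OF \<open>Rd s\<close>]) auto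
    have J': "J (Ya a) (2 + (4 + (4 + 12 * m) * m) * a + 1) (tick s2)" using J(1) by (simp add: J_def vecs_def)
    have "J (Ya (Suc a)) (2 + (4 + (4 + 12 * m) * m) * a + 1 + (2 + (4 + 12 * m) * m)) (sem ?c (tick s2))"
      using J(2) by (intro loop_b[OF J' R _ a]) simp_all
    moreover have e: "2 + (4 + (4 + 12 * m) * m) * Suc a = 2 + (4 + (4 + 12 * m) * m) * a + 1 + (2 + (4 + 12 * m) * m) + 1"
      by simp
    ultimately have "J (Ya (Suc a)) (2 + (4 + (4 + 12 * m) * m) * Suc a) ((sem ?c (tick s2))\<lparr>rg := (rg (sem ?c (tick s2)))(ra := Suc a),
        tm := tm (sem ?c (tick s2)) + 1\<rparr>)"
      unfolding e by (intro Jt) simp_all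
    then
    show "J (Ya (Suc a)) (2 + (4 + (4 + 12 * m) * m) * Suc a) (loop_step ra ?c (Suc a) s2)"
      by (simp only: Suc_eq_plus1)
  qed simp
  moreover have "card X = m * (m * m)" by (simp add: X_def card_cartesian_product)
  ultimately show "vecs s' lo (rg s' rhi) = expand (cv ad m) X (vecs s lo hi)" "hi \<le> rg s' rhi"
    "rg s' rhi - lo \<le> (hi - lo) * 2 ^ (m * (m * m))" "\<forall>x<hi * M. ar s' ST x = ar s ST x"
    "tm s' \<le> tm s + 2 + (4 + (4 + 12 * m) * m) * m + (rg s' rhi - hi) * (3 * M + 12)"
    by (simp_all add: J_def Yb)
qed


text \<open>The mean of a stored entry with \<open>K\<close> is the halved vector entry, rounded
  down and shifted by \<open>K\<close> again. Thus \<open>Avg\<close> halves signed numbers.\<close>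

lemma sem_halve_state:
  assumes s: "rg s rM = M" "rg s rK = K" "rg s rhi = h" "rg s re = e" "e < h"
  defines "s' \<equiv> sem halve_state s"
  shows "vec s' h = halve (vec s e)" "\<forall>x<h * M. ar s' ST x = ar s ST x" "tm s' \<le> tm s + 2 + 3 * M"
proof -
  define body where "body = Sto ST (slot rhi (Rg ri)) (Avg (Ar ST (slot re (Rg ri))) (Rg rK))"
  define I where "I j s' \<longleftrightarrow> (\<forall>i<j. ar s' ST (h * M + i) = (ar s ST (e * M + i) + K) div 2) \<and> (\<forall>x<h * M. ar s' ST x = ar s ST x) \<and>
    tm s' \<le> tm s + 2 + 3 * j" for j and s' :: st
  have "I M (sem (For ri (Rg rM) body) s)"
  proof (rule For_rule)
    fix j s'
    assume j: "j < M" and I: "I j s'" "rg s' ri = j" and f: "\<And>r. r \<noteq> ri \<Longrightarrow> r \<notin> wr body \<Longrightarrow> rg s' r = rg s r"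
    have e: "rg s' rM = M" "rg s' rhi = h" "rg s' re = e" "rg s' rK = K" using f s by (simp_all add: body_def)
    have "e * M + j < h * M" using slot_less s(5) j .
    then show "I (Suc j) (loop_step ri body (Suc j) s')"
      using I e by (auto simp: I_def body_def less_Suc_eq)
  qed (use s in \<open>simp_all add: I_def body_def\<close>)
  then have I: "I M s'" by (simp add: s'_def halve_state_def body_def)
  have "int ((x + K) div 2) - int K = (int x - int K) div 2" for x by linarith
  then show "vec s' h = halve (vec s e)" using I by (auto simp: I_def vec_def halve_def fun_eq_iff)
  show "\<forall>x<h * M. ar s' ST x = ar s ST x" "tm s' \<le> tm s + 2 + 3 * M" using I by (auto simp: I_def)
qed

lemma sem_compare_states:
  assumes s: "rg s rM = M" "rg s rhi = h" "rg s rq = q"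
  defines "s' \<equiv> sem compare_states s"
  shows "rg s' rok \<noteq> 0 \<longleftrightarrow> vec s q = vec s h" "tm s' \<le> tm s + 3 + 5 * M"
proof -
  define s1 where "s1 = sem (Asg rok (Cn 1)) s"
  define body where "body = Cond (Eq (Ar ST (slot rq (Rg ri))) (Ar ST (slot rhi (Rg ri)))) Nop (Asg rok (Cn 0))"
  define I where "I j s' \<longleftrightarrow> (rg s' rok \<noteq> 0 \<longleftrightarrow> (\<forall>i<j. ar s ST (q * M + i) = ar s ST (h * M + i))) \<and>
    tm s' \<le> tm s + 3 + 5 * j" for j and s' :: st
  have "I M (sem (For ri (Rg rM) body) s1)"
  proof (rule For_rule)
    fix j s'
    assume j: "j < M" and I: "I j s'" "rg s' ri = j" and f: "\<And>r. r \<noteq> ri \<Longrightarrow> r \<notin> wr body \<Longrightarrow> rg s' r = rg s1 r"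
      "\<And>a. a \<notin> wa body \<Longrightarrow> ar s' a = ar s1 a"
    have e: "rg s' rM = M" "rg s' rhi = h" "rg s' rq = q" "ar s' ST = ar s ST" using f s by (simp_all add: body_def s1_def)
    show "I (Suc j) (loop_step ri body (Suc j) s')"
      using I e by (auto simp: I_def body_def less_Suc_eq)
  qed (use s in \<open>simp_all add: I_def body_def s1_def\<close>)
  then have I: "I M s'" by (simp add: s'_def compare_states_def body_def s1_def)
  then show "rg s' rok \<noteq> 0 \<longleftrightarrow> vec s q = vec s h" "tm s' \<le> tm s + 3 + 5 * M"
    by (auto simp: I_def vec_def fun_eq_iff)
qed

lemma sem_find_duplicate:
  assumes s: "rg s rM = M" "rg s rhi = h" "rg s rmid = mid" "mid \<le> h"
  defines "s' \<equiv> sem find_duplicate s"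
  shows "rg s' rfd \<noteq> 0 \<longleftrightarrow> vec s h \<in> vecs s mid h" "tm s' \<le> tm s + 3 + (h - mid) * (5 * M + 8)"
proof -
  define s1 where "s1 = sem (Asg rfd (Cn 0) ;; Asg rq (Rg rmid)) s"
  define body where "body = (compare_states ;; Cond (Rg rok) (Asg rfd (Cn 1)) Nop ;; Inc rq)"
  have s1: "rg s1 rM = M" "rg s1 rhi = h" "rg s1 rmid = mid" "rg s1 rq = mid" "rg s1 rfd = 0" "ar s1 = ar s" "tm s1 = tm s + 2"
    using s by (simp_all add: s1_def)
  have wb: "wr body = {rok, ri, rfd, rq}" "wa body = {}" by (auto simp: body_def)
  define I where "I j s' \<longleftrightarrow> rg s' rq = mid + j \<and> (rg s' rfd \<noteq> 0 \<longleftrightarrow> (\<exists>i<j. vec s h = vec s (mid + i))) \<and>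
    tm s' \<le> tm s + 3 + j * (5 * M + 8)" for j and s' :: st
  have "I (eval (Minus (Rg rhi) (Rg rmid)) s1) (sem (Loop (Minus (Rg rhi) (Rg rmid)) body) s1)"
  proof (rule Loop_rule)
    show "I 0 (tick s1)" using s1 by (simp add: I_def)
  next
    fix j s2
    assume I: "I j s2"
      and f: "\<And>r. r \<notin> wr body \<Longrightarrow> rg s2 r = rg s1 r" "\<And>a. a \<notin> wa body \<Longrightarrow> ar s2 a = ar s1 a"
    have e: "rg s2 rM = M" "rg s2 rhi = h" "rg s2 rq = mid + j" "ar s2 ST = ar s ST"
      using f s1 I by (simp_all add: wb I_def)
    have v: "vec s2 x = vec s x" for x using e(4) by (simp add: vec_def fun_eq_iff)
    define s3 where "s3 = sem compare_states (tick s2)"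
    have s3: "rg s3 rok \<noteq> 0 \<longleftrightarrow> vec s (mid + j) = vec s h" "tm s3 \<le> tm s2 + 4 + 5 * M" "rg s3 rfd = rg s2 rfd"
      "rg s3 rq = mid + j"
      using sem_compare_states[of "tick s2" h "mid + j"] e by (simp_all add: s3_def v sem_frame_rg)
    have "sem body (tick s2) = sem (Cond (Rg rok) (Asg rfd (Cn 1)) Nop ;; Inc rq) s3" by (simp add: body_def s3_def)
    then show "I (Suc j) (sem body (tick s2))" using s3 I by (auto simp: I_def less_Suc_eq)
  qed
  then have I: "I (h - mid) s'" using s1 by (simp add: s'_def find_duplicate_def body_def s1_def)
  have "vec s h \<in> vecs s mid h \<longleftrightarrow> (\<exists>i<h - mid. vec s h = vec s (mid + i))"
    using image_shift[of "vec s" mid "h - mid"] s(4) by (auto simp: vecs_def)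
  then show "rg s' rfd \<noteq> 0 \<longleftrightarrow> vec s h \<in> vecs s mid h" "tm s' \<le> tm s + 3 + (h - mid) * (5 * M + 8)"
    using I by (auto simp: I_def)
qed

text \<open>Injectivity of \<open>vec s'\<close> on the new segment says that it has no repetitions.
  Its length is therefore a number of distinct vectors, at most \<open>S\<close> throughout, and so
  every search for a duplicate makes at most \<open>S\<close> comparisons.\<close>

lemma sem_halve_all:
  assumes s: "ready s" "rg s rlo = lo" "rg s rhi = mid" "lo \<le> mid"
    and S: "card (halve ` vecs s lo mid) \<le> S"
  defines "s' \<equiv> sem halve_all s"
  shows "rg s' rmid = mid" "mid \<le> rg s' rhi" "vecs s' mid (rg s' rhi) = halve ` vecs s lo mid"
    "inj_on (vec s') {mid..<rg s' rhi}" "tm s' \<le> tm s + 3 + (mid - lo) * (3 * M + 12 + S * (5 * M + 8))"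
proof -
  define T where "T = 3 * M + 12 + S * (5 * M + 8)"
  define s1 where "s1 = sem (Asg rmid (Rg rhi) ;; Asg re (Rg rlo)) s"
  define body where "body = (halve_state ;; find_duplicate ;; Cond (Rg rfd) Nop (Inc rhi) ;; Inc re)"
  have s1: "rg s1 rmid = mid" "rg s1 rhi = mid" "rg s1 rlo = lo" "rg s1 re = lo" "ar s1 = ar s" "ready s1" "tm s1 = tm s + 2"
    using s by (auto simp: s1_def intro: ready_cong[OF s(1)])
  have wb: "wr body = {ri, rok, rfd, rq, rhi, re}" "wa body = {ST}" by (auto simp: body_def)
  define I where "I j s' \<longleftrightarrow> rg s' re = lo + j \<and> mid \<le> rg s' rhi \<and> vecs s' mid (rg s' rhi) = halve ` vecs s lo (lo + j) \<and>
    inj_on (vec s') {mid..<rg s' rhi} \<and> (\<forall>x<mid * M. ar s' ST x = ar s ST x) \<and> tm s' \<le> tm s + 3 + j * T" for j and s' :: st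
  have "I (eval (Minus (Rg rmid) (Rg rlo)) s1) (sem (Loop (Minus (Rg rmid) (Rg rlo)) body) s1)"
  proof (rule Loop_rule)
    show "I 0 (tick s1)" using s1 by (simp add: I_def vecs_def)
  next
    fix j s2
    assume j: "j < eval (Minus (Rg rmid) (Rg rlo)) s1" and I: "I j s2"
      and f: "\<And>r. r \<notin> wr body \<Longrightarrow> rg s2 r = rg s1 r" "\<And>a. a \<notin> wa body \<Longrightarrow> ar s2 a = ar s1 a"
    have jl: "lo + j < mid" using j s1 by simp
    have r2: "ready s2" using f by (auto simp: wb intro!: ready_cong[OF s1(6)])
    have m2: "rg s2 rmid = mid" using f s1 by (simp add: wb)
    define h where "h = rg s2 rhi"
    have h: "mid \<le> h" "vecs s2 mid h = halve ` vecs s lo (lo + j)" "inj_on (vec s2) {mid..<h}"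
      "\<forall>x<mid * M. ar s2 ST x = ar s ST x" "rg s2 re = lo + j" "tm s2 \<le> tm s + 3 + j * T"
      using I by (simp_all add: I_def h_def)
    have hS: "h - mid \<le> S"
    proof -
      have "h - mid = card (vecs s2 mid h)" unfolding vecs_def using card_image[OF h(3)] by simp
      also have "\<dots> \<le> card (halve ` vecs s lo mid)"
        unfolding h(2) using jl by (intro card_mono image_mono) (auto simp: vecs_def)
      finally show ?thesis using S by simp
    qed
    have v2: "vec s2 (lo + j) = vec s (lo + j)" using h(4) jl by (intro vec_cong[of mid]) auto
    define s3 where "s3 = sem halve_state (tick s2)"
    have a3: "vec s3 h = halve (vec s (lo + j))" "\<forall>x<h * M. ar s3 ST x = ar s2 ST x" "tm s3 \<le> tm s2 + 3 + 3 * M"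
      using sem_halve_state[of "tick s2" h "lo + j"] h jl readyD(1,3)[OF r2] by (simp_all add: s3_def h_def v2)
    have r3: "rg s3 rM = M" "rg s3 rhi = h" "rg s3 rmid = mid" "rg s3 re = lo + j"
      using readyD[OF r2] m2 h by (simp_all add: s3_def h_def sem_frame_rg)
    define s4 where "s4 = sem find_duplicate s3"
    note d = sem_find_duplicate[OF r3(1,2,3) h(1), folded s4_def]
    have "tm s4 \<le> tm s3 + 3 + S * (5 * M + 8)"
      using mult_le_mono1[OF hS, of "5 * M + 8"] d(2) by linarith
    note d4 = d(1) this
    have r4: "rg s4 rhi = h" "rg s4 re = lo + j" "ar s4 = ar s3"
      using r3 by (simp_all add: s4_def sem_frame_rg sem_frame_ar fun_eq_iff)
    have keep: "vec s3 x = vec s2 x" if "x < h" for x using a3(2) that by (intro vec_cong[of h]) auto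
    have vs3: "vecs s3 mid h = halve ` vecs s lo (lo + j)" using h(2) keep by (simp add: vecs_def)
    have inj3: "inj_on (vec s3) {mid..<h}"
      using h(3) keep inj_on_cong[of "{mid..<h}" "vec s3" "vec s2"] by simp
    have st3: "\<forall>x<mid * M. ar s3 ST x = ar s ST x"
    proof (intro allI impI)
      fix x assume x: "x < mid * M"
      also have "\<dots> \<le> h * M" using h(1) by simp
      finally show "ar s3 ST x = ar s ST x" using a3(2) h(4) x by simp
    qed
    define s5 where "s5 = sem (Cond (Rg rfd) Nop (Inc rhi)) s4"
    have ar5: "ar s5 = ar s3" using r4 by (simp add: s5_def)
    have vec5: "vec s5 = vec s3" using ar5 by (intro ext) (simp add: vec_def)
    have new: "halve ` vecs s lo (lo + Suc j) = insert (vec s3 h) (halve ` vecs s lo (lo + j))"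
      using a3(1) by (simp add: vecs_Suc)
    have t5: "tm s5 + 1 \<le> tm s + 3 + Suc j * T"
    proof -
      have "tm s5 \<le> tm s4 + 2" by (simp add: s5_def)
      then show ?thesis using d4(2) a3(3) h(6) by (simp add: T_def)
    qed
    have five: "mid \<le> rg s5 rhi \<and> vecs s5 mid (rg s5 rhi) = halve ` vecs s lo (lo + Suc j) \<and> inj_on (vec s5) {mid..<rg s5 rhi} \<and>
          rg s5 re = lo + j"
    proof (cases "rg s4 rfd = 0")
      case False
      then have "rg s5 rhi = h" "rg s5 re = lo + j" using r4 by (simp_all add: s5_def)
      moreover have "vecs s5 = vecs s3" using vec5 by (intro ext) (simp add: vecs_def)
      ultimately show ?thesis
        using False d4(1) vs3 inj3 vec5 h(1) new by (simp add: insert_absorb)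
    next
      case True
      then have "rg s5 rhi = Suc h" "rg s5 re = lo + j" using r4 by (simp_all add: s5_def)
      moreover have "vecs s5 mid (Suc h) = insert (vec s3 h) (vecs s3 mid h)"
        using vecs_Suc[OF h(1), of s5] vec5 by (simp add: vecs_def)
      moreover have "inj_on (vec s3) {mid..<Suc h}"
        using inj3 True d4(1) h(1) by (simp add: atLeastLessThanSuc vecs_def)
      ultimately show ?thesis
        using vs3 vec5 h(1) new by simp
    qed
    have b: "sem body (tick s2) = sem (Inc re) s5"
      by (simp add: body_def s3_def s4_def s5_def del: sem_Inc)
    show "I (Suc j) (sem body (tick s2))"
      unfolding b using five t5 st3 ar5 by (simp add: I_def vecs_def)
  qed
  then have I: "I (mid - lo) s'" using s1 by (simp add: s'_def halve_all_def body_def s1_def)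
  show "rg s' rmid = mid" using s1 by (simp add: s'_def halve_all_def s1_def sem_frame_rg wb[unfolded body_def] del: sem.simps(6))
  show "mid \<le> rg s' rhi" "vecs s' mid (rg s' rhi) = halve ` vecs s lo mid"
    "inj_on (vec s') {mid..<rg s' rhi}" "tm s' \<le> tm s + 3 + (mid - lo) * (3 * M + 12 + S * (5 * M + 8))"
    using I s(4) by (simp_all add: I_def T_def)
qed


definition nvar :: nat where "nvar = m * (m * m)"

definition nstate :: nat where "nstate = (2 * nvar + 2) ^ M"

text \<open>A segment of at most \<open>nstate\<close> vectors is expanded to at most
  \<open>nstate * 2 ^ nvar\<close>, each of which is written, halved and compared with at most
  \<open>nstate\<close> others.\<close>

definition level_cost :: nat where
  "level_cost = 8 + (4 + (4 + 12 * m) * m) * m + nstate * 2 ^ nvar * (6 * M + 24 + nstate * (5 * M + 8))"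

text \<open>The offset \<open>K\<close> must absorb \<open>B + nvar + 1\<close> for the vectors at
  the start of a round and another \<open>nvar\<close> for the columns added during the round,
  before halving.\<close>

lemma sem_run_levels:
  assumes s: "ready s" "rg s rN = N" and B: "\<And>i. - int B \<le> vec s 0 i" "B + 2 * nvar + 1 \<le> K"
  defines "X \<equiv> {..<m} \<times> {..<m} \<times> {..<m}" and "s' \<equiv> sem run_levels s"
  shows "vecs s' (rg s' rlo) (rg s' rhi) = (level (cv ad m) X ^^ N) {vec s 0}" "rg s' rhi - rg s' rlo \<le> nstate"
    "rg s' rlo \<le> rg s' rhi" "tm s' \<le> tm s + 4 + level_cost * N"
proof -
  define b where "b = vec s 0"
  let ?R = "\<lambda>L. (level (cv ad m) X ^^ L) {b}"
  have X: "finite X" "card X \<le> nvar" by (simp_all add: X_def nvar_def card_cartesian_product)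
  have fin: "finite (?R L)" "card (?R L) \<le> nstate" for L
    using level_card[of "cv ad m" X nvar M b L, OF cv_abs X] cv_zero[of m _ ad, folded M]
    by (simp_all add: nstate_def b_def vec_def)
  define s1 where "s1 = sem (Asg rlo (Cn 0) ;; Asg rhi (Cn 1)) s"
  have s1: "rg s1 rlo = 0" "rg s1 rhi = 1" "ar s1 = ar s" "rg s1 rN = N" "ready s1" "tm s1 = tm s + 2"
    using s by (auto simp: s1_def intro: ready_cong[OF s(1)])
  define I where "I L s' \<longleftrightarrow> vecs s' (rg s' rlo) (rg s' rhi) = ?R L \<and> rg s' rlo \<le> rg s' rhi \<and>
    inj_on (vec s') {rg s' rlo..<rg s' rhi} \<and> tm s' \<le> tm s + 4 + level_cost * L" for L and s' :: st
  have size: "rg s' rhi - rg s' rlo \<le> nstate" if "I L s'" for L s'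
    using that fin(2)[of L] card_image[of "vec s'" "{rg s' rlo..<rg s' rhi}"] by (simp add: I_def vecs_def)
  have "I N (sem (For rlv (Rg rN) run_level) s1)"
  proof (rule For_rule)
    have "vec s1 = vec s" using s1(3) by (intro ext) (simp add: vec_def)
    then show "I 0 (s1\<lparr>rg := (rg s1)(rlv := 0), tm := tm s1 + 2\<rparr>)" using s1 by (simp add: I_def vecs_def b_def)
  next
    fix L s2
    assume I: "I L s2"
      and f: "\<And>r. r \<noteq> rlv \<Longrightarrow> r \<notin> wr run_level \<Longrightarrow> rg s2 r = rg s1 r" "\<And>a. a \<notin> wa run_level \<Longrightarrow> ar s2 a = ar s1 a"
    define lo hi where "lo = rg s2 rlo" and "hi = rg s2 rhi"
    have I2: "vecs s2 lo hi = ?R L" "lo \<le> hi" "inj_on (vec s2) {lo..<hi}" "tm s2 \<le> tm s + 4 + level_cost * L" "hi - lo \<le> nstate"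
      using I size[OF I] by (simp_all add: I_def lo_def hi_def)
    have r2: "ready (tick s2)" using f by (auto intro!: ready_cong[OF s1(5)])
    have R: "rg (tick s2) rlo = lo" "rg (tick s2) rhi = hi" by (simp_all add: lo_def hi_def)
    have v2: "vecs (tick s2) lo hi = ?R L" using I2(1) by (simp add: vecs_def)
    have nn: "\<forall>v\<in>expand (cv ad m) X (vecs (tick s2) lo hi). \<forall>i. - int K \<le> v i"
    proof (intro ballI allI)
      fix v i assume v: "v \<in> expand (cv ad m) X (vecs (tick s2) lo hi)"
      have "\<exists>u\<in>?R L. \<forall>i. \<bar>v i - u i\<bar> \<le> int nvar"
        using expand_bound[of "cv ad m" X nvar v "?R L", OF cv_abs X] v unfolding v2 .
      then obtain u where u: "u \<in> ?R L" "\<forall>i. \<bar>v i - u i\<bar> \<le> int nvar" by (elim bexE)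
      have "- int (B + nvar + 1) \<le> u i"
        using level_lower[of "cv ad m" X nvar u L b B i, OF cv_abs X u(1)] B(1) by (simp add: b_def)
      then show "- int K \<le> v i" using u(2)[rule_format, of i] B(2) by linarith
    qed
    define s3 where "s3 = sem branch_all (tick s2)"
    note E = sem_branch_all[OF r2 R I2(2) nn[unfolded X_def], folded s3_def X_def]
    define mid where "mid = rg s3 rhi"
    have v3: "vecs s3 lo mid = expand (cv ad m) X (?R L)" using E(1) v2 by (simp add: mid_def)
    have lm: "lo \<le> mid" using E(2) I2(2) by (simp add: mid_def)
    have sz: "mid - lo \<le> nstate * 2 ^ nvar"
      using E(3) mult_le_mono1[OF I2(5), of "2 ^ nvar"] unfolding mid_def nvar_def by linarith
    have r3: "ready s3" "rg s3 rlo = lo" by (auto simp: s3_def sem_frame_rg sem_frame_ar lo_def intro!: ready_cong[OF r2])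
    have hv: "halve ` vecs s3 lo mid = ?R (Suc L)" using v3 by (simp add: level_def)
    define s4 where "s4 = sem halve_all s3"
    have c: "card (halve ` vecs s3 lo mid) \<le> nstate" unfolding hv by (rule fin(2))
    note H = sem_halve_all[OF r3 mid_def[symmetric] lm c, folded s4_def, unfolded hv]
    have b: "sem run_level (tick s2) = sem (Asg rlo (Rg rmid)) s4" by (simp add: run_level_def s3_def s4_def)
    have "(mid - lo) * (3 * M + 12 + nstate * (5 * M + 8)) \<le> nstate * 2 ^ nvar * (3 * M + 12 + nstate * (5 * M + 8))"
      using sz by (rule mult_le_mono1)
    moreover have "(mid - hi) * (3 * M + 12) \<le> nstate * 2 ^ nvar * (3 * M + 12)"
      using sz I2(2) by (intro mult_le_mono1) simp
    ultimately have "tm s4 + 2 \<le> tm s + 4 + level_cost * Suc L"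
      using E(5) H(5) I2(4) unfolding level_cost_def mid_def[symmetric] by (simp add: algebra_simps)
    then show "I (Suc L) (loop_step rlv run_level (Suc L) s2)"
      unfolding b using H by (simp add: I_def vecs_def)
  qed (use s1 in simp_all)
  then have I: "I N s'" by (simp add: s'_def run_levels_def s1_def)
  show "vecs s' (rg s' rlo) (rg s' rhi) = (level (cv ad m) X ^^ N) {vec s 0}" "rg s' rhi - rg s' rlo \<le> nstate"
    "rg s' rlo \<le> rg s' rhi" "tm s' \<le> tm s + 4 + level_cost * N"
    using I size[OF I] by (simp_all add: I_def b_def)
qed

lemma sem_test_state:
  assumes s: "rg s rM = M" "rg s rK = K" "rg s re = e"
  defines "s' \<equiv> sem test_state s"
  shows "rg s' rok \<noteq> 0 \<longleftrightarrow> (\<forall>i. 0 \<le> vec s e i)" "tm s' \<le> tm s + 3 + 4 * M"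
proof -
  define s1 where "s1 = sem (Asg rok (Cn 1)) s"
  define body where "body = Cond (Minus (Rg rK) (Ar ST (slot re (Rg ri)))) (Asg rok (Cn 0)) Nop"
  define I where "I j s' \<longleftrightarrow> (rg s' rok \<noteq> 0 \<longleftrightarrow> (\<forall>i<j. K \<le> ar s ST (e * M + i))) \<and>
    tm s' \<le> tm s + 3 + 4 * j" for j and s' :: st
  have "I M (sem (For ri (Rg rM) body) s1)"
  proof (rule For_rule)
    fix j s'
    assume j: "j < M" and I: "I j s'" "rg s' ri = j" and f: "\<And>r. r \<noteq> ri \<Longrightarrow> r \<notin> wr body \<Longrightarrow> rg s' r = rg s1 r"
      "\<And>a. a \<notin> wa body \<Longrightarrow> ar s' a = ar s1 a"
    have e: "rg s' rM = M" "rg s' rK = K" "rg s' re = e" "ar s' ST = ar s ST" using f s by (simp_all add: body_def s1_def)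
    show "I (Suc j) (loop_step ri body (Suc j) s')"
      using I e by (auto simp: I_def body_def less_Suc_eq)
  qed (use s in \<open>simp_all add: I_def body_def s1_def\<close>)
  then have I: "I M s'" by (simp add: s'_def test_state_def body_def s1_def)
  then show "rg s' rok \<noteq> 0 \<longleftrightarrow> (\<forall>i. 0 \<le> vec s e i)" "tm s' \<le> tm s + 3 + 4 * M"
    by (auto simp: I_def vec_def)
qed

lemma sem_accept_states:
  assumes s: "rg s rM = M" "rg s rK = K" "rg s rlo = lo" "rg s rhi = hi" "lo \<le> hi"
  defines "s' \<equiv> sem accept_states s"
  shows "rg s' 1 \<noteq> 0 \<longleftrightarrow> rg s rbad = 0 \<and> (\<exists>v\<in>vecs s lo hi. \<forall>i. 0 \<le> v i)"
    "tm s' \<le> tm s + 5 + (hi - lo) * (4 * M + 8)"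
proof -
  define s1 where "s1 = sem (Asg 1 (Cn 0) ;; Asg re (Rg rlo)) s"
  define body where "body = (test_state ;; Cond (Rg rok) (Asg 1 (Cn 1)) Nop ;; Inc re)"
  have s1: "rg s1 rM = M" "rg s1 rK = K" "rg s1 rlo = lo" "rg s1 rhi = hi" "rg s1 re = lo" "rg s1 1 = 0" "ar s1 = ar s"
    "tm s1 = tm s + 2" "rg s1 rbad = rg s rbad"
    using s by (simp_all add: s1_def)
  have wb: "wr body = {1, re, rok, ri}" "wa body = {}" by (auto simp: body_def)
  define I where "I j s' \<longleftrightarrow> rg s' re = lo + j \<and> (rg s' 1 \<noteq> 0 \<longleftrightarrow> (\<exists>k<j. \<forall>i. 0 \<le> vec s (lo + k) i)) \<and>
    rg s' rbad = rg s rbad \<and> tm s' \<le> tm s + 3 + j * (4 * M + 8)" for j and s' :: st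
  define s2 where "s2 = sem (Loop (Minus (Rg rhi) (Rg rlo)) body) s1"
  have "I (eval (Minus (Rg rhi) (Rg rlo)) s1) s2" unfolding s2_def
  proof (rule Loop_rule)
    show "I 0 (tick s1)" using s1 by (simp add: I_def)
  next
    fix j s2
    assume I: "I j s2"
      and f: "\<And>r. r \<notin> wr body \<Longrightarrow> rg s2 r = rg s1 r" "\<And>a. a \<notin> wa body \<Longrightarrow> ar s2 a = ar s1 a"
    have e: "rg s2 rM = M" "rg s2 rK = K" "rg s2 re = lo + j" "ar s2 ST = ar s ST"
      using f s1 I by (simp_all add: wb I_def)
    have v: "vec s2 x = vec s x" for x using e(4) by (simp add: vec_def fun_eq_iff)
    define s3 where "s3 = sem test_state (tick s2)"
    have s3: "rg s3 rok \<noteq> 0 \<longleftrightarrow> (\<forall>i. 0 \<le> vec s (lo + j) i)" "tm s3 \<le> tm s2 + 4 + 4 * M" "rg s3 1 = rg s2 1"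
      "rg s3 re = lo + j" "rg s3 rbad = rg s2 rbad"
      using sem_test_state[of "tick s2" "lo + j"] e by (simp_all add: s3_def v sem_frame_rg)
    have ex_Suc: "(\<exists>k<Suc j. Q k) \<longleftrightarrow> (\<exists>k<j. Q k) \<or> Q j" for Q by (auto simp: less_Suc_eq)
    have "sem body (tick s2) = sem (Cond (Rg rok) (Asg 1 (Cn 1)) Nop ;; Inc re) s3" by (simp add: body_def s3_def)
    then show "I (Suc j) (sem body (tick s2))" using s3 I unfolding I_def ex_Suc by (cases "rg s3 rok = 0") auto
  qed
  then have I: "I (hi - lo) s2" using s1 by simp
  have "(\<exists>v\<in>vecs s lo hi. \<forall>i. 0 \<le> v i) \<longleftrightarrow> (\<exists>k<hi - lo. \<forall>i. 0 \<le> vec s (lo + k) i)"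
    using image_shift[of "vec s" lo "hi - lo"] s(5) by (auto simp: vecs_def Bex_def image_iff)
  moreover have "s' = sem (Cond (Rg rbad) (Asg 1 (Cn 0)) Nop) s2" by (simp add: s'_def accept_states_def s1_def s2_def body_def)
  ultimately show "rg s' 1 \<noteq> 0 \<longleftrightarrow> rg s rbad = 0 \<and> (\<exists>v\<in>vecs s lo hi. \<forall>i. 0 \<le> v i)"
    "tm s' \<le> tm s + 5 + (hi - lo) * (4 * M + 8)"
    using I by (auto simp: I_def)
qed

end

section \<open>Correctness and cost of the whole program\<close>

definition main :: com where
  "main = locate_lists ;; classify ;; connect_types ;; fill_state ;; read_pairs ;; count_free ;; run_levels ;; accept_states"

lemma wr_main [simp]:
  "wr locate_lists = {rN, rp, rv, rpp}" "wa locate_lists = {STA}"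
  "wr classify = {rv, rp, ri, rfd, rj, rr, rok, ru, rm}" "wa classify = {MK, CLS, REP}"
  by (auto simp: locate_lists_def classify_def)

context code_word
begin

definition ad :: "(nat \<Rightarrow> nat) \<Rightarrow> nat \<Rightarrow> nat \<Rightarrow> bool" where
  "ad cls a b \<longleftrightarrow> (\<exists>u<N. \<exists>w\<in>set (adj ! u). cls u = a \<and> cls w = b)"

definition terminal :: "nat \<Rightarrow> bool" where
  "terminal v \<longleftrightarrow> (\<exists>j<length ps. v = fst (ps ! j) \<or> v = snd (ps ! j))"

definition overlap :: bool where
  "overlap \<longleftrightarrow> (\<exists>j<length ps. \<exists>j'<j. {fst (ps ! j), snd (ps ! j)} \<inter> {fst (ps ! j'), snd (ps ! j')} \<noteq> {})"

text \<open>The right-hand side of the integer program in the row numbering used in memory: negated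
  demands, then the supply of free vertices.\<close>

definition start :: "(nat \<Rightarrow> nat) \<Rightarrow> nat \<Rightarrow> nat \<Rightarrow> int" where
  "start cls m i = (if i < m * m then - int (dem cls (ad cls) (length ps) (i div m) (i mod m))
     else if i < m * m + m then int (card {v \<in> {..<N}. \<not> terminal v \<and> cls v = i - m * m}) else 0)"

text \<open>The times of the eight phases; 38 is the sum of their additive constants.\<close>

definition cost :: "nat \<Rightarrow> nat \<Rightarrow> nat" where
  "cost k m = 38 + 19 * N + 20 * (k + 1) * list_pos N + 10 * list_pos N + 5 * (m * m + m) + 4 * (m * (m * m)) + 14 * length ps +
     layout.level_cost m (m * m + m) * N + layout.nstate m (m * m + m) * (4 * (m * m + m) + 8)"

text \<open>The program never learns \<open>k\<close>; it works with the number \<open>m\<close> of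
  types that it finds, and \<open>k\<close> enters only the analysis. Two vertices of one class are
  certified merely as twins of a common representative.\<close>

lemma main_correct:
  assumes k: "\<And>R. R \<subseteq> {..<N} \<Longrightarrow> (\<And>i j. i \<in> R \<Longrightarrow> j \<in> R \<Longrightarrow> twin i j \<Longrightarrow> i = j) \<Longrightarrow> card R \<le> k"
  obtains m cls where "m \<le> k" "\<And>v. v < N \<Longrightarrow> cls v < m"
    "\<And>u v. u < N \<Longrightarrow> v < N \<Longrightarrow> cls u = cls v \<Longrightarrow> \<exists>r<N. twin u r \<and> twin v r"
    "rg (sem main (ini xs)) 1 \<noteq> 0 \<longleftrightarrow> \<not> overlap \<and>
       (\<exists>v\<in>(level (cv (ad cls) m) ({..<m} \<times> {..<m} \<times> {..<m}) ^^ N) {start cls m}. \<forall>i. 0 \<le> v i)"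
    "tm (sem main (ini xs)) \<le> cost k m"
proof -
  note frame = sem_frame_rg sem_frame_ar
  have i0: "ar (ini xs) IN = inp" "rg (ini xs) 0 = n" "tm (ini xs) = 0"
    by (simp_all add: ini_def inp_def fun_eq_iff)
  define s1 where "s1 = sem locate_lists (ini xs)"
  note A = sem_locate_lists[OF i0(1,2), folded s1_def]
  have f1: "ar s1 IN = inp" "rg s1 0 = n" "rg s1 rm = 0" "ar s1 MK = (\<lambda>_. 0)" "ar s1 ADJ = (\<lambda>_. 0)" "ar s1 TRM = (\<lambda>_. 0)"
    using i0 by (simp_all add: s1_def frame, simp_all add: ini_def)
  define s2 where "s2 = sem classify s1"
  note B = sem_classify[OF A(1) f1(1) A(3) f1(3,4) k, folded s2_def]
  have f2: "rg s2 rN = N" "rg s2 rpp = list_pos N" "\<forall>v<N. ar s2 STA v = list_pos v" "ar s2 IN = inp" "rg s2 0 = n"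
    "ar s2 ADJ = (\<lambda>_. 0)" "ar s2 TRM = (\<lambda>_. 0)"
    using A f1 by (simp_all add: s2_def frame)
  define m cls where "m = rg s2 rm" and "cls = ar s2 CLS"
  define M K where "M = m * m + m" and "K = n + 2 * (m * (m * m)) + 2"
  have cls: "\<forall>v<N. ar s2 CLS v < m" using B(2) by (simp add: m_def)
  define s3 where "s3 = sem connect_types s2"
  note C = sem_connect_types[OF f2(1) m_def[symmetric] f2(4,3) cls f2(6), folded s3_def cls_def ad_def]
  have f3: "rg s3 rN = N" "rg s3 rpp = list_pos N" "ar s3 IN = inp" "rg s3 0 = n" "rg s3 rm = m" "ar s3 TRM = (\<lambda>_. 0)" "ar s3 CLS = cls"
    using f2 by (simp_all add: s3_def frame m_def cls_def)
  define s4 where "s4 = sem fill_state s3"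
  note D = sem_fill_state[OF f3(5,4), folded s4_def K_def]
  have f4: "rg s4 rN = N" "rg s4 rpp = list_pos N" "ar s4 IN = inp" "rg s4 rm = m" "ar s4 TRM = (\<lambda>_. 0)" "ar s4 CLS = cls"
    "ar s4 ADJ = ar s3 ADJ"
    using f3 by (simp_all add: s4_def frame)
  define s5 where "s5 = sem read_pairs s4"
  have nK: "n \<le> K" by (simp add: K_def)
  have cls4: "\<forall>v<N. ar s4 CLS v < m" using cls f4(6) by (simp add: cls_def)
  have ad4: "ar s4 ADJ (m * a + b) \<noteq> 0 \<longleftrightarrow> ad cls a b" if "a < m" "b < m" for a b
    using C(1) that f4(7) by simp
  note E = sem_read_pairs[OF f4(2,3,4) cls4 f4(5) D(3) nK ad4, folded s5_def overlap_def terminal_def, unfolded f4(6)]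
  have f5: "rg s5 rN = N" "rg s5 rm = m" "rg s5 rM = M" "rg s5 rK = K" "ar s5 CLS = cls" "ar s5 ADJ = ar s3 ADJ"
    using f4 D by (simp_all add: s5_def frame M_def)
  define s6 where "s6 = sem count_free s5"
  have cls5: "\<forall>v<N. ar s5 CLS v < m" using cls f5(5) by (simp add: cls_def)
  note F = sem_count_free[OF f5(1,2) cls5 E(4), folded s6_def]
  have f6: "rg s6 rN = N" "rg s6 rm = m" "rg s6 rM = M" "rg s6 rK = K" "ar s6 ADJ = ar s3 ADJ" "rg s6 rbad = rg s5 rbad"
    using f5 by (simp_all add: s6_def frame)
  interpret layout m M K "ad cls" by unfold_locales (simp add: M_def)
  have r6: "ready s6" using f6 C(1) by (simp add: ready_def)
  have start: "vec s6 0 = start cls m"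
  proof
    fix i
    consider (d) "i < m * m" | (c) "m * m \<le> i" "i < M" | (z) "M \<le> i" by linarith
    then show "vec s6 0 i = start cls m i"
    proof cases
      case d
      then have m: "0 < m" by (cases m) auto
      have i: "i = m * (i div m) + i mod m" by simp
      have ab: "i div m < m" "i mod m < m" using d m by (simp_all add: less_mult_imp_div_less)
      have "int (ar s5 ST (m * (i div m) + i mod m)) = int K - int (dem cls (ad cls) (length ps) (i div m) (i mod m))"
        using E(3) ab by blast
      then have "int (ar s5 ST i) = int K - int (dem cls (ad cls) (length ps) (i div m) (i mod m))"
        using i by simp
      moreover have "i < M" using d by (simp add: M_def)
      ultimately show ?thesis using d F(2) by (simp add: vec_def start_def)
    next
      case c
      then obtain j where j: "i = m * m + j" "j < m" unfolding M_def using le_Suc_ex by (metis add_less_cancel_left)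
      have "ar s6 ST (m * m + j) = K + card {v \<in> {..<N}. ar s5 TRM v = 0 \<and> cls v = j}" using F(1) j(2) f5(5) by simp
      moreover have "ar s5 TRM v = 0 \<longleftrightarrow> \<not> terminal v" for v using E(2) by blast
      ultimately show ?thesis using j c(2) by (simp add: vec_def start_def)
    next
      case z
      then show ?thesis using z[unfolded M_def] by (simp add: vec_def start_def)
    qed
  qed
  have low: "- int (length ps) \<le> vec s6 0 i" for i
    unfolding start start_def using dem_le[of cls "ad cls" "length ps"] by auto
  \<comment> \<open>The number of pairs is at most \<open>n\<close>, and \<open>2 * nvar + 1\<close>
    is covered by the remaining summands of \<open>K\<close>.\<close>
  have KB: "length ps + 2 * nvar + 1 \<le> K" using n_eq by (simp add: K_def nvar_def)
  define s7 where "s7 = sem run_levels s6"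
  note G = sem_run_levels[OF r6 f6(1) low KB, folded s7_def, unfolded start]
  have f7: "rg s7 rM = M" "rg s7 rK = K" "rg s7 rbad = rg s5 rbad"
    using f6 by (simp_all add: s7_def frame)
  define s8 where "s8 = sem accept_states s7"
  note H = sem_accept_states[OF f7(1,2) refl refl G(3), folded s8_def, unfolded G(1) f7]
  have s8: "sem main (ini xs) = s8"
    by (simp add: main_def s1_def s2_def s3_def s4_def s5_def s6_def s7_def s8_def)
  show thesis
  proof (rule that)
    show mk: "m \<le> k" using B(1) by (simp add: m_def)
    show "cls v < m" if "v < N" for v using cls that by (simp add: cls_def)
    show "\<exists>r<N. twin u r \<and> twin v r" if "u < N" "v < N" "cls u = cls v" for u v
      using B(2) that unfolding cls_def by metis
    show "rg (sem main (ini xs)) 1 \<noteq> 0 \<longleftrightarrow> \<not> overlap \<and>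
       (\<exists>v\<in>(level (cv (ad cls) m) ({..<m} \<times> {..<m} \<times> {..<m}) ^^ N) {start cls m}. \<forall>i. 0 \<le> v i)"
      unfolding s8 H(1) using E(1) by blast
    have B3: "tm s2 \<le> tm s1 + 2 + 20 * (k + 1) * list_pos N" by (rule B(3); blast)
    have E5: "tm s5 \<le> tm s4 + 3 + 14 * length ps" by (rule E(5); blast)
    have F3: "tm s6 \<le> tm s5 + 2 + 5 * N" by (rule F(3); blast)
    have "(rg s7 rhi - rg s7 rlo) * (4 * M + 8) \<le> nstate * (4 * M + 8)" using G(2) by (rule mult_le_mono1)
    then show "tm (sem main (ini xs)) \<le> cost k m"
      unfolding s8 cost_def M_def[symmetric]
      using H(2) G(4) F3 E5 D(4)[folded M_def] C(2) B3 A(4) i0(3) by linarith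
  qed
qed


text \<open>\<open>S\<close> bounds the number of vectors in a round, and also
  \<open>m * m + m\<close>. A round expands \<open>S\<close> vectors to
  \<open>S * 2 ^ k ^ 3\<close>, each compared with up to \<open>S\<close> others of at most
  \<open>S\<close> entries, whence the third power.\<close>

lemma cost_le:
  fixes k m :: nat
  defines "S \<equiv> (2 * k ^ 3 + 2) ^ (k\<^sup>2 + k)"
  assumes "m \<le> k" "1 \<le> k"
  shows "cost k m \<le> 140 * (S ^ 3 * 2 ^ k ^ 3 * n)"
proof -
  let ?M = "m * m + m" and ?Q = "k ^ 3"
  define W :: nat where "W = 2 ^ ?Q"
  define Z where "Z = S ^ 3 * W * n"
  interpret layout m ?M 0 "\<lambda>_ _. False" by unfold_locales simp
  have "1 \<le> k\<^sup>2 + k" using assms(3) by simp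
  then have S: "2 * ?Q + 2 \<le> S" unfolding S_def using assms(3) by (intro self_le_power) auto
  have "1 \<le> ?Q" using assms(3) by simp
  then have S4: "4 \<le> S" using S by simp
  have kk: "k \<le> ?Q" "k * k \<le> ?Q" using assms(3) by (simp_all add: power3_eq_cube)
  have mm: "m * m \<le> k * k" using assms(2) by (simp add: mult_le_mono)
  then have mmm: "m * (m * m) \<le> ?Q" using assms(2) mult_le_mono[OF assms(2) mm] by (simp add: power3_eq_cube)
  have M: "?M \<le> k\<^sup>2 + k" using mm assms(2) by (simp add: power2_eq_square)
  have MS: "?M \<le> S" using mm assms(2) kk S by linarith
  have nv: "nvar \<le> ?Q" using mmm by (simp add: nvar_def)
  have "nstate \<le> (2 * ?Q + 2) ^ ?M" unfolding nstate_def using nv by (intro power_mono) auto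
  also have "\<dots> \<le> S" unfolding S_def using M by (intro power_increasing) auto
  finally have ns: "nstate \<le> S" .
  have nw: "2 ^ nvar \<le> W" unfolding W_def using nv by (intro power_increasing) auto
  have W1: "1 \<le> W" by (simp add: W_def)
  have n2: "2 \<le> n" using n_eq list_pos_ge[of N] by simp
  have S1: "1 \<le> S" using S by simp
  have p: "S \<le> S ^ 3" "S * S \<le> S ^ 3" using S1 by (simp_all add: power3_eq_cube)
  have S3: "S ^ 3 \<le> S ^ 3 * W" using W1 by simp
  have m3: "(4 + (4 + 12 * m) * m) * m \<le> 10 * S"
  proof -
    have "(4 + (4 + 12 * m) * m) * m = 4 * m + 4 * (m * m) + 12 * (m * (m * m))" by (simp add: algebra_simps)
    then show ?thesis using assms(2) mm mmm kk S by linarith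
  qed
  have "6 * ?M + 24 + nstate * (5 * ?M + 8) \<le> 18 * S + S * (9 * S)"
  proof (rule add_mono)
    show "6 * ?M + 24 \<le> 18 * S" using MS S4 by simp
    have "5 * ?M + 8 \<le> 9 * S" using MS S4 by simp
    with ns show "nstate * (5 * ?M + 8) \<le> S * (9 * S)" by (rule mult_le_mono)
  qed
  also have "\<dots> \<le> 27 * (S * S)" using S1 by simp
  finally have "nstate * 2 ^ nvar * (6 * ?M + 24 + nstate * (5 * ?M + 8)) \<le> S * W * (27 * (S * S))"
    using ns nw by (intro mult_le_mono) auto
  also have "\<dots> = 27 * (S ^ 3 * W)" by (simp add: power3_eq_cube)
  finally have "level_cost \<le> 8 + 10 * S + 27 * (S ^ 3 * W)" unfolding level_cost_def using m3 by linarith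
  then have lc: "level_cost \<le> 41 * (S ^ 3 * W)" using S p(1) S3 kk assms(3) by linarith
  have le: "N \<le> n" "list_pos N \<le> n" "length ps \<le> n" using n_eq list_pos_ge[of N] by simp_all
  have Z1: "S ^ 3 * W \<le> Z" "S * n \<le> Z" "n \<le> S * n"
    using n2 S1 mult_le_mono1[OF le_trans[OF p(1) S3], of n] by (simp_all add: Z_def)
  have "level_cost * N \<le> 41 * (S ^ 3 * W) * n" using lc le(1) by (rule mult_le_mono)
  then have 1: "level_cost * N \<le> 41 * Z" by (simp add: Z_def)
  have "k + 1 \<le> S" using S kk by linarith
  then have "(k + 1) * list_pos N \<le> S * n" using le(2) by (rule mult_le_mono)
  then have 2: "20 * (k + 1) * list_pos N \<le> 20 * Z" using Z1(2) by linarith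
  have "4 * ?M + 8 \<le> 8 * S" using MS S4 by simp
  with ns have "nstate * (4 * ?M + 8) \<le> S * (8 * S)" by (rule mult_le_mono)
  also have "\<dots> \<le> 8 * Z" using le_trans[OF p(2) le_trans[OF S3 Z1(1)]] by simp
  finally have 3: "nstate * (4 * ?M + 8) \<le> 8 * Z" .
  have "cost k m \<le> 140 * Z"
    unfolding cost_def using 1 2 3 le n2 Z1 mult_le_mono2[OF MS, of 5] mmm S p(1) S3 by linarith
  then show ?thesis by (simp add: Z_def W_def)
qed

end

section \<open>From encodings to graphs\<close>

lemma same_type_trans:
  assumes "simple_graph V E" "same_type E u v" "same_type E v w"
  shows "same_type E u w"
proof -
  have irr: "{x, x} \<notin> E" for x using assms(1) by (auto simp: simple_graph_def)
  have sym: "{x, y} \<in> E \<longleftrightarrow> {y, x} \<in> E" for x y by (simp add: insert_commute)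
  have uv: "{u, x} \<in> E \<and> x \<noteq> v \<longleftrightarrow> {v, x} \<in> E \<and> x \<noteq> u" for x
    using assms(2) by (auto simp: same_type_def nbhd_def set_eq_iff)
  have vw: "{v, x} \<in> E \<and> x \<noteq> w \<longleftrightarrow> {w, x} \<in> E \<and> x \<noteq> v" for x
    using assms(3) by (auto simp: same_type_def nbhd_def set_eq_iff)
  \<comment> \<open>The delicate neighbour is \<open>x = v\<close>, which neither assumption covers
    directly: an edge from \<open>u\<close> to \<open>v\<close> first gives one from
    \<open>w\<close> to \<open>u\<close>, by the type of \<open>v\<close> and \<open>w\<close>, and
    then one from \<open>v\<close> to \<open>w\<close>, by the type of \<open>u\<close> and
    \<open>v\<close>.\<close>
  have "{u, x} \<in> E \<and> x \<noteq> w \<longleftrightarrow> {w, x} \<in> E \<and> x \<noteq> u" for x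
    using uv[of x] vw[of x] uv[of w] vw[of u] irr sym by metis
  then show ?thesis by (auto simp: same_type_def nbhd_def set_eq_iff)
qed

lemma symmetric_pairs:
  fixes n :: nat
  assumes "\<And>i j. D i j = {} \<Longrightarrow> D j i = {}"
  shows "(\<forall>j\<in>{..<n}. \<forall>j'\<in>{..<n}. j \<noteq> j' \<longrightarrow> D j j' = {}) \<longleftrightarrow> \<not> (\<exists>j<n. \<exists>j'<j. D j j' \<noteq> {})"
proof
  assume "\<forall>j\<in>{..<n}. \<forall>j'\<in>{..<n}. j \<noteq> j' \<longrightarrow> D j j' = {}"
  then show "\<not> (\<exists>j<n. \<exists>j'<j. D j j' \<noteq> {})" by fastforce
next
  assume a: "\<not> (\<exists>j<n. \<exists>j'<j. D j j' \<noteq> {})"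
  show "\<forall>j\<in>{..<n}. \<forall>j'\<in>{..<n}. j \<noteq> j' \<longrightarrow> D j j' = {}"
  proof (intro ballI impI)
    fix j j' assume j: "j \<in> {..<n}" "j' \<in> {..<n}" "j \<noteq> j'"
    show "D j j' = {}"
    proof (cases "j' < j")
      case False
      then have "D j' j = {}" using a j by auto
      then show ?thesis by (rule assms)
    qed (use a j in auto)
  qed
qed

text \<open>Vertex numbers are carried over to \<open>V\<close> along the enumeration
  \<open>vs\<close>, which makes the computed classes an instance of \<open>typed_graph\<close> and
  \<open>start\<close> together with \<open>cv\<close> the rows of \<open>feasible\<close>. One
  halving round per vertex matches the bound \<open>2 ^ card V\<close>.\<close>

lemma main_decides:
  fixes V :: "'a set" and xs :: "nat list" and k :: nat
  assumes G: "simple_graph V E" and P: "P \<subseteq> V \<times> V" and nd: "nd_at_most V E k" and enc: "encodes xs V E P"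
    and k: "1 \<le> k"
  shows "rg (sem main (ini xs)) 1 \<noteq> 0 \<longleftrightarrow> has_disjoint_paths V E P"
    "tm (sem main (ini xs)) \<le> 140 * (((2 * k ^ 3 + 2) ^ (k\<^sup>2 + k)) ^ 3 * 2 ^ k ^ 3 * length xs)"
    "2 \<le> length xs" "\<forall>x\<in>set xs. x \<le> length xs"
proof -
  obtain vs adj ps where vs: "distinct vs" "set vs = V" and adj: "length adj = length vs"
    "\<And>i. i < length vs \<Longrightarrow> distinct (adj ! i)"
    "\<And>i. i < length vs \<Longrightarrow> set (adj ! i) = {j. j < length vs \<and> vs ! j \<in> nbhd E (vs ! i)}"
    and ps: "distinct ps" "set ps = {(i, j). i < length vs \<and> j < length vs \<and> (vs ! i, vs ! j) \<in> P}"
    and xs: "xs = length vs # concat (map (\<lambda>l. length l # l) adj) @ length ps # concat (map (\<lambda>(i, j). [i, j]) ps)"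
    using enc unfolding encodes_def by blast
  define N where "N = length vs"
  have edge: "w \<in> set (adj ! v) \<longleftrightarrow> w < N \<and> {vs ! v, vs ! w} \<in> E" if "v < N" for v w
    using adj(3) that by (simp add: N_def nbhd_def)
  have loop: "{x, x} \<notin> E" for x using G by (auto simp: simple_graph_def)
  have EV: "x \<in> V \<and> y \<in> V" if "{x, y} \<in> E" for x y using G that by (auto simp: simple_graph_def)
  have vsV: "vs ! v \<in> V" if "v < N" for v using that vs by (auto simp: N_def)
  have inj: "vs ! u = vs ! v \<longleftrightarrow> u = v" if "u < N" "v < N" for u v
    using that vs(1) by (simp add: N_def nth_eq_iff_index_eq)
  have ex: "\<exists>i<N. vs ! i = x" if "x \<in> V" for x using that vs by (auto simp: N_def in_set_conv_nth)
  have cardV: "card V = N" using distinct_card[OF vs(1)] vs(2) by (simp add: N_def)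
  interpret code_word adj ps xs N
  proof
    show "xs = N # concat (map (\<lambda>l. length l # l) adj) @ length ps # concat (map (\<lambda>(i, j). [i, j]) ps)"
      using xs by (simp add: N_def)
    show "N = length adj" using adj by (simp add: N_def)
    show "w < N" if "v < N" "w \<in> set (adj ! v)" for v w using edge that by simp
    show "distinct (adj ! v)" if "v < N" for v using adj(2) that by (simp add: N_def)
    show "v \<in> set (adj ! w)" if "v < N" "w \<in> set (adj ! v)" for v w
      using edge that by (simp add: insert_commute)
    show "v \<notin> set (adj ! v)" if "v < N" for v using edge[OF that] loop[of "vs ! v"] by simp
    show "i < N \<and> j < N" if "(i, j) \<in> set ps" for i j using ps(2) that by (simp add: N_def)
  qed
  have twin: "twin u v \<longleftrightarrow> same_type E (vs ! u) (vs ! v)" if uv: "u < N" "v < N" for u v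
  proof -
    have nb: "nbhd E (vs ! u) - {vs ! v} = (!) vs ` (set (adj ! u) - {v})" if "u < N" "v < N" for u v
    proof (intro set_eqI iffI)
      fix x assume x: "x \<in> nbhd E (vs ! u) - {vs ! v}"
      then obtain i where "i < N" "vs ! i = x" using ex EV by (auto simp: nbhd_def)
      then show "x \<in> (!) vs ` (set (adj ! u) - {v})" using x edge[OF that(1)] by (auto simp: nbhd_def)
    qed (use edge[OF that(1)] inj that in \<open>auto simp: nbhd_def\<close>)
    have "inj_on ((!) vs) {..<N}" using inj by (auto simp: inj_on_def)
    moreover have "set (adj ! u) - {v} \<subseteq> {..<N}" "set (adj ! v) - {u} \<subseteq> {..<N}" using adj_less uv by auto
    ultimately show ?thesis unfolding twin_def same_type_def nb[OF uv] nb[OF uv(2,1)]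
      by (simp add: inj_on_image_eq_iff)
  qed
  obtain PP where PP: "partition_on V PP" "finite PP" "card PP \<le> k"
    "\<And>A v v'. A \<in> PP \<Longrightarrow> v \<in> A \<Longrightarrow> v' \<in> A \<Longrightarrow> same_type E v v'"
    using nd unfolding nd_at_most_def by blast
  \<comment> \<open>Pairwise non-twin vertices lie in different blocks of the partition that
    witnesses the neighbourhood diversity. The hypothesis on the diversity enters only here.\<close>
  have bound: "card R \<le> k" if R: "R \<subseteq> {..<N}" "\<And>i j. i \<in> R \<Longrightarrow> j \<in> R \<Longrightarrow> twin i j \<Longrightarrow> i = j" for R
  proof -
    have "\<exists>A\<in>PP. vs ! i \<in> A" if "i \<in> R" for i
      using partition_onD1[OF PP(1)] vsV[of i] R(1) that by auto
    then obtain f where f: "\<And>i. i \<in> R \<Longrightarrow> f i \<in> PP \<and> vs ! i \<in> f i" by metis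
    have "inj_on f R"
    proof (rule inj_onI)
      fix i j assume ij: "i \<in> R" "j \<in> R" "f i = f j"
      then have "same_type E (vs ! i) (vs ! j)" using PP(4)[of "f i"] f by metis
      then show "i = j" using R twin[of i j] ij by auto
    qed
    then have "card R \<le> card PP" using f PP(2) by (intro card_inj_on_le[of f]) auto
    then show ?thesis using PP(3) by simp
  qed
  show "2 \<le> length xs" using n_eq list_pos_ge[of N] by simp
  show "\<forall>x\<in>set xs. x \<le> length xs" using xs_le by blast
  obtain m cls where m: "m \<le> k" and cls: "\<And>v. v < N \<Longrightarrow> cls v < m"
    and tw: "\<And>u v. u < N \<Longrightarrow> v < N \<Longrightarrow> cls u = cls v \<Longrightarrow> \<exists>r<N. twin u r \<and> twin v r"
    and res: "rg (sem main (ini xs)) 1 \<noteq> 0 \<longleftrightarrow> \<not> overlap \<and>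
       (\<exists>v\<in>(level (cv (ad cls) m) ({..<m} \<times> {..<m} \<times> {..<m}) ^^ N) {start cls m}. \<forall>i. 0 \<le> v i)"
    and tm: "tm (sem main (ini xs)) \<le> cost k m"
    using main_correct[of k, OF bound] by blast
  show "tm (sem main (ini xs)) \<le> 140 * (((2 * k ^ 3 + 2) ^ (k\<^sup>2 + k)) ^ 3 * 2 ^ k ^ 3 * length xs)"
    using tm cost_le[OF m k] by simp
  define idx where "idx x = (SOME i. i < N \<and> vs ! i = x)" for x
  have idx: "idx (vs ! i) = i" if "i < N" for i
    unfolding idx_def by (rule some_equality) (use that inj in auto)
  define cl where "cl x = cls (idx x)" for x
  have cl: "cl (vs ! i) = cls i" if "i < N" for i using idx[OF that] by (simp add: cl_def)
  interpret T: typed_graph V E cl m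
  proof
    show "simple_graph V E" by (rule G)
    show "cl v < m" if "v \<in> V" for v using ex[OF that] cl cls by auto
    show "same_type E u v" if uv: "u \<in> V" "v \<in> V" "cl u = cl v" for u v
    proof -
      obtain i j where i: "i < N" "vs ! i = u" and j: "j < N" "vs ! j = v" using ex uv by metis
      then have "cls i = cls j" using cl uv by auto
      then obtain r where r: "r < N" "twin i r" "twin j r" using tw i j by blast
      have "same_type E u (vs ! r)" "same_type E v (vs ! r)" using twin r i j by auto
      then have "same_type E (vs ! r) v" by (simp add: same_type_def)
      with \<open>same_type E u (vs ! r)\<close> show ?thesis by (rule same_type_trans[OF G])
    qed
  qed
  have AD: "ad cls a b \<longleftrightarrow> T.AD a b" for a b
  proof
    assume "ad cls a b"
    then obtain u w where "u < N" "w \<in> set (adj ! u)" "cls u = a" "cls w = b" by (auto simp: ad_def)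
    then show "T.AD a b" using T.AD_edge[of "vs ! u" "vs ! w"] edge vsV cl by auto
  next
    assume "T.AD a b"
    then obtain x y where xy: "x \<in> V" "y \<in> V" "{x, y} \<in> E" "cl x = a" "cl y = b" by (auto simp: T.AD_def)
    then obtain u w where u: "u < N" "vs ! u = x" and w: "w < N" "vs ! w = y" using ex by metis
    then have "w \<in> set (adj ! u)" using edge xy by simp
    moreover have "cls u = a" "cls w = b" using cl u w xy by auto
    ultimately show "ad cls a b" using u unfolding ad_def by blast
  qed
  have Pps: "P = (\<lambda>j. (vs ! fst (ps ! j), vs ! snd (ps ! j))) ` {..<length ps}" (is "P = ?f ` _")
  proof (intro set_eqI iffI)
    fix z assume z: "z \<in> P"
    then obtain i i' where i: "i < N" "i' < N" "z = (vs ! i, vs ! i')" using P ex by (cases z) blast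
    then have "(i, i') \<in> set ps" using z ps(2) by (simp add: N_def)
    then obtain j where "j < length ps" "ps ! j = (i, i')" by (auto simp: in_set_conv_nth)
    then show "z \<in> ?f ` {..<length ps}" using i by (intro image_eqI[of _ _ j]) auto
  next
    fix z assume "z \<in> ?f ` {..<length ps}"
    then obtain j where j: "j < length ps" "z = ?f j" by auto
    obtain i i' where e: "ps ! j = (i, i')" by (metis prod.exhaust)
    have "(i, i') \<in> set ps" using nth_mem[OF j(1)] e by simp
    then have "(vs ! i, vs ! i') \<in> P" unfolding ps(2) by simp
    then show "z \<in> P" using j(2) e by simp
  qed
  have psN: "fst (ps ! j) < N" "snd (ps ! j) < N" if "j < length ps" for j
    using ps_less[of "fst (ps ! j)" "snd (ps ! j)"] that by simp_all
  \<comment> \<open>As \<open>ps\<close> has no repetitions, its positions correspond to the pairs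
    of \<open>P\<close>, so sums and disjointness conditions over \<open>P\<close> can be read over
    positions.\<close>
  have injf: "inj_on ?f {..<length ps}"
  proof (rule inj_onI)
    fix j j' assume j: "j \<in> {..<length ps}" "j' \<in> {..<length ps}" "?f j = ?f j'"
    then have "fst (ps ! j) = fst (ps ! j')" "snd (ps ! j) = snd (ps ! j')"
      using psN inj by (simp_all only: prod.inject lessThan_iff)
    then have "ps ! j = ps ! j'" by (rule prod_eqI)
    then show "j = j'" using j ps(1) by (simp add: nth_eq_iff_index_eq)
  qed
  have sep: "separated P \<longleftrightarrow> \<not> overlap"
  proof -
    have meet: "{fst (?f j), snd (?f j)} \<inter> {fst (?f j'), snd (?f j')} = {} \<longleftrightarrow>
        {fst (ps ! j), snd (ps ! j)} \<inter> {fst (ps ! j'), snd (ps ! j')} = {}" if "j < length ps" "j' < length ps" for j j'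
      using psN[OF that(1)] psN[OF that(2)] inj by auto
    have "separated P \<longleftrightarrow> (\<forall>j\<in>{..<length ps}. \<forall>j'\<in>{..<length ps}. ?f j \<noteq> ?f j' \<longrightarrow>
        {fst (?f j), snd (?f j)} \<inter> {fst (?f j'), snd (?f j')} = {})"
      unfolding separated_def Pps ball_simps(9) ..
    also have "\<dots> \<longleftrightarrow> (\<forall>j\<in>{..<length ps}. \<forall>j'\<in>{..<length ps}. j \<noteq> j' \<longrightarrow>
        {fst (ps ! j), snd (ps ! j)} \<inter> {fst (ps ! j'), snd (ps ! j')} = {})"
      by (intro ball_cong refl) (simp only: meet inj_on_eq_iff[OF injf] lessThan_iff)
    also have "\<dots> \<longleftrightarrow> \<not> overlap"
      unfolding overlap_def by (rule symmetric_pairs) (simp only: Int_commute)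
    finally show ?thesis .
  qed
  have terms: "vs ! v \<in> terms P \<longleftrightarrow> terminal v" if "v < N" for v
  proof -
    have "vs ! v \<in> terms P \<longleftrightarrow> (\<exists>j\<in>{..<length ps}. vs ! v = vs ! fst (ps ! j) \<or> vs ! v = vs ! snd (ps ! j))"
      unfolding Pps terms_def image_image by (simp add: image_iff) blast
    also have "\<dots> \<longleftrightarrow> (\<exists>j\<in>{..<length ps}. v = fst (ps ! j) \<or> v = snd (ps ! j))"
      by (intro bex_cong refl) (simp only: inj[OF that psN(1)] inj[OF that psN(2)] lessThan_iff)
    finally show ?thesis by (simp add: terminal_def Bex_def)
  qed
  have demand: "T.demand P a b = int (dem cls (ad cls) (length ps) a b)" for a b
    unfolding T.demand_def Pps sum.reindex[OF injf] dem_def AD of_nat_sum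
    by (intro sum.cong refl) (simp add: psN inj cl)
  have stock: "T.stock (V - terms P) c = int (card {v \<in> {..<N}. \<not> terminal v \<and> cls v = c})" for c
  proof -
    have "{v \<in> V - terms P. cl v = c} = (!) vs ` {v \<in> {..<N}. \<not> terminal v \<and> cls v = c}"
    proof (intro set_eqI iffI)
      fix x assume x: "x \<in> {v \<in> V - terms P. cl v = c}"
      then obtain i where i: "i < N" "vs ! i = x" using ex by blast
      then show "x \<in> (!) vs ` {v \<in> {..<N}. \<not> terminal v \<and> cls v = c}"
        using x terms[of i] cl[of i] by (intro image_eqI[of _ _ i]) auto
    next
      fix x assume "x \<in> (!) vs ` {v \<in> {..<N}. \<not> terminal v \<and> cls v = c}"
      then obtain i where "i < N" "x = vs ! i" "\<not> terminal i" "cls i = c" by auto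
      then show "x \<in> {v \<in> V - terms P. cl v = c}" using terms[of i] cl[of i] vsV[of i] by simp
    qed
    moreover have "inj_on ((!) vs) {v \<in> {..<N}. \<not> terminal v \<and> cls v = c}" using inj by (auto simp: inj_on_def)
    ultimately show ?thesis by (simp add: T.stock_def card_image)
  qed
  let ?col = "cv (ad cls) m"
  have colD: "T.colD x a b = ?col x (m * a + b)" if "x \<in> T.X" "a < m" "b < m" for x a b
  proof -
    obtain a' b' c' where x: "x = (a', b', c')" by (cases x)
    then have lt: "a' < m" "b' < m" "c' < m" using that by (auto simp: T.X_def)
    show ?thesis
      using lt that idx_less[of a m b] by (auto simp: x T.colD_def T.usable_def cv_def AD idx_eq)
  qed
  have colF: "T.colF x c = ?col x (m * m + c)" if "x \<in> T.X" "c < m" for x c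
  proof -
    obtain a' b' c' where x: "x = (a', b', c')" by (cases x)
    then have lt: "a' < m" "b' < m" "c' < m" using that by (auto simp: T.X_def)
    show ?thesis
      using lt that idx_less[of a' m b'] idx_less[of c' m b'] by (auto simp: x T.colF_def T.usable_def cv_def AD)
  qed
  have feasible: "T.feasible P (V - terms P) y \<longleftrightarrow> (\<forall>i. 0 \<le> start cls m i + (\<Sum>x\<in>T.X. int (y x) * ?col x i))" for y
  proof
    assume f: "T.feasible P (V - terms P) y"
    show "\<forall>i. 0 \<le> start cls m i + (\<Sum>x\<in>T.X. int (y x) * ?col x i)"
    proof
      fix i
      consider (d) "i < m * m" | (c) "m * m \<le> i" "i < m * m + m" | (z) "m * m + m \<le> i" by linarith
      then show "0 \<le> start cls m i + (\<Sum>x\<in>T.X. int (y x) * ?col x i)"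
      proof cases
        case d
        then have "0 < m" by (cases m) auto
        then have ab: "i div m < m" "i mod m < m" using d by (simp_all add: less_mult_imp_div_less)
        have "0 \<le> - T.demand P (i div m) (i mod m) + (\<Sum>x\<in>T.X. int (y x) * T.colD x (i div m) (i mod m))"
          using f ab unfolding T.feasible_def by blast
        then show ?thesis using colD[OF _ ab] d by (simp add: demand start_def)
      next
        case c
        then have j: "i = m * m + (i - m * m)" "i - m * m < m" by simp_all
        have "0 \<le> T.stock (V - terms P) (i - m * m) + (\<Sum>x\<in>T.X. int (y x) * T.colF x (i - m * m))"
          using f j(2) unfolding T.feasible_def by blast
        then show ?thesis using colF[OF _ j(2)] c by (simp add: stock start_def)
      next
        case z
        then show ?thesis by (simp add: start_def cv_zero)
      qed
    qed
  next
    assume f: "\<forall>i. 0 \<le> start cls m i + (\<Sum>x\<in>T.X. int (y x) * ?col x i)"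
    have "0 \<le> - T.demand P a b + (\<Sum>x\<in>T.X. int (y x) * T.colD x a b)" if "a < m" "b < m" for a b
      using f[rule_format, of "m * a + b"] colD[OF _ that] idx_less[OF that] that by (simp add: demand start_def)
    moreover have "0 \<le> T.stock (V - terms P) c + (\<Sum>x\<in>T.X. int (y x) * T.colF x c)" if "c < m" for c
      using f[rule_format, of "m * m + c"] colF[OF _ that] that by (simp add: stock start_def)
    ultimately show "T.feasible P (V - terms P) y" unfolding T.feasible_def by blast
  qed
  have "has_disjoint_paths V E P \<longleftrightarrow> \<not> overlap \<and>
      (\<exists>v\<in>{start cls m}. \<exists>y. (\<forall>x. y x < 2 ^ N) \<and> (\<forall>i. 0 \<le> v i + (\<Sum>x\<in>T.X. int (y x) * ?col x i)))"
    unfolding T.disjoint_paths_iff[OF P] sep feasible cardV by auto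
  also have "\<dots> \<longleftrightarrow> \<not> overlap \<and> (\<exists>v\<in>(level ?col T.X ^^ N) {start cls m}. \<forall>i. 0 \<le> v i)"
    unfolding doubling[OF T.finite_X] ..
  finally show "rg (sem main (ini xs)) 1 \<noteq> 0 \<longleftrightarrow> has_disjoint_paths V E P"
    using res by (simp add: T.X_def)
qed

section \<open>The bound in terms of q\<close>

lemma nd_cost_le:
  fixes k :: nat
  assumes "1 \<le> k"
  defines "q \<equiv> k\<^sup>2 * 2 ^ k"
  shows "((2 * k ^ 3 + 2) ^ (k\<^sup>2 + k)) ^ 3 * 2 ^ k ^ 3 \<le> q ^ (24 * k\<^sup>2 + q)"
proof -
  have k2: "k \<le> k\<^sup>2" "1 \<le> k\<^sup>2" using assms(1) by (simp_all add: power2_eq_square)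
  \<comment> \<open>This gives both \<open>2 \<le> q\<close> and \<open>k ^ 3 \<le> q\<close>, the
    latter because \<open>k ^ 3\<close> is \<open>k\<^sup>2 * k\<close>.\<close>
  have "2 * k \<le> 2 ^ k"
    using assms(1)
  proof (induction k rule: dec_induct)
    case (step j)
    have "2 \<le> (2::nat) ^ j" using step(1) self_le_power[of 2 j] by simp
    then show ?case using step(3) by simp
  qed simp
  then have q: "2 \<le> q" "k ^ 3 \<le> q"
    using k2 assms(1) mult_le_mono[of 1 "k\<^sup>2" 2 "2 ^ k"] mult_le_mono2[of k "2 ^ k" "k\<^sup>2"]
    by (simp_all add: q_def power3_eq_cube power2_eq_square mult.assoc)
  \<comment> \<open>The final 24 is 4 * 2 * 3: the base is at most \<open>q ^ 4\<close>, the
    exponent \<open>k\<^sup>2 + k\<close> at most \<open>2 * k\<^sup>2\<close>, and the whole is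
    cubed.\<close>
  have "2 * k ^ 3 + 2 \<le> 4 * k ^ 3" using assms(1) by simp
  also have "\<dots> \<le> q ^ 2 * q" using q mult_le_mono[of 4 "q ^ 2" "k ^ 3" q] power_mono[of 2 q 2] by simp
  also have "\<dots> \<le> q ^ 4" using q power_increasing[of 3 4 q] by (simp add: power_numeral_reduce)
  finally have "(2 * k ^ 3 + 2) ^ (k\<^sup>2 + k) \<le> (q ^ 4) ^ (k\<^sup>2 + k)" by (rule power_mono) simp
  also have "\<dots> = q ^ (4 * (k\<^sup>2 + k))" by (rule power_mult[symmetric])
  also have "\<dots> \<le> q ^ (8 * k\<^sup>2)" using q k2 by (intro power_increasing) auto
  finally have "((2 * k ^ 3 + 2) ^ (k\<^sup>2 + k)) ^ 3 \<le> (q ^ (8 * k\<^sup>2)) ^ 3" by (rule power_mono) simp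
  also have "\<dots> = q ^ (24 * k\<^sup>2)" by (simp flip: power_mult)
  finally have 1: "((2 * k ^ 3 + 2) ^ (k\<^sup>2 + k)) ^ 3 \<le> q ^ (24 * k\<^sup>2)" .
  have "(2::nat) ^ k ^ 3 \<le> 2 ^ q" using q by (intro power_increasing) auto
  also have "\<dots> \<le> q ^ q" using q by (intro power_mono) auto
  finally have "((2 * k ^ 3 + 2) ^ (k\<^sup>2 + k)) ^ 3 * 2 ^ k ^ 3 \<le> q ^ (24 * k\<^sup>2) * q ^ q"
    using 1 by (rule mult_le_mono[rotated])
  then show ?thesis by (simp add: power_add)
qed

text \<open>Since \<open>2 ^ k \<le> q\<close>, the parameter \<open>k\<close> is at most the binary
  logarithm of \<open>q\<close>, so the exponent \<open>24 * k\<^sup>2\<close> is polylogarithmic in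
  \<open>q\<close> and goes into the lower-order term. The main exponent \<open>q\<close> leaves a
  margin below \<open>5 / 2 * real q\<close>.\<close>

lemma nd_cost_powr:
  fixes k :: nat
  assumes "1 \<le> k"
  defines "q \<equiv> k\<^sup>2 * 2 ^ k"
  shows "real (((2 * k ^ 3 + 2) ^ (k\<^sup>2 + k)) ^ 3 * 2 ^ k ^ 3) \<le> real q powr (5 / 2 * real q + 24 * (log 2 (real q))\<^sup>2)"
proof -
  have q: "2 ^ k \<le> q" "1 \<le> q" using assms(1) by (simp_all add: q_def)
  have "real k = log 2 (2 ^ k)" by simp
  also have "\<dots> \<le> log 2 (real q)" using q of_nat_mono[OF q(1), where 'a = real] by (subst log_le_cancel_iff) auto
  finally have k: "(real k)\<^sup>2 \<le> (log 2 (real q))\<^sup>2" by (rule power_mono) simp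
  have "real (((2 * k ^ 3 + 2) ^ (k\<^sup>2 + k)) ^ 3 * 2 ^ k ^ 3) \<le> real (q ^ (24 * k\<^sup>2 + q))"
    using nd_cost_le[OF assms(1)] unfolding q_def by (rule of_nat_mono)
  also have "\<dots> = real q powr real (24 * k\<^sup>2 + q)"
    unfolding of_nat_power by (rule powr_realpow[symmetric]) (use q in simp)
  also have "\<dots> \<le> real q powr (5 / 2 * real q + 24 * (log 2 (real q))\<^sup>2)"
  proof (rule powr_mono)
    show "real (24 * k\<^sup>2 + q) \<le> 5 / 2 * real q + 24 * (log 2 (real q))\<^sup>2"
      unfolding of_nat_add of_nat_mult of_nat_power of_nat_numeral using k of_nat_0_le_iff[of q, where 'a = real] by linarith
  qed (use q in simp)
  finally show ?thesis .
qed

text \<open>30 exceeds every variable number in use, the largest being 26, and no assignment adds or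
  stores a constant larger than 1.\<close>

lemma main_wf: "wfc 30 main" "csafe 1 main"
  by (simp_all add: main_def locate_lists_def classify_def mark_neighbours_def find_type_def compare_lists_def connect_types_def fill_state_def read_pairs_def read_pair_def count_free_def
      run_levels_def run_level_def branch_all_def branch_column_def branch_state_def copy_state_def apply_column_def halve_all_def halve_state_def find_duplicate_def compare_states_def accept_states_def test_state_def
      For_def Inc_def Eq_def KA_def)

theorem theorem5:
  "\<exists>(prog :: instr list) (c :: nat) (C :: real) (g :: nat \<Rightarrow> real).
     g \<in> o(\<lambda>q. real q) \<and>
     (\<forall>(k :: nat) (V :: nat set) (E :: nat set set) (P :: (nat \<times> nat) set) (xs :: nat list).
        k \<ge> 1 \<and> simple_graph V E \<and> P \<subseteq> V \<times> V \<and> nd_at_most V E k \<and> encodes xs V E P \<longrightarrow>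
        (let q = k\<^sup>2 * 2 ^ k; n = length xs in
         \<exists>t. decides_in prog c xs (has_disjoint_paths V E P) t \<and>
             real t \<le> C * real q powr (5 / 2 * real q + g q) * real n))"
proof (intro exI conjI allI impI)
  \<comment> \<open>The factor required by \<open>compile_decides\<close> for \<kappa> = 1.\<close>
  define A where "A = csize main 30 + 1 + 20"
  show "(\<lambda>q. 24 * (log 2 (real q))\<^sup>2) \<in> o(\<lambda>q. real q)" by real_asymp
  fix k :: nat and V :: "nat set" and E P and xs :: "nat list"
  assume "k \<ge> 1 \<and> simple_graph V E \<and> P \<subseteq> V \<times> V \<and> nd_at_most V E k \<and> encodes xs V E P"
  then have a: "k \<ge> 1" "simple_graph V E" "P \<subseteq> V \<times> V" "nd_at_most V E k" "encodes xs V E P" by auto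
  define q where "q = k\<^sup>2 * 2 ^ k"
  define F where "F = ((2 * k ^ 3 + 2) ^ (k\<^sup>2 + k)) ^ 3 * 2 ^ k ^ 3"
  \<comment> \<open>141 is the 140 of the time bound plus 1 for the summand \<open>length xs\<close>
    that pays for copying the input.\<close>
  define t where "t = A * (141 * (F * length xs))"
  note D = main_decides[OF a(2-5,1)]
  have "1 \<le> F" by (simp add: F_def)
  then have "length xs \<le> F * length xs" by simp
  then have "A * (tm (sem main (ini xs)) + length xs) \<le> t"
    unfolding t_def using D(2)[folded F_def] by (intro mult_le_mono2) linarith
  then have "decides_in (compile 30 main) (cesz main + 8) xs (rg (sem main (ini xs)) 1 \<noteq> 0) t"
    using compile_decides[OF main_wf(1) _ main_wf(2) D(3,4)] by (simp add: A_def)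
  moreover have "real t \<le> real (A * 141) * real q powr (5 / 2 * real q + 24 * (log 2 (real q))\<^sup>2) * real (length xs)"
  proof -
    have "real t = real (A * 141) * real F * real (length xs)" by (simp add: t_def)
    also have "\<dots> \<le> real (A * 141) * real q powr (5 / 2 * real q + 24 * (log 2 (real q))\<^sup>2) * real (length xs)"
      using nd_cost_powr[OF a(1)] by (intro mult_right_mono mult_left_mono) (simp_all add: F_def q_def)
    finally show ?thesis .
  qed
  ultimately show "let q = k\<^sup>2 * 2 ^ k; n = length xs in
         \<exists>t. decides_in (compile 30 main) (cesz main + 8) xs (has_disjoint_paths V E P) t \<and>
             real t \<le> real ((csize main 30 + 1 + 20) * 141) * real q powr (5 / 2 * real q + 24 * (log 2 (real q))\<^sup>2) * real n"
    unfolding Let_def q_def[symmetric] D(1) A_def[symmetric] by blast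
qed

end
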